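(* Let $p$ be a prime and $k$ a field of characteristic $p$. Let $P$ be a non-trivial finite abelian $p$-group and $E$ a $p'$-group acting on $P$. Suppose that $[P,E]=P$, that $C_E(P)\leq \mathrm{Z}(E)$ and that $E/C_E(P)$ is abelian. Then every class in $\mathrm{HH}^1(k(P\rtimes E))$ is represented by a derivation on $k(P\rtimes E)$ with image contained in the Jacobson radical $J(k(P\rtimes E))$. If the semisimple $\mathbb{F}_pE$-module $P/\Phi(P)$ is multiplicity free, then the Lie algebra $\mathrm{HH}^1(k(P\rtimes E))$ is solvable. Conversely, if $p$ is odd and $\mathrm{HH}^1(k(P\rtimes E))$ is solvable, then the $\mathbb{F}_pE$-module $P/\Phi(P)$ is multiplicity free.
   Context: A $p'$-group is a finite group of order prime to $p$. $C_E(P)$ is the kernel of the action of $E$ on $P$ and $\mathrm{Z}(E)$ is the center of $E$. $[P,E]$ is the subgroup of $P$ generated by all elements $({}^eu)u^{-1}$ with $u\in P$, $e\in E$. $\Phi(P)$ is the Frattini subgroup, the smallest normal subgroup of $P$ with elementary abelian quotient; the action of $E$ makes $P/\Phi(P)$ a semisimple $\mathbb{F}_pE$-module. A semisimple module is multiplicity free if it is a direct sum of pairwise non-isomorphic simple modules. For a $k$-algebra $A$, $\mathrm{HH}^1(A)=\mathrm{Der}(A)/\mathrm{IDer}(A)$ ($k$-linear derivations modulo inner derivations), with Lie bracket induced by $[f,g]=f\circ g-g\circ f$. *)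

theory Defs
  imports "HOL-Algebra.Algebra" "HOL-Algebra.Algebraic_Closure_Type" "HOL-Number_Theory.Residues"
begin

section \<open>Groups\<close>

definition group_center :: "('g, 'm) monoid_scheme \<Rightarrow> 'g set" where
  "group_center G = {z \<in> carrier G. \<forall>g\<in>carrier G. z \<otimes>\<^bsub>G\<^esub> g = g \<otimes>\<^bsub>G\<^esub> z}"

text \<open>Throughout, an action of \<open>E\<close> on \<open>P\<close> by group automorphisms is a homomorphism
  \<open>\<phi>\<close> from \<open>E\<close> to the library's \<^const>\<open>AutoGroup\<close> of \<open>P\<close>, with \<open>\<phi> e u\<close> for the
  image of \<open>u\<close> under \<open>e\<close>.\<close>

definition semidirect_product ::
    "('a, 'm) monoid_scheme \<Rightarrow> ('b, 'n) monoid_scheme \<Rightarrow> ('b \<Rightarrow> 'a \<Rightarrow> 'a) \<Rightarrow> ('a \<times> 'b) monoid" where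
  "semidirect_product P E \<phi> =
    \<lparr>carrier = carrier P \<times> carrier E,
     monoid.mult = (\<lambda>(u, e) (v, f). (u \<otimes>\<^bsub>P\<^esub> \<phi> e v, e \<otimes>\<^bsub>E\<^esub> f)),
     one = (\<one>\<^bsub>P\<^esub>, \<one>\<^bsub>E\<^esub>)\<rparr>"

definition action_commutator ::
    "('a, 'm) monoid_scheme \<Rightarrow> ('b, 'n) monoid_scheme \<Rightarrow> ('b \<Rightarrow> 'a \<Rightarrow> 'a) \<Rightarrow> 'a set" where
  "action_commutator P E \<phi> =
    generate P {\<phi> e u \<otimes>\<^bsub>P\<^esub> inv\<^bsub>P\<^esub> u | u e. u \<in> carrier P \<and> e \<in> carrier E}"

definition elementary_abelian :: "nat \<Rightarrow> ('g, 'm) monoid_scheme \<Rightarrow> bool" where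
  "elementary_abelian p G \<longleftrightarrow> comm_group G \<and> (\<forall>x\<in>carrier G. x [^]\<^bsub>G\<^esub> p = \<one>\<^bsub>G\<^esub>)"

text \<open>For a finite \<open>p\<close>-group this intersection is itself one of the subgroups intersected, hence
  the smallest of them.\<close>

definition frattini :: "nat \<Rightarrow> ('g, 'm) monoid_scheme \<Rightarrow> 'g set" where
  "frattini p P = \<Inter>{N. N \<lhd> P \<and> elementary_abelian p (P Mod N)}"


section \<open>Modules over a group algebra\<close>

text \<open>A module over the group algebra \<open>KG\<close> is given by a \<open>K\<close>-module \<open>V\<close> together with a map
  \<open>\<rho>\<close> such that \<open>G\<close> acts \<open>K\<close>-linearly on \<open>V\<close> by \<open>\<rho> g\<close>. Submodules are represented
  by their carriers.\<close>

definition subrep ::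
    "('c, 'm) ring_scheme \<Rightarrow> ('g, 'n) monoid_scheme \<Rightarrow> ('c, 'v, 'l) module_scheme \<Rightarrow>
     ('g \<Rightarrow> 'v \<Rightarrow> 'v) \<Rightarrow> 'v set \<Rightarrow> bool" where
  "subrep K G V \<rho> W \<longleftrightarrow> submodule W K V \<and> (\<forall>g\<in>carrier G. \<forall>w\<in>W. \<rho> g w \<in> W)"

definition simple_subrep ::
    "('c, 'm) ring_scheme \<Rightarrow> ('g, 'n) monoid_scheme \<Rightarrow> ('c, 'v, 'l) module_scheme \<Rightarrow>
     ('g \<Rightarrow> 'v \<Rightarrow> 'v) \<Rightarrow> 'v set \<Rightarrow> bool" where
  "simple_subrep K G V \<rho> W \<longleftrightarrow>
    subrep K G V \<rho> W \<and> W \<noteq> {\<zero>\<^bsub>V\<^esub>} \<and>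
    (\<forall>U. subrep K G V \<rho> U \<and> U \<subseteq> W \<longrightarrow> U = {\<zero>\<^bsub>V\<^esub>} \<or> U = W)"

definition isomorphic_subreps ::
    "('c, 'm) ring_scheme \<Rightarrow> ('g, 'n) monoid_scheme \<Rightarrow> ('c, 'v, 'l) module_scheme \<Rightarrow>
     ('g \<Rightarrow> 'v \<Rightarrow> 'v) \<Rightarrow> 'v set \<Rightarrow> 'v set \<Rightarrow> bool" where
  "isomorphic_subreps K G V \<rho> W W' \<longleftrightarrow>
    (\<exists>f. bij_betw f W W' \<and>
      (\<forall>x\<in>W. \<forall>y\<in>W. f (x \<oplus>\<^bsub>V\<^esub> y) = f x \<oplus>\<^bsub>V\<^esub> f y) \<and>
      (\<forall>c\<in>carrier K. \<forall>x\<in>W. f (c \<odot>\<^bsub>V\<^esub> x) = c \<odot>\<^bsub>V\<^esub> f x) \<and>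
      (\<forall>g\<in>carrier G. \<forall>x\<in>W. f (\<rho> g x) = \<rho> g (f x)))"

text \<open>The last conjunct says that \<open>V\<close> is the internal direct sum of the members of \<open>\<S>\<close>.\<close>

definition multiplicity_free ::
    "('c, 'm) ring_scheme \<Rightarrow> ('g, 'n) monoid_scheme \<Rightarrow> ('c, 'v, 'l) module_scheme \<Rightarrow>
     ('g \<Rightarrow> 'v \<Rightarrow> 'v) \<Rightarrow> bool" where
  "multiplicity_free K G V \<rho> \<longleftrightarrow>
    (\<exists>\<S>. finite \<S> \<and>
      (\<forall>W\<in>\<S>. simple_subrep K G V \<rho> W) \<and>
      (\<forall>W\<in>\<S>. \<forall>W'\<in>\<S>. W \<noteq> W' \<longrightarrow> \<not> isomorphic_subreps K G V \<rho> W W') \<and>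
      (\<forall>v\<in>carrier V. \<exists>!c. c \<in> (\<Pi>\<^sub>E W\<in>\<S>. W) \<and> v = finsum V c \<S>))"

text \<open>\<open>P/\<Phi>(P)\<close> as a vector space over the field \<open>residue_ring p\<close> of \<open>p\<close> elements, written
  additively: scalars act by taking powers. The multiplicative part of the record is not used.\<close>

definition frattini_quotient :: "nat \<Rightarrow> ('a, 'm) monoid_scheme \<Rightarrow> (int, 'a set) module" where
  "frattini_quotient p P = (let Q = P Mod frattini p P in
    \<lparr>carrier = carrier Q, monoid.mult = undefined, one = undefined,
     ring.zero = \<one>\<^bsub>Q\<^esub>, add = (\<otimes>\<^bsub>Q\<^esub>), module.smult = (\<lambda>c C. C [^]\<^bsub>Q\<^esub> c)\<rparr>)"

definition induced_action :: "('b \<Rightarrow> 'a \<Rightarrow> 'a) \<Rightarrow> 'b \<Rightarrow> 'a set \<Rightarrow> 'a set" where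
  "induced_action \<phi> e C = \<phi> e ` C"

definition frattini_quotient_multiplicity_free ::
    "nat \<Rightarrow> ('a, 'm) monoid_scheme \<Rightarrow> ('b, 'n) monoid_scheme \<Rightarrow> ('b \<Rightarrow> 'a \<Rightarrow> 'a) \<Rightarrow> bool" where
  "frattini_quotient_multiplicity_free p P E \<phi> \<longleftrightarrow>
    multiplicity_free (residue_ring (int p)) E (frattini_quotient p P) (induced_action \<phi>)"


section \<open>Algebras over a field\<close>

text \<open>The ground field is a type \<open>'k\<close> of class \<^class>\<open>field\<close>; an algebra over it is a record
  of type \<open>('k, 'a, 'm) module_scheme\<close>, which need not be commutative.\<close>

text \<open>The group algebra of a finite group: functions on \<open>G\<close>, extended by \<open>0\<close>, with
  convolution as multiplication.\<close>

definition group_algebra ::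
    "'k::field itself \<Rightarrow> ('g, 'm) monoid_scheme \<Rightarrow> ('k, 'g \<Rightarrow> 'k) module" where
  "group_algebra _ G =
    \<lparr>carrier = {a. \<forall>x. x \<notin> carrier G \<longrightarrow> a x = 0},
     monoid.mult = (\<lambda>a b x. if x \<in> carrier G
                     then \<Sum>y\<in>carrier G. a y * b (inv\<^bsub>G\<^esub> y \<otimes>\<^bsub>G\<^esub> x) else 0),
     one = (\<lambda>x. if x = \<one>\<^bsub>G\<^esub> then 1 else 0),
     ring.zero = (\<lambda>x. 0),
     add = (\<lambda>a b x. a x + b x),
     module.smult = (\<lambda>c a x. c * a x)\<rparr>"

definition left_ideal :: "'a set \<Rightarrow> ('a, 'm) ring_scheme \<Rightarrow> bool" where
  "left_ideal I R \<longleftrightarrow> additive_subgroup I R \<and> (\<forall>r\<in>carrier R. \<forall>x\<in>I. r \<otimes>\<^bsub>R\<^esub> x \<in> I)"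

definition maximal_left_ideal :: "'a set \<Rightarrow> ('a, 'm) ring_scheme \<Rightarrow> bool" where
  "maximal_left_ideal I R \<longleftrightarrow>
    left_ideal I R \<and> I \<noteq> carrier R \<and>
    (\<forall>J. left_ideal J R \<and> I \<subseteq> J \<longrightarrow> J = I \<or> J = carrier R)"

definition jacobson_radical :: "('a, 'm) ring_scheme \<Rightarrow> 'a set" where
  "jacobson_radical R = carrier R \<inter> \<Inter>{I. maximal_left_ideal I R}"


section \<open>Lie algebras and the first Hochschild cohomology\<close>

text \<open>A Lie algebra over \<open>'k\<close> is stored in the library's \<open>module\<close> record, the field
  \<open>mult\<close> holding the Lie bracket. The field \<open>one\<close> is not used. This makes the library's cosets,
  \<^const>\<open>A_RCOSETS\<close>, \<^const>\<open>set_add\<close> and \<^const>\<open>rcoset_mult\<close> available for quotients.\<close>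

text \<open>Derivations are extensional functions on the carrier, so that they are determined by their
  values there.\<close>

definition derivations :: "('k::field, 'a, 'm) module_scheme \<Rightarrow> ('a \<Rightarrow> 'a) set" where
  "derivations A = {d \<in> carrier A \<rightarrow>\<^sub>E carrier A.
     (\<forall>x\<in>carrier A. \<forall>y\<in>carrier A. d (x \<oplus>\<^bsub>A\<^esub> y) = d x \<oplus>\<^bsub>A\<^esub> d y) \<and>
     (\<forall>c. \<forall>x\<in>carrier A. d (c \<odot>\<^bsub>A\<^esub> x) = c \<odot>\<^bsub>A\<^esub> d x) \<and>
     (\<forall>x\<in>carrier A. \<forall>y\<in>carrier A.
        d (x \<otimes>\<^bsub>A\<^esub> y) = (d x \<otimes>\<^bsub>A\<^esub> y) \<oplus>\<^bsub>A\<^esub> (x \<otimes>\<^bsub>A\<^esub> d y))}"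

definition inner_derivations :: "('k::field, 'a, 'm) module_scheme \<Rightarrow> ('a \<Rightarrow> 'a) set" where
  "inner_derivations A =
    {\<lambda>x\<in>carrier A. (a \<otimes>\<^bsub>A\<^esub> x) \<ominus>\<^bsub>A\<^esub> (x \<otimes>\<^bsub>A\<^esub> a) | a. a \<in> carrier A}"

definition Der :: "('k::field, 'a, 'm) module_scheme \<Rightarrow> ('k, 'a \<Rightarrow> 'a) module" where
  "Der A =
    \<lparr>carrier = derivations A,
     monoid.mult = (\<lambda>f g. \<lambda>x\<in>carrier A. f (g x) \<ominus>\<^bsub>A\<^esub> g (f x)),
     one = undefined,
     ring.zero = (\<lambda>x\<in>carrier A. \<zero>\<^bsub>A\<^esub>),
     add = (\<lambda>f g. \<lambda>x\<in>carrier A. f x \<oplus>\<^bsub>A\<^esub> g x),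
     module.smult = (\<lambda>c f. \<lambda>x\<in>carrier A. c \<odot>\<^bsub>A\<^esub> f x)\<rparr>"

definition lie_quotient :: "('k::field, 'l, 'm) module_scheme \<Rightarrow> 'l set \<Rightarrow> ('k, 'l set) module" where
  "lie_quotient L I =
    \<lparr>carrier = a_rcosets\<^bsub>L\<^esub> I,
     monoid.mult = rcoset_mult L I,
     one = undefined,
     ring.zero = I,
     add = set_add L,
     module.smult = (\<lambda>c C. \<Union>x\<in>C. I +>\<^bsub>L\<^esub> (c \<odot>\<^bsub>L\<^esub> x))\<rparr>"

text \<open>Elements of \<open>HH1 A\<close> are sets of derivations; \<open>d \<in> C\<close> says that \<open>d\<close> represents
  the class \<open>C\<close>.\<close>

definition HH1 :: "('k::field, 'a, 'm) module_scheme \<Rightarrow> ('k, ('a \<Rightarrow> 'a) set) module" where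
  "HH1 A = lie_quotient (Der A) (inner_derivations A)"

text \<open>\<open>[U, U]\<close>, the \<open>'k\<close>-subspace spanned by all brackets of elements of \<open>U\<close>.\<close>

definition lie_derived :: "('k::field, 'l, 'm) module_scheme \<Rightarrow> 'l set \<Rightarrow> 'l set" where
  "lie_derived L U =
    \<Inter>{W. submodule W (ring_of_type_algebra :: 'k ring) L \<and> (\<forall>x\<in>U. \<forall>y\<in>U. x \<otimes>\<^bsub>L\<^esub> y \<in> W)}"

definition lie_solvable :: "('k::field, 'l, 'm) module_scheme \<Rightarrow> bool" where
  "lie_solvable L \<longleftrightarrow> (\<exists>n. (lie_derived L ^^ n) (carrier L) = {\<zero>\<^bsub>L\<^esub>})"

end

theory Submission
  imports Defs "HOL-Library.Function_Algebras"
begin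

text \<open>Write \<open>G = P \<rtimes> E\<close> and let \<open>J\<close> be the ideal of \<open>kG\<close> generated by the \<open>u - 1\<close> with \<open>u \<in> P\<close>. Averaging over
  \<open>E\<close> changes any derivation by an inner one into a derivation \<open>d\<close> that kills \<open>E\<close>. Such a \<open>d\<close> is
  given by the cocycle \<open>u \<mapsto> d(u) u\<^sup>-\<^sup>1\<close> of \<open>P\<close> with values in the sum of the \<open>k[Pf]\<close>, \<open>f \<in> E\<close>. If \<open>f\<close>
  acts trivially on \<open>P\<close>, it is central, so the augmentation of the component in \<open>k[Pf]\<close> is an
  \<open>E\<close>-invariant homomorphism \<open>P \<rightarrow> k\<close>, which vanishes because \<open>[P,E] = P\<close>. Otherwise \<open>P\<close> is the direct
  product of \<open>[P,f] \<noteq> 1\<close> and \<open>C\<^sub>P(f)\<close>, and \<open>[P,f]\<close> acts freely on \<open>Pf\<close>: after a further inner change the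
  component is a multiple of the sum over \<open>[P,f]\<close>, which lies in \<open>J\<^sup>2\<close>. Hence \<open>d\<close> maps into \<open>J\<close>.

  The derivations with \<open>d(J) \<subseteq> J\<^sup>n\<^sup>+\<^sup>1\<close> form a filtration, nilpotent in positive degrees, so solvability
  is decided by the action on \<open>J/J\<^sup>2\<close>, where only the components at the kernel of the action survive.
  If \<open>P/\<Phi>(P)\<close> is multiplicity free, it is generated by the \<open>E\<close>-orbit of one element, and then these
  operators commute, since \<open>E\<close> acts through an abelian group. If two simple summands are isomorphic,
  then \<open>E\<close>-equivariant derivations of \<open>kP\<close> realise \<open>sl\<^sub>2\<close> on \<open>P/\<Phi>(P)\<close>, which is perfect for odd \<open>p\<close>; no
  inner derivation interferes, because conjugation by \<open>P\<close> fixes the component in \<open>kP\<close>.\<close>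


section \<open>Convolution on a finite group\<close>

text \<open>The module \<open>P/\<Phi>(P)\<close> lives over \<open>F_p\<close>, the quotient
  \<open>J/J^2\<close> over \<open>k\<close>. No base change is made: \<Phi>(P) is identified with
  the set of all \<open>u\<close> such that \<open>u - 1\<close> lies in \<open>J^2\<close>, so
  congruences modulo \<open>J^2\<close> and cosets of the Frattini subgroup translate into each
  other, and one \<open>u0\<close> in \<open>P\<close> serves as generator on both sides. A
  derivation killing \<open>E\<close> commutes with the maps
  \<open>y \<mapsto> e y e^(-1) z\<close>. If \<open>d(u0 - 1)\<close> and \<open>d'(u0 - 1)\<close>
  are, modulo \<open>J^2\<close>, values \<open>h(u0 - 1)\<close> and \<open>h'(u0 - 1)\<close> of
  combinations of such maps with \<open>z\<close> in the kernel, then \<open>d d'\<close> and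
  \<open>d' d\<close> act on \<open>u0 - 1\<close> as \<open>h' h\<close> and \<open>h h'\<close>,
  and these agree there. The sum over \<open>[P,f]\<close> lies in \<open>J^2\<close> because the
  product of all elements of \<open>[P,f]\<close> is fixed by \<open>f\<close>, hence 1; this covers
  \<open>p = 2\<close> as well. The inner change at components outside the kernel serves to reach
  \<open>J^2\<close>; that the values lie in \<open>J\<close> follows from augmentations
  alone.\<close>

lemma (in group) finite_subgroupI:
  assumes fin: "finite (carrier G)" and H: "H \<subseteq> carrier G" "H \<noteq> {}"
    and mult: "\<And>a b. a \<in> H \<Longrightarrow> b \<in> H \<Longrightarrow> a \<otimes> b \<in> H"
  shows "subgroup H G"
proof (rule subgroupI[OF H _ mult])
  fix a assume a: "a \<in> H"
  then have aG: "a \<in> carrier G" using H by blast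
  have pow: "a [^] Suc n \<in> H" for n :: nat
    by (induction n) (use a aG mult in simp_all)
  \<comment> \<open>The inverse of \<open>a\<close> is a positive power of \<open>a\<close>. The
    factor 2 keeps the truncated subtraction exact for a group of order 1.\<close>
  have "a [^] Suc (2 * Coset.order G - 2) \<otimes> a = \<one>"
  proof -
    have "0 < Coset.order G" using fin by (simp add: order_gt_0_iff_finite)
    then have "Suc (Suc (2 * Coset.order G - 2)) = Coset.order G * 2" by simp
    then show ?thesis
      using pow_order_eq_1[OF aG] nat_pow_pow[OF aG, of "Coset.order G" 2] by (metis nat_pow_Suc nat_pow_one)
  qed
  then have "inv a = a [^] Suc (2 * Coset.order G - 2)" using aG by (intro inv_equality) auto
  then show "inv a \<in> H" using pow by simp
qed

definition conv :: "('g, 'm) monoid_scheme \<Rightarrow> ('g \<Rightarrow> 'k::field) \<Rightarrow> ('g \<Rightarrow> 'k) \<Rightarrow> 'g \<Rightarrow> 'k" where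
  "conv G a b = (\<lambda>x. if x \<in> carrier G
     then \<Sum>y\<in>carrier G. a y * b (inv\<^bsub>G\<^esub> y \<otimes>\<^bsub>G\<^esub> x) else 0)"

definition sgl :: "'g \<Rightarrow> 'g \<Rightarrow> 'k::field" where
  "sgl g = (\<lambda>x. if x = g then 1 else 0)"

definition scl :: "'k::field \<Rightarrow> ('g \<Rightarrow> 'k) \<Rightarrow> 'g \<Rightarrow> 'k" where
  "scl c a = (\<lambda>x. c * a x)"

lemma scl_apply: "scl c a x = c * a x"
  by (simp add: scl_def)

lemma sgl_apply: "sgl g x = (if x = g then 1 else 0)"
  by (simp add: sgl_def)

text \<open>Evaluation at points is removed from the simplifier, so that elements of the group
  algebra are treated as vectors unless these rules are named.\<close>

lemmas pointwise = plus_fun_apply minus_apply uminus_apply zero_fun_apply scl_apply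
declare pointwise [simp del]

global_interpretation fv: vector_space "scl :: 'k::field \<Rightarrow> ('g \<Rightarrow> 'k) \<Rightarrow> 'g \<Rightarrow> 'k"
  by unfold_locales (auto simp: pointwise fun_eq_iff algebra_simps)

lemma sum_fun_apply: "(\<Sum>i\<in>I. f i) x = (\<Sum>i\<in>I. f i x)"
  by (induction I rule: infinite_finite_induct) (auto simp: pointwise)

locale finite_group = group G for G (structure) +
  assumes fin [simp, intro]: "finite (carrier G)"
begin

abbreviation cv (infixl \<open>\<star>\<close> 70) where "a \<star> b \<equiv> conv G a b"

definition KG :: "('a \<Rightarrow> 'k::field) set" where
  "KG = {a. \<forall>x. x \<notin> carrier G \<longrightarrow> a x = 0}"

lemma KG_I: "(\<And>x. x \<notin> carrier G \<Longrightarrow> a x = 0) \<Longrightarrow> a \<in> KG"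
  and KG_D: "a \<in> KG \<Longrightarrow> x \<notin> carrier G \<Longrightarrow> a x = 0"
  by (auto simp: KG_def)

lemma subspace_KG: "fv.subspace KG"
  by (auto simp: fv.subspace_def KG_def pointwise)

lemmas KG_add [simp, intro] = fv.subspace_add[OF subspace_KG]
  and KG_diff [simp, intro] = fv.subspace_diff[OF subspace_KG]
  and KG_neg [simp, intro] = fv.subspace_neg[OF subspace_KG]
  and KG_scl [simp, intro] = fv.subspace_scale[OF subspace_KG]
  and KG_zero [simp, intro] = fv.subspace_0[OF subspace_KG]
  and KG_sum [intro] = fv.subspace_sum[OF subspace_KG]

lemma KG_conv [simp, intro]: "a \<star> b \<in> KG"
  by (simp add: KG_def conv_def)

lemma KG_sgl [simp, intro]: "g \<in> carrier G \<Longrightarrow> sgl g \<in> KG"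
  by (auto simp: KG_def sgl_def)

lemma conv_add_left: "(a + b) \<star> c = a \<star> c + b \<star> c"
  and conv_add_right: "a \<star> (b + c) = a \<star> b + a \<star> c"
  and conv_diff_left: "(a - b) \<star> c = a \<star> c - b \<star> c"
  and conv_diff_right: "a \<star> (b - c) = a \<star> b - a \<star> c"
  and conv_minus_left: "(- a) \<star> c = - (a \<star> c)"
  and conv_minus_right: "a \<star> (- c) = - (a \<star> c)"
  and conv_zero_left [simp]: "0 \<star> c = 0"
  and conv_zero_right [simp]: "c \<star> 0 = 0"
  and conv_scl_left: "scl k a \<star> b = scl k (a \<star> b)"
  and conv_scl_right: "a \<star> scl k b = scl k (a \<star> b)"
  by (auto simp: conv_def fun_eq_iff algebra_simps pointwise sum.distrib sum_subtractf sum_negf sum_distrib_left)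

lemma conv_sum_left: "(\<Sum>i\<in>I. f i) \<star> c = (\<Sum>i\<in>I. f i \<star> c)"
  using sum_comp_morphism[of "\<lambda>x. x \<star> c" f I] by (simp add: conv_add_left o_def)

lemma conv_sum_right: "c \<star> (\<Sum>i\<in>I. f i) = (\<Sum>i\<in>I. c \<star> f i)"
  using sum_comp_morphism[of "\<lambda>x. c \<star> x" f I] by (simp add: conv_add_right o_def)

lemmas conv_bilinear = conv_add_left conv_add_right conv_diff_left conv_diff_right
  conv_minus_left conv_minus_right conv_scl_left conv_scl_right

lemma mult_inv_cancel [simp]:
  assumes "z \<in> carrier G" "x \<in> carrier G"
  shows "z \<otimes> (inv z \<otimes> x) = x" "inv z \<otimes> (z \<otimes> x) = x"
  using assms by (simp_all add: m_assoc[symmetric])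

lemma mult_inv_cancel_right [simp]:
  assumes "z \<in> carrier G" "x \<in> carrier G"
  shows "x \<otimes> z \<otimes> inv z = x" "x \<otimes> inv z \<otimes> z = x"
  using assms by (simp_all add: m_assoc)

lemma sum_left_translate:
  assumes "z \<in> carrier G"
  shows "(\<Sum>y\<in>carrier G. f (inv z \<otimes> y)) = (\<Sum>w\<in>carrier G. f w)"
  by (rule sum.reindex_bij_witness[where i = "\<lambda>w. z \<otimes> w" and j = "\<lambda>y. inv z \<otimes> y"])
     (use assms in auto)

lemma conv_assoc: "(a \<star> b) \<star> c = a \<star> (b \<star> c)"
proof
  fix x
  show "((a \<star> b) \<star> c) x = (a \<star> (b \<star> c)) x"
  proof (cases "x \<in> carrier G")
    case True
    have *: "(\<Sum>y\<in>carrier G. b (inv z \<otimes> y) * c (inv y \<otimes> x)) =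
      (\<Sum>w\<in>carrier G. b w * c (inv w \<otimes> (inv z \<otimes> x)))" if z: "z \<in> carrier G" for z
    proof -
      have "(\<Sum>y\<in>carrier G. b (inv z \<otimes> y) * c (inv y \<otimes> x)) =
         (\<Sum>y\<in>carrier G. (\<lambda>w. b w * c (inv w \<otimes> (inv z \<otimes> x))) (inv z \<otimes> y))"
        by (rule sum.cong) (use z True in \<open>auto simp: inv_mult_group m_assoc\<close>)
      also have "\<dots> = (\<Sum>w\<in>carrier G. b w * c (inv w \<otimes> (inv z \<otimes> x)))"
        by (rule sum_left_translate[OF z])
      finally show ?thesis .
    qed
    have "((a \<star> b) \<star> c) x =
        (\<Sum>y\<in>carrier G. \<Sum>z\<in>carrier G. a z * b (inv z \<otimes> y) * c (inv y \<otimes> x))"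
      by (simp add: conv_def True sum_distrib_right)
    also have "\<dots> = (\<Sum>z\<in>carrier G. a z * (\<Sum>y\<in>carrier G. b (inv z \<otimes> y) * c (inv y \<otimes> x)))"
      by (subst sum.swap) (simp add: sum_distrib_left mult.assoc)
    also have "\<dots> = (a \<star> (b \<star> c)) x"
      by (simp add: conv_def True * cong: sum.cong)
    finally show ?thesis .
  qed (simp add: conv_def)
qed

lemma conv_sgl_left:
  assumes "g \<in> carrier G"
  shows "(sgl g \<star> a) x = (if x \<in> carrier G then a (inv g \<otimes> x) else 0)"
proof (cases "x \<in> carrier G")
  case True
  have "(sgl g \<star> a) x = (\<Sum>y\<in>carrier G. if y = g then a (inv y \<otimes> x) else 0)"
    by (simp add: conv_def True sgl_def if_distrib[of "\<lambda>t. t * _"] cong: if_cong sum.cong)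
  then show ?thesis using assms True by simp
qed (simp add: conv_def)

lemma conv_sgl_right:
  assumes "g \<in> carrier G"
  shows "(a \<star> sgl g) x = (if x \<in> carrier G then a (x \<otimes> inv g) else 0)"
proof (cases "x \<in> carrier G")
  case True
  have eq: "inv y \<otimes> x = g \<longleftrightarrow> y = x \<otimes> inv g" if "y \<in> carrier G" for y
    by (metis True assms inv_closed inv_solve_left inv_solve_right that)
  have "(a \<star> sgl g) x = (\<Sum>y\<in>carrier G. if y = x \<otimes> inv g then a y else 0)"
    by (simp add: conv_def True sgl_def eq if_distrib[of "\<lambda>t. _ * t"] cong: if_cong sum.cong)
  then show ?thesis using assms True by simp
qed (simp add: conv_def)

lemma conv_sgl_sgl [simp]:
  assumes "g \<in> carrier G" "h \<in> carrier G"
  shows "sgl g \<star> sgl h = sgl (g \<otimes> h)"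
proof
  fix x show "(sgl g \<star> sgl h) x = sgl (g \<otimes> h) x"
    using assms by (auto simp: conv_sgl_left sgl_apply)
qed

lemma conv_one_left [simp]: "a \<in> KG \<Longrightarrow> sgl \<one> \<star> a = a"
  by (auto simp: fun_eq_iff conv_sgl_left KG_def)

lemma conv_one_right [simp]: "a \<in> KG \<Longrightarrow> a \<star> sgl \<one> = a"
  by (auto simp: fun_eq_iff conv_sgl_right KG_def)

lemma conv_sgl_assoc [simp]:
  assumes "g \<in> carrier G" "h \<in> carrier G"
  shows "sgl g \<star> (sgl h \<star> a) = sgl (g \<otimes> h) \<star> a" "a \<star> sgl g \<star> sgl h = a \<star> sgl (g \<otimes> h)"
  using assms by (simp add: conv_assoc[symmetric], simp add: conv_assoc)

lemma expand: "a \<in> KG \<Longrightarrow> a = (\<Sum>g\<in>carrier G. scl (a g) (sgl g))"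
  by (rule ext) (auto simp: sum_fun_apply pointwise sgl_def KG_def if_distrib cong: if_cong)

lemma KG_induct [consumes 1, case_names zero add scl sgl]:
  assumes a: "a \<in> KG"
    and zero: "Q 0" and add: "\<And>x y. x \<in> KG \<Longrightarrow> y \<in> KG \<Longrightarrow> Q x \<Longrightarrow> Q y \<Longrightarrow> Q (x + y)"
    and scl: "\<And>c x. x \<in> KG \<Longrightarrow> Q x \<Longrightarrow> Q (scl c x)"
    and sgl: "\<And>g. g \<in> carrier G \<Longrightarrow> Q (sgl g)"
  shows "Q a"
proof -
  have "(\<Sum>g\<in>S. scl (a g) (sgl g)) \<in> KG \<and> Q (\<Sum>g\<in>S. scl (a g) (sgl g))" if "S \<subseteq> carrier G" for S
    using finite_subset[OF that fin] that
    by (induction S rule: finite_induct) (auto intro!: zero add scl sgl)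
  then show ?thesis using expand[OF a] by (metis subset_refl)
qed

abbreviation A :: "('k::field, 'a \<Rightarrow> 'k) module" where "A \<equiv> group_algebra TYPE('k) G"

lemma A_simps [simp]:
  "carrier A = KG" "x \<otimes>\<^bsub>A\<^esub> y = x \<star> y" "x \<oplus>\<^bsub>A\<^esub> y = x + y" "\<zero>\<^bsub>A\<^esub> = 0" "\<one>\<^bsub>A\<^esub> = sgl \<one>"
  "c \<odot>\<^bsub>A\<^esub> x = scl c x"
  by (simp_all add: group_algebra_def KG_def conv_def fun_eq_iff sgl_def pointwise)

lemma abelian_group_A: "abelian_group A"
proof (rule abelian_groupI)
  fix x :: "'a \<Rightarrow> 'k::field" assume "x \<in> carrier A"
  then show "\<exists>y\<in>carrier A. y \<oplus>\<^bsub>A\<^esub> x = \<zero>\<^bsub>A\<^esub>" by (auto intro!: bexI[of _ "- x"])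
qed (auto simp: add_ac)

lemma a_inv_A [simp]: "x \<in> KG \<Longrightarrow> \<ominus>\<^bsub>A\<^esub> x = - x"
  by (rule abelian_group.minus_equality[OF abelian_group_A]) auto

lemma a_minus_A [simp]: "x \<in> KG \<Longrightarrow> y \<in> KG \<Longrightarrow> x \<ominus>\<^bsub>A\<^esub> y = x - y"
  by (simp add: a_minus_def)

end

section \<open>Derivations and their classes\<close>

context finite_group
begin

definition ders :: "(('a \<Rightarrow> 'k::field) \<Rightarrow> ('a \<Rightarrow> 'k)) set" where
  "ders = {d \<in> KG \<rightarrow>\<^sub>E KG.
     (\<forall>x\<in>KG. \<forall>y\<in>KG. d (x + y) = d x + d y) \<and>
     (\<forall>c. \<forall>x\<in>KG. d (scl c x) = scl c (d x)) \<and>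
     (\<forall>x\<in>KG. \<forall>y\<in>KG. d (x \<star> y) = d x \<star> y + x \<star> d y)}"

definition ad :: "('a \<Rightarrow> 'k::field) \<Rightarrow> ('a \<Rightarrow> 'k) \<Rightarrow> ('a \<Rightarrow> 'k)" where
  "ad a = (\<lambda>x\<in>KG. a \<star> x - x \<star> a)"

definition dbr :: "(('a \<Rightarrow> 'k::field) \<Rightarrow> ('a \<Rightarrow> 'k)) \<Rightarrow> (('a \<Rightarrow> 'k) \<Rightarrow> ('a \<Rightarrow> 'k)) \<Rightarrow> ('a \<Rightarrow> 'k) \<Rightarrow> ('a \<Rightarrow> 'k)"
  where "dbr f g = (\<lambda>x\<in>KG. f (g x) - g (f x))"

definition dadd :: "(('a \<Rightarrow> 'k::field) \<Rightarrow> ('a \<Rightarrow> 'k)) \<Rightarrow> (('a \<Rightarrow> 'k) \<Rightarrow> ('a \<Rightarrow> 'k)) \<Rightarrow> ('a \<Rightarrow> 'k) \<Rightarrow> ('a \<Rightarrow> 'k)"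
  where "dadd f g = (\<lambda>x\<in>KG. f x + g x)"

definition dscl :: "'k::field \<Rightarrow> (('a \<Rightarrow> 'k) \<Rightarrow> ('a \<Rightarrow> 'k)) \<Rightarrow> ('a \<Rightarrow> 'k) \<Rightarrow> ('a \<Rightarrow> 'k)"
  where "dscl c f = (\<lambda>x\<in>KG. scl c (f x))"

lemma derivations_eq: "derivations A = ders"
  by (simp add: derivations_def ders_def)

lemma dersI:
  assumes "d \<in> extensional KG" "\<And>x. x \<in> KG \<Longrightarrow> d x \<in> KG"
    and "\<And>x y. x \<in> KG \<Longrightarrow> y \<in> KG \<Longrightarrow> d (x + y) = d x + d y"
    and "\<And>c x. x \<in> KG \<Longrightarrow> d (scl c x) = scl c (d x)"
    and "\<And>x y. x \<in> KG \<Longrightarrow> y \<in> KG \<Longrightarrow> d (x \<star> y) = d x \<star> y + x \<star> d y"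
  shows "d \<in> ders"
  using assms by (auto simp: ders_def PiE_def)

lemma
  assumes "d \<in> ders"
  shows der_ext: "d \<in> extensional KG"
    and der_closed: "x \<in> KG \<Longrightarrow> d x \<in> KG"
    and der_add: "x \<in> KG \<Longrightarrow> y \<in> KG \<Longrightarrow> d (x + y) = d x + d y"
    and der_scl: "x \<in> KG \<Longrightarrow> d (scl c x) = scl c (d x)"
    and der_mult: "x \<in> KG \<Longrightarrow> y \<in> KG \<Longrightarrow> d (x \<star> y) = d x \<star> y + x \<star> d y"
  using assms by (auto simp: ders_def PiE_def)

lemma der_zero: "d \<in> ders \<Longrightarrow> d 0 = 0"
  using der_scl[of d 0 0] by simp

lemma der_neg: "d \<in> ders \<Longrightarrow> x \<in> KG \<Longrightarrow> d (- x) = - d x"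
  using der_scl[of d x "- 1"] by (simp add: fv.scale_minus_left)

lemma der_diff: "d \<in> ders \<Longrightarrow> x \<in> KG \<Longrightarrow> y \<in> KG \<Longrightarrow> d (x - y) = d x - d y"
  using der_add[of d x "- y"] der_neg[of d y] by simp

lemmas der_rules = der_closed der_zero der_add der_neg der_diff der_scl der_mult

lemma der_one: "d \<in> ders \<Longrightarrow> d (sgl \<one>) = 0"
  using der_mult[of d "sgl \<one>" "sgl \<one>"] by (simp add: der_closed)

lemma ders_eqI:
  fixes d d' :: "('a \<Rightarrow> 'k::field) \<Rightarrow> 'a \<Rightarrow> 'k"
  assumes "d \<in> ders" "d' \<in> ders" "\<And>g. g \<in> carrier G \<Longrightarrow> d (sgl g) = d' (sgl g)"
  shows "d = d'"
proof (rule extensionalityI[OF der_ext der_ext])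
  fix x :: "'a \<Rightarrow> 'k" assume "x \<in> KG"
  then show "d x = d' x"
    by (induction x rule: KG_induct) (simp_all add: der_rules[OF assms(1)] der_rules[OF assms(2)] assms(3))
qed (use assms in auto)

lemma ad_apply: "x \<in> KG \<Longrightarrow> ad a x = a \<star> x - x \<star> a"
  and dbr_apply: "x \<in> KG \<Longrightarrow> dbr f g x = f (g x) - g (f x)"
  and dadd_apply: "x \<in> KG \<Longrightarrow> dadd f g x = f x + g x"
  and dscl_apply: "x \<in> KG \<Longrightarrow> dscl c f x = scl c (f x)"
  by (simp_all add: ad_def dbr_def dadd_def dscl_def)

lemma ad_ders [intro]: "a \<in> KG \<Longrightarrow> ad a \<in> ders"
  by (rule dersI) (auto simp: ad_def conv_bilinear conv_assoc fv.scale_right_diff_distrib)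

lemma dbr_ders [intro]:
  assumes f: "f \<in> ders" and g: "g \<in> ders" shows "dbr f g \<in> ders"
  by (rule dersI) (auto simp: dbr_def der_rules[OF f] der_rules[OF g] conv_bilinear fv.scale_right_diff_distrib)

lemma dadd_ders [intro]:
  assumes f: "f \<in> ders" and g: "g \<in> ders" shows "dadd f g \<in> ders"
  by (rule dersI) (auto simp: dadd_def der_rules[OF f] der_rules[OF g] conv_bilinear fv.scale_right_distrib)

lemma dscl_ders [intro]:
  assumes f: "f \<in> ders" shows "dscl c f \<in> ders"
  by (rule dersI) (auto simp: dscl_def der_rules[OF f] conv_bilinear fv.scale_right_distrib mult.commute)

definition inn :: "(('a \<Rightarrow> 'k::field) \<Rightarrow> ('a \<Rightarrow> 'k)) set" where
  "inn = ad ` KG"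

lemma inner_derivations_eq: "inner_derivations A = inn"
  by (auto simp: inner_derivations_def inn_def ad_def image_def cong: restrict_cong)

abbreviation DA :: "('k::field, ('a \<Rightarrow> 'k) \<Rightarrow> ('a \<Rightarrow> 'k)) module" where "DA \<equiv> Der A"

lemma DA_simps [simp]:
  "carrier DA = ders" "f \<oplus>\<^bsub>DA\<^esub> g = dadd f g" "c \<odot>\<^bsub>DA\<^esub> f = dscl c f"
  by (simp_all add: Der_def derivations_eq dadd_def dscl_def)

lemma DA_mult: "f \<in> ders \<Longrightarrow> g \<in> ders \<Longrightarrow> f \<otimes>\<^bsub>DA\<^esub> g = dbr f g"
  by (auto simp: Der_def dbr_def der_closed intro!: restrict_ext)

lemma DA_zero: "\<zero>\<^bsub>DA\<^esub> = ad 0"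
  by (simp add: Der_def ad_def)

lemma dadd_zero: "f \<in> ders \<Longrightarrow> dadd (ad 0) f = f"
  and dadd_neg: "f \<in> ders \<Longrightarrow> dadd (dscl (- 1) f) f = ad 0"
  by (intro ders_eqI dadd_ders dscl_ders ad_ders;
      simp add: dadd_apply dscl_apply ad_apply fv.scale_minus_left)+

lemma dadd_commute: "f \<in> ders \<Longrightarrow> g \<in> ders \<Longrightarrow> dadd f g = dadd g f"
  and dadd_assoc: "f \<in> ders \<Longrightarrow> g \<in> ders \<Longrightarrow> h \<in> ders \<Longrightarrow> dadd (dadd f g) h = dadd f (dadd g h)"
  by (intro ders_eqI dadd_ders; simp add: dadd_apply add_ac)+

lemma abelian_group_DA: "abelian_group DA"
proof (rule abelian_groupI)
  fix f :: "('a \<Rightarrow> 'k::field) \<Rightarrow> _" assume "f \<in> carrier DA"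
  then show "\<exists>y\<in>carrier DA. y \<oplus>\<^bsub>DA\<^esub> f = \<zero>\<^bsub>DA\<^esub>"
    by (intro bexI[of _ "dscl (- 1) f"]) (auto simp: DA_zero dadd_neg)
qed (auto simp: DA_zero dadd_zero dadd_assoc intro: dadd_commute)

lemma a_inv_DA: "f \<in> ders \<Longrightarrow> \<ominus>\<^bsub>DA\<^esub> f = dscl (- 1) f"
  by (rule abelian_group.minus_equality[OF abelian_group_DA]) (auto simp: DA_zero dadd_neg)

lemma dadd_ad: "a \<in> KG \<Longrightarrow> b \<in> KG \<Longrightarrow> dadd (ad a) (ad b) = ad (a + b)"
  and dscl_ad: "a \<in> KG \<Longrightarrow> dscl c (ad a) = ad (scl c a)"
  by (intro ders_eqI dadd_ders dscl_ders ad_ders;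
      simp add: dadd_apply dscl_apply ad_apply conv_bilinear fv.scale_right_diff_distrib)+

lemma abelian_subgroup_inn: "abelian_subgroup inn DA"
proof (rule abelian_subgroupI3[OF _ abelian_group_DA])
  interpret DG: group "add_monoid (DA :: ('k::field, _) module)"
    by (rule abelian_group.a_group[OF abelian_group_DA])
  show "additive_subgroup inn (DA :: ('k::field, _) module)"
  proof (rule additive_subgroupI, rule DG.subgroupI)
    fix x :: "('a \<Rightarrow> 'k) \<Rightarrow> _" assume x: "x \<in> inn"
    then obtain a where a: "a \<in> KG" "x = ad a" by (auto simp: inn_def)
    have "inv\<^bsub>add_monoid DA\<^esub> x = ad (scl (- 1) a)"
      using a_inv_DA[of x] a by (auto simp: dscl_ad a_inv_def)
    then show "inv\<^bsub>add_monoid DA\<^esub> x \<in> inn"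
      using a by (auto simp: inn_def)
  next
    fix x y :: "('a \<Rightarrow> 'k) \<Rightarrow> _" assume "x \<in> inn" "y \<in> inn"
    then show "x \<otimes>\<^bsub>add_monoid DA\<^esub> y \<in> inn"
      by (auto simp: inn_def dadd_ad)
  qed (auto simp: inn_def)
qed

section \<open>The quotient Lie algebra, computed on classes of derivations\<close>

definition cls :: "(('a \<Rightarrow> 'k::field) \<Rightarrow> ('a \<Rightarrow> 'k)) \<Rightarrow> (('a \<Rightarrow> 'k) \<Rightarrow> ('a \<Rightarrow> 'k)) set" where
  "cls d = {dadd (ad a) d | a. a \<in> KG}"

lemma cls_coset: "cls d = inn +>\<^bsub>DA\<^esub> d"
  by (auto simp: cls_def a_r_coset_def' inn_def)

lemma cls_self: "d \<in> ders \<Longrightarrow> d \<in> cls d"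
  by (auto simp: cls_def dadd_zero intro!: exI[of _ 0])

lemma cls_subset: "d \<in> ders \<Longrightarrow> cls d \<subseteq> ders"
  by (auto simp: cls_def)

lemma cls_eq:
  assumes "d \<in> ders" "a \<in> KG"
  shows "cls (dadd (ad a) d) = cls d"
proof -
  have "dadd (ad b) (dadd (ad a) d) = dadd (ad (b + a)) d" if "b \<in> KG" for b
    using assms that by (intro ders_eqI dadd_ders ad_ders) (auto simp: dadd_apply ad_apply conv_bilinear)
  moreover have "dadd (ad b) d = dadd (ad (b - a)) (dadd (ad a) d)" if "b \<in> KG" for b
    using assms that by (intro ders_eqI dadd_ders ad_ders) (auto simp: dadd_apply ad_apply conv_bilinear)
  ultimately show ?thesis using assms unfolding cls_def by (metis (no_types, lifting) KG_add KG_diff)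
qed

lemma cls_zero: "cls (ad 0) = inn"
proof -
  have "dadd (ad a) (ad 0) = ad a" if "a \<in> KG" for a
    using that by (simp add: dadd_ad)
  then show ?thesis by (force simp: cls_def inn_def image_iff)
qed

lemma cls_eqD: "d \<in> ders \<Longrightarrow> cls d = inn \<Longrightarrow> \<exists>a\<in>KG. d = ad a"
  using cls_self[of d] by (auto simp: inn_def)

abbreviation HA :: "('k::field, (('a \<Rightarrow> 'k) \<Rightarrow> ('a \<Rightarrow> 'k)) set) module" where "HA \<equiv> HH1 A"

lemma HA_carrier: "carrier HA = cls ` ders"
  by (auto simp: HH1_def lie_quotient_def A_RCOSETS_def' inner_derivations_eq cls_coset)

lemma HA_zero: "\<zero>\<^bsub>HA\<^esub> = inn"
  by (simp add: HH1_def lie_quotient_def inner_derivations_eq)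

lemma HA_add: "f \<in> ders \<Longrightarrow> g \<in> ders \<Longrightarrow> cls f \<oplus>\<^bsub>HA\<^esub> cls g = cls (dadd f g)"
  using abelian_subgroup.a_rcos_sum[OF abelian_subgroup_inn, of f g]
  by (simp add: HH1_def lie_quotient_def inner_derivations_eq cls_coset)

lemma HA_scl:
  assumes f: "f \<in> ders" shows "c \<odot>\<^bsub>HA\<^esub> cls f = cls (dscl c f)"
proof -
  have *: "cls (dscl c x) = cls (dscl c f)" if "x \<in> cls f" for x
  proof -
    obtain a where a: "a \<in> KG" "x = dadd (ad a) f" using \<open>x \<in> cls f\<close> by (auto simp: cls_def)
    have "dscl c x = dadd (ad (scl c a)) (dscl c f)"
      using a f by (intro ders_eqI dadd_ders dscl_ders ad_ders)
        (auto simp: dadd_apply ad_apply dscl_apply conv_bilinear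
          fv.scale_right_diff_distrib fv.scale_right_distrib)
    then show ?thesis using cls_eq[of "dscl c f"] f a by auto
  qed
  have "c \<odot>\<^bsub>HA\<^esub> cls f = (\<Union>x\<in>cls f. cls (dscl c x))"
    by (simp add: HH1_def lie_quotient_def inner_derivations_eq cls_coset)
  then show ?thesis using * cls_self[OF f] by blast
qed

text \<open>Inner derivations form an ideal: \<open>[f, ad b] = ad (f b)\<close> and
  \<open>[ad a, g] = - ad (g a)\<close>. The coset product is a union over all pairs of
  representatives, and this independence makes it a single class.\<close>

lemma HA_mult:
  assumes f: "f \<in> ders" and g: "g \<in> ders"
  shows "cls f \<otimes>\<^bsub>HA\<^esub> cls g = cls (dbr f g)"
proof -
  have *: "cls (x \<otimes>\<^bsub>DA\<^esub> y) = cls (dbr f g)" if xy: "x \<in> cls f" "y \<in> cls g" for x y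
  proof -
    obtain a where a: "a \<in> KG" "x = dadd (ad a) f"
      using xy(1) unfolding cls_def by blast
    obtain b where b: "b \<in> KG" "y = dadd (ad b) g"
      using xy(2) unfolding cls_def by blast
    have "dbr x y = dadd (ad (a \<star> b - b \<star> a - g a + f b)) (dbr f g)"
      using a b f g by (intro ders_eqI dadd_ders dbr_ders ad_ders)
        (auto simp: dadd_apply ad_apply dbr_apply conv_bilinear conv_assoc der_rules[OF f] der_rules[OF g])
    moreover have "x \<in> ders" "y \<in> ders" using xy cls_subset f g by blast+
    moreover have "a \<star> b - b \<star> a - g a + f b \<in> KG"
      using a b f g by (simp add: der_closed)
    ultimately show ?thesis
      using cls_eq[OF dbr_ders[OF f g]] by (simp add: DA_mult)
  qed
  have "cls f \<otimes>\<^bsub>HA\<^esub> cls g = (\<Union>x\<in>cls f. \<Union>y\<in>cls g. cls (x \<otimes>\<^bsub>DA\<^esub> y))"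
    by (simp add: HH1_def lie_quotient_def inner_derivations_eq cls_coset rcoset_mult_def)
  then show ?thesis using * cls_self[OF f] cls_self[OF g] by blast
qed

lemma abelian_group_HA: "abelian_group HA"
proof (rule abelian_groupI)
  fix x :: "(('a \<Rightarrow> 'k::field) \<Rightarrow> _) set" assume "x \<in> carrier HA"
  then obtain f where f: "f \<in> ders" "x = cls f" by (auto simp: HA_carrier)
  show "\<zero>\<^bsub>HA\<^esub> \<oplus>\<^bsub>HA\<^esub> x = x"
    using HA_add[of "ad 0" f] f cls_eq[of f 0] by (auto simp: HA_zero cls_zero)
  show "\<exists>y\<in>carrier HA. y \<oplus>\<^bsub>HA\<^esub> x = \<zero>\<^bsub>HA\<^esub>"
    using f HA_add[of "dscl (- 1) f" f] by (intro bexI[of _ "cls (dscl (- 1) f)"])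
      (auto simp: HA_carrier HA_zero cls_zero dadd_neg)
next
  fix x y z :: "(('a \<Rightarrow> 'k::field) \<Rightarrow> _) set"
  assume "x \<in> carrier HA" "y \<in> carrier HA" "z \<in> carrier HA"
  then obtain f g h where fgh: "f \<in> ders" "x = cls f" "g \<in> ders" "y = cls g" "h \<in> ders" "z = cls h"
    by (auto simp: HA_carrier)
  then show "x \<oplus>\<^bsub>HA\<^esub> y \<oplus>\<^bsub>HA\<^esub> z = x \<oplus>\<^bsub>HA\<^esub> (y \<oplus>\<^bsub>HA\<^esub> z)"
    using fgh by (auto simp: HA_add dadd_ders dadd_assoc)
next
  fix x y :: "(('a \<Rightarrow> 'k::field) \<Rightarrow> _) set"
  assume "x \<in> carrier HA" "y \<in> carrier HA"
  then obtain f g where fg: "f \<in> ders" "x = cls f" "g \<in> ders" "y = cls g"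
    by (auto simp: HA_carrier)
  then show "x \<oplus>\<^bsub>HA\<^esub> y = y \<oplus>\<^bsub>HA\<^esub> x" using fg by (auto simp: HA_add dadd_commute[of f g])
  show "x \<oplus>\<^bsub>HA\<^esub> y \<in> carrier HA" using fg by (auto simp: HA_add HA_carrier)
next
  show "\<zero>\<^bsub>HA\<^esub> \<in> carrier (HA :: ('k::field, _) module)"
    by (auto simp: HA_zero HA_carrier simp flip: cls_zero)
qed

lemma submodule_cls:
  fixes S :: "(('a \<Rightarrow> 'k::field) \<Rightarrow> ('a \<Rightarrow> 'k)) set"
  assumes "S \<subseteq> ders" "ad 0 \<in> S"
    and "\<And>f g. f \<in> S \<Longrightarrow> g \<in> S \<Longrightarrow> dadd f g \<in> S"
    and "\<And>f c. f \<in> S \<Longrightarrow> dscl c f \<in> S"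
  shows "submodule (cls ` S) (ring_of_type_algebra :: 'k ring) HA"
proof (rule submodule.intro)
  interpret HG: group "add_monoid (HA :: ('k, _) module)"
    by (rule abelian_group.a_group[OF abelian_group_HA])
  show "subgroup (cls ` S) (add_monoid HA)"
  proof (rule HG.subgroupI)
    show "cls ` S \<subseteq> carrier (add_monoid HA)" "cls ` S \<noteq> {}"
      using assms by (auto simp: HA_carrier)
    fix x assume "x \<in> cls ` S"
    then obtain f where f: "f \<in> S" "x = cls f" by auto
    have f': "f \<in> ders" using f assms by auto
    then have "\<ominus>\<^bsub>HA\<^esub> x = cls (dscl (- 1) f)"
      using f f' HA_add[of "dscl (- 1) f" f]
      by (intro abelian_group.minus_equality[OF abelian_group_HA])
         (auto simp: HA_carrier HA_zero cls_zero dadd_neg)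
    then show "inv\<^bsub>add_monoid HA\<^esub> x \<in> cls ` S"
      using assms(4) f by (auto simp: a_inv_def)
  next
    fix x y assume "x \<in> cls ` S" "y \<in> cls ` S"
    then show "x \<otimes>\<^bsub>add_monoid HA\<^esub> y \<in> cls ` S"
      using assms by (auto simp: HA_add subset_iff)
  qed
  show "submodule_axioms (cls ` S) (ring_of_type_algebra :: 'k ring) HA"
    using assms by (auto simp: submodule_axioms_def HA_scl subset_iff)
qed

text \<open>Upper bound for a derived algebra: as an intersection of submodules it lies in any one
  that contains the brackets.\<close>

lemma lie_derived_cls_subset:
  fixes S T :: "(('a \<Rightarrow> 'k::field) \<Rightarrow> ('a \<Rightarrow> 'k)) set"
  assumes "S \<subseteq> ders" "submodule (cls ` T) (ring_of_type_algebra :: 'k ring) HA"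
    and "\<And>f g. f \<in> S \<Longrightarrow> g \<in> S \<Longrightarrow> cls (dbr f g) \<in> cls ` T"
    and "U \<subseteq> cls ` S"
  shows "lie_derived HA U \<subseteq> cls ` T"
proof -
  have "x \<otimes>\<^bsub>HA\<^esub> y \<in> cls ` T" if xy: "x \<in> U" "y \<in> U" for x y
  proof -
    obtain f g where "x = cls f" "y = cls g" "f \<in> S" "g \<in> S" using xy assms(4) by blast
    then show ?thesis using assms(1,3) by (auto simp: HA_mult subset_iff)
  qed
  then show ?thesis using assms(2) by (auto simp: lie_derived_def)
qed

text \<open>The matching lower bound. The scalar is there to divide by 2 in the relations of
  \<open>sl_2\<close>.\<close>

lemma lie_derived_bracket:
  fixes c :: "'k::field"
  assumes "f \<in> ders" "g \<in> ders" "cls f \<in> U" "cls g \<in> U"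
  shows "cls (dscl c (dbr f g)) \<in> lie_derived HA U"
proof -
  have "cls (dscl c (dbr f g)) \<in> W"
    if W: "submodule W (ring_of_type_algebra :: 'k ring) HA" "\<forall>x\<in>U. \<forall>y\<in>U. x \<otimes>\<^bsub>HA\<^esub> y \<in> W" for W
  proof -
    have "cls (dbr f g) \<in> W" using W(2) assms HA_mult[OF assms(1,2)] by metis
    moreover have "c \<in> carrier (ring_of_type_algebra :: 'k ring)"
      by (simp add: ring_of_type_algebra_def)
    ultimately have "c \<odot>\<^bsub>HA\<^esub> cls (dbr f g) \<in> W"
      using W(1) by (simp add: submodule_def submodule_axioms_def)
    then show ?thesis by (simp add: HA_scl[OF dbr_ders[OF assms(1,2)]])
  qed
  then show ?thesis by (auto simp: lie_derived_def)
qed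

text \<open>Reduces the vanishing of a term of the derived series to an inclusion.\<close>

lemma zero_in_lie_derived:
  fixes U :: "(('a \<Rightarrow> 'k::field) \<Rightarrow> ('a \<Rightarrow> 'k)) set set"
  shows "inn \<in> lie_derived HA U"
  using subgroup.one_closed by (fastforce simp: lie_derived_def submodule_def HA_zero)

end

section \<open>The radical filtration of a group algebra\<close>

lemma add_power_prime_char:
  fixes x y :: "'r::comm_semiring_1"
  assumes p: "Factorial_Ring.prime p" and "of_nat p = (0::'r)"
  shows "(x + y) ^ p = x ^ p + y ^ p"
proof -
  have "(x + y) ^ p = (\<Sum>k\<le>p. of_nat (p choose k) * x ^ k * y ^ (p - k))"
    by (rule binomial_ring)
  also have "\<dots> = (\<Sum>k\<in>{0, p}. of_nat (p choose k) * x ^ k * y ^ (p - k))"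
  proof (rule sum.mono_neutral_right)
    show "\<forall>i\<in>{..p} - {0, p}. of_nat (p choose i) * x ^ i * y ^ (p - i) = 0"
    proof
      fix i assume "i \<in> {..p} - {0, p}"
      then have "p dvd (p choose i)"
        using p by (intro dvd_choose_prime) auto
      then obtain m where "p choose i = p * m" by blast
      then show "of_nat (p choose i) * x ^ i * y ^ (p - i) = 0"
        using assms(2) by simp
    qed
  qed auto
  also have "\<dots> = x ^ p + y ^ p"
    using prime_gt_0_nat[OF p] by (simp add: add.commute)
  finally show ?thesis .
qed

lemma diff_power_prime_power_char:
  fixes x y :: "'r::comm_ring_1"
  assumes p: "Factorial_Ring.prime p" and z: "of_nat p = (0::'r)"
  shows "(x - y) ^ (p ^ n) = x ^ (p ^ n) - y ^ (p ^ n)"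
proof -
  have "(a + b) ^ (p ^ n) = a ^ (p ^ n) + b ^ (p ^ n)" for a b :: 'r
  proof (induction n)
    case (Suc n)
    then show ?case by (simp add: power_mult add_power_prime_char[OF p z] mult.commute[of p])
  qed simp
  from this[of "x - y" y] show ?thesis by (simp add: algebra_simps)
qed

text \<open>Evaluation of a polynomial at an operator. It carries an identity from the commutative
  ring \<open>k[X]\<close> to powers of \<open>L\<close>.\<close>

definition poly_op :: "(('g \<Rightarrow> 'k::field) \<Rightarrow> ('g \<Rightarrow> 'k)) \<Rightarrow> 'k poly \<Rightarrow> ('g \<Rightarrow> 'k) \<Rightarrow> ('g \<Rightarrow> 'k)" where
  "poly_op L f y = (\<Sum>i\<le>degree f. scl (coeff f i) ((L ^^ i) y))"

lemma poly_op_ge: "degree f \<le> n \<Longrightarrow> poly_op L f y = (\<Sum>i\<le>n. scl (coeff f i) ((L ^^ i) y))"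
  unfolding poly_op_def by (rule sum.mono_neutral_left) (auto simp: coeff_eq_0)

lemma poly_op_diff: "poly_op L (f - g) y = poly_op L f y - poly_op L g y"
  using poly_op_ge[of "f - g" "max (degree f) (degree g)" L y]
    poly_op_ge[of f "max (degree f) (degree g)" L y] poly_op_ge[of g "max (degree f) (degree g)" L y]
  by (simp add: degree_diff_le_max fv.scale_left_diff_distrib sum_subtractf)

lemma poly_op_shift:
  assumes L: "\<And>x y. L (x + y) = L x + L y" "\<And>c x. L (scl c x) = scl c (L x)"
  shows "poly_op L (pCons 0 f) y = L (poly_op L f y)"
proof -
  have L0: "L 0 = 0" using L(2)[of 0 0] by simp
  have Lsum: "L (\<Sum>i\<in>I. h i) = (\<Sum>i\<in>I. L (h i))" for h :: "nat \<Rightarrow> _" and I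
    using sum_comp_morphism[of L h I] L0 L(1) by (simp add: o_def)
  have "poly_op L (pCons 0 f) y = (\<Sum>i\<le>Suc (degree f). scl (coeff (pCons 0 f) i) ((L ^^ i) y))"
    by (rule poly_op_ge) (rule degree_pCons_le)
  also have "\<dots> = (\<Sum>i\<le>degree f. scl (coeff f i) (L ((L ^^ i) y)))"
    by (subst sum.atMost_Suc_shift) simp
  also have "\<dots> = L (poly_op L f y)"
    by (simp add: poly_op_def Lsum L(2))
  finally show ?thesis .
qed

text \<open>Frobenius gives \<open>(X - 1)^(p^n) = X^(p^n) - 1\<close> in \<open>k[X]\<close>; both
  sides are evaluated at \<open>L\<close>.\<close>

lemma funpow_minus_id:
  fixes L :: "('g \<Rightarrow> 'k::field) \<Rightarrow> ('g \<Rightarrow> 'k)"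
  assumes p: "Factorial_Ring.prime p" and char: "CHAR('k) = p"
    and L: "\<And>x y. L (x + y) = L x + L y" "\<And>c x. L (scl c x) = scl c (L x)"
  shows "((\<lambda>y. L y - y) ^^ (p ^ n)) y = (L ^^ (p ^ n)) y - y"
proof -
  have pe: "poly_op L ([:- 1, 1:] ^ m) y = ((\<lambda>y. L y - y) ^^ m) y" for m
  proof (induction m)
    case (Suc m)
    have "[:- 1, 1:] * f = pCons 0 f - f" for f :: "'k poly" by simp
    then show ?case by (simp add: poly_op_diff poly_op_shift[OF L] Suc)
  qed (simp add: poly_op_def)
  have po: "poly_op L (monom 1 m) y = (L ^^ m) y" for m
    by (induction m) (simp_all add: poly_op_shift[OF L] monom_Suc, simp add: poly_op_def)
  have "[:- 1, 1:] = monom 1 1 - (1 :: 'k poly)"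
    by (simp add: monom_altdef one_pCons)
  moreover have "of_nat p = (0 :: 'k poly)"
    using char of_nat_eq_0_iff_char_dvd[where 'a = 'k, of p] by (simp add: of_nat_poly)
  ultimately have "[:- 1, 1:] ^ (p ^ n) = monom 1 (p ^ n) - (1 :: 'k poly)"
    using diff_power_prime_power_char[OF p, of "monom 1 1 :: 'k poly" 1 n] by (simp add: monom_power)
  then show ?thesis
    using pe[of "p ^ n"] po[of "p ^ n"] po[of 0] by (simp add: poly_op_diff)
qed

text \<open>The parameter \<open>kk\<close> pins the field type, so that \<open>up\<close>,
  \<open>Jp\<close> and the other constants have values in one fixed algebra.\<close>

locale p'_action = P: comm_group P + E: group E
  for P :: "'a monoid" (structure) and E :: "'b monoid" +
  fixes \<phi> :: "'b \<Rightarrow> 'a \<Rightarrow> 'a" and p :: nat and kk :: "'k::field itself"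
  assumes prime_p: "Factorial_Ring.prime p" and char_k: "CHAR('k) = p"
    and fin_P [simp, intro]: "finite (carrier P)" and order_P: "\<exists>n. Coset.order P = p ^ n"
    and fin_E [simp, intro]: "finite (carrier E)" and coprime_E: "coprime (Coset.order E) p"
    and phi_hom: "\<phi> \<in> hom E (AutoGroup P)"
begin

lemma phi_auto: "e \<in> carrier E \<Longrightarrow> \<phi> e \<in> auto P"
  using phi_hom by (auto simp: hom_def AutoGroup_def)

lemma phi_closed [simp, intro]: "e \<in> carrier E \<Longrightarrow> u \<in> carrier P \<Longrightarrow> \<phi> e u \<in> carrier P"
  using phi_auto[of e] by (auto simp: auto_def hom_def)

lemma phi_mult: "e \<in> carrier E \<Longrightarrow> u \<in> carrier P \<Longrightarrow> v \<in> carrier P \<Longrightarrow>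
    \<phi> e (u \<otimes> v) = \<phi> e u \<otimes> \<phi> e v"
  using phi_auto[of e] by (auto simp: auto_def hom_def)

lemma phi_comp: "e \<in> carrier E \<Longrightarrow> f \<in> carrier E \<Longrightarrow> u \<in> carrier P \<Longrightarrow>
    \<phi> (e \<otimes>\<^bsub>E\<^esub> f) u = \<phi> e (\<phi> f u)"
  using phi_hom phi_auto[of e] phi_auto[of f]
  by (auto simp: hom_def AutoGroup_def BijGroup_def auto_def compose_def)

lemma phi_hom_P: "e \<in> carrier E \<Longrightarrow> \<phi> e \<in> hom P P"
  using phi_auto[of e] by (auto simp: auto_def)

lemma phi_one_P [simp]: "e \<in> carrier E \<Longrightarrow> \<phi> e \<one> = \<one>"
  using hom_one[OF phi_hom_P] by auto

lemma phi_inv: "e \<in> carrier E \<Longrightarrow> u \<in> carrier P \<Longrightarrow> \<phi> e (inv u) = inv (\<phi> e u)"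
  using phi_hom_P[of e] by (metis P.group_axioms group_hom.hom_inv group_hom.intro group_hom_axioms.intro)

lemma phi_inj: "e \<in> carrier E \<Longrightarrow> u \<in> carrier P \<Longrightarrow> v \<in> carrier P \<Longrightarrow> \<phi> e u = \<phi> e v \<Longrightarrow> u = v"
  using phi_auto[of e] by (auto simp: auto_def Bij_def bij_betw_def dest: inj_onD)

lemma phi_one [simp]: "u \<in> carrier P \<Longrightarrow> \<phi> \<one>\<^bsub>E\<^esub> u = u"
  using phi_comp[of "\<one>\<^bsub>E\<^esub>" "\<one>\<^bsub>E\<^esub>" u] phi_inj[of "\<one>\<^bsub>E\<^esub>" "\<phi> \<one>\<^bsub>E\<^esub> u" u] by simp

lemma phi_inv_cancel [simp]:
  assumes "e \<in> carrier E" "u \<in> carrier P"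
  shows "\<phi> e (\<phi> (inv\<^bsub>E\<^esub> e) u) = u" "\<phi> (inv\<^bsub>E\<^esub> e) (\<phi> e u) = u"
  using assms by (simp_all flip: phi_comp)

definition Gr :: "('a \<times> 'b) monoid" where "Gr = semidirect_product P E \<phi>"

lemma Gr_simps [simp]:
  "carrier Gr = carrier P \<times> carrier E"
  "(u, e) \<otimes>\<^bsub>Gr\<^esub> (v, f) = (u \<otimes> \<phi> e v, e \<otimes>\<^bsub>E\<^esub> f)"
  "\<one>\<^bsub>Gr\<^esub> = (\<one>, \<one>\<^bsub>E\<^esub>)"
  by (simp_all add: Gr_def semidirect_product_def)

lemma group_Gr: "group Gr"
proof (rule groupI)
  fix x assume "x \<in> carrier Gr"
  then show "\<exists>y\<in>carrier Gr. y \<otimes>\<^bsub>Gr\<^esub> x = \<one>\<^bsub>Gr\<^esub>"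
    by (intro bexI[of _ "(\<phi> (inv\<^bsub>E\<^esub> (snd x)) (inv (fst x)), inv\<^bsub>E\<^esub> (snd x))"])
       (auto simp flip: phi_mult)
qed (auto simp: P.m_assoc E.m_assoc phi_mult phi_comp)

end

sublocale p'_action \<subseteq> finite_group Gr
  by (intro finite_group.intro finite_group_axioms.intro group_Gr) simp

context p'_action
begin

abbreviation cvG (infixl \<open>\<star>\<close> 70) where "a \<star> b \<equiv> conv Gr a b"

lemma Gr_inv:
  assumes "u \<in> carrier P" "e \<in> carrier E"
  shows "inv\<^bsub>Gr\<^esub> (u, e) = (\<phi> (inv\<^bsub>E\<^esub> e) (inv u), inv\<^bsub>E\<^esub> e)"
  by (rule inv_equality) (use assms in \<open>auto simp flip: phi_mult\<close>)

definition one' :: "'a \<times> 'b \<Rightarrow> 'k" where "one' = sgl (\<one>, \<one>\<^bsub>E\<^esub>)"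

definition up :: "'a \<Rightarrow> 'a \<times> 'b \<Rightarrow> 'k" where "up u = sgl (u, \<one>\<^bsub>E\<^esub>)"

definition ue :: "'b \<Rightarrow> 'a \<times> 'b \<Rightarrow> 'k" where "ue e = sgl (\<one>, e)"

lemma up_KG [simp, intro]: "u \<in> carrier P \<Longrightarrow> up u \<in> KG"
  and ue_KG [simp, intro]: "e \<in> carrier E \<Longrightarrow> ue e \<in> KG"
  and one_KG [simp, intro]: "one' \<in> KG"
  and up_one: "up \<one> = one'"
  and ue_one: "ue \<one>\<^bsub>E\<^esub> = one'"
  by (auto simp: up_def ue_def one'_def)

lemma one'_left [simp]: "a \<in> KG \<Longrightarrow> one' \<star> a = a"
  and one'_right [simp]: "a \<in> KG \<Longrightarrow> a \<star> one' = a"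
  using conv_one_left[of a] conv_one_right[of a] by (simp_all add: one'_def)

lemma up_mult: "u \<in> carrier P \<Longrightarrow> v \<in> carrier P \<Longrightarrow> up u \<star> up v = up (u \<otimes> v)"
  and ue_mult: "e \<in> carrier E \<Longrightarrow> f \<in> carrier E \<Longrightarrow> ue e \<star> ue f = ue (e \<otimes>\<^bsub>E\<^esub> f)"
  and up_ue: "u \<in> carrier P \<Longrightarrow> e \<in> carrier E \<Longrightarrow> up u \<star> ue e = sgl (u, e)"
  by (auto simp: up_def ue_def)

lemma up_mult_assoc: "u \<in> carrier P \<Longrightarrow> v \<in> carrier P \<Longrightarrow> up u \<star> (up v \<star> a) = up (u \<otimes> v) \<star> a"
  and ue_mult_assoc: "e \<in> carrier E \<Longrightarrow> f \<in> carrier E \<Longrightarrow> ue e \<star> (ue f \<star> a) = ue (e \<otimes>\<^bsub>E\<^esub> f) \<star> a"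
  by (simp_all add: up_mult ue_mult flip: conv_assoc)

text \<open>\<open>Jp n\<close> is \<open>J\<^sup>n\<close> for the ideal \<open>J\<close> generated by the \<open>u - 1\<close>, which is the Jacobson radical
  because \<open>E\<close> is a \<open>p'\<close>-group.\<close>

primrec Jp :: "nat \<Rightarrow> ('a \<times> 'b \<Rightarrow> 'k) set" where
  "Jp 0 = KG"
| "Jp (Suc n) = fv.span {(up u - one') \<star> x | u x. u \<in> carrier P \<and> x \<in> Jp n}"

lemma subspace_Jp: "fv.subspace (Jp n)"
  by (cases n) (auto simp: subspace_KG)

lemmas Jp_add [intro] = fv.subspace_add[OF subspace_Jp]
  and Jp_diff [intro] = fv.subspace_diff[OF subspace_Jp]
  and Jp_neg [intro] = fv.subspace_neg[OF subspace_Jp]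
  and Jp_scl [intro] = fv.subspace_scale[OF subspace_Jp]
  and Jp_zero [simp, intro] = fv.subspace_0[OF subspace_Jp]
  and Jp_sum [intro] = fv.subspace_sum[OF subspace_Jp]

lemma Jp_gen: "u \<in> carrier P \<Longrightarrow> x \<in> Jp n \<Longrightarrow> (up u - one') \<star> x \<in> Jp (Suc n)"
  by (auto intro: fv.span_base)

lemma Jp_KG: "x \<in> Jp n \<Longrightarrow> x \<in> KG"
proof (cases n)
  case (Suc m)
  moreover have "Jp (Suc m) \<subseteq> KG"
    unfolding Jp.simps by (rule fv.span_minimal) (auto simp: subspace_KG)
  ultimately show "x \<in> Jp n \<Longrightarrow> x \<in> KG" by blast
qed simp

text \<open>The membership premises in the linear steps are for derivations, whose linearity is
  available on \<open>KG\<close> only.\<close>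

lemma Jp_Suc_induct [consumes 1, case_names zero add scl gen]:
  assumes "x \<in> Jp (Suc n)" and "Q 0"
    and "\<And>x y. x \<in> Jp (Suc n) \<Longrightarrow> y \<in> Jp (Suc n) \<Longrightarrow> Q x \<Longrightarrow> Q y \<Longrightarrow> Q (x + y)"
    and "\<And>c x. x \<in> Jp (Suc n) \<Longrightarrow> Q x \<Longrightarrow> Q (scl c x)"
    and "\<And>u y. u \<in> carrier P \<Longrightarrow> y \<in> Jp n \<Longrightarrow> Q ((up u - one') \<star> y)"
  shows "Q x"
proof -
  have "x \<in> Jp (Suc n) \<and> Q x"
    using assms(1) unfolding Jp.simps(2)
  proof (induction x rule: fv.span_induct)
    case base
    show ?case
      using assms(2-4) unfolding fv.subspace_def by (auto simp: fv.span_zero fv.span_add fv.span_scale)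
  next
    case (step x)
    then show ?case using assms(5) by (auto intro: fv.span_base)
  qed
  then show ?thesis by simp
qed

lemma Jp_right: "x \<in> Jp n \<Longrightarrow> a \<in> KG \<Longrightarrow> x \<star> a \<in> Jp n"
proof (induction n arbitrary: x)
  case (Suc n)
  from Suc.prems(1) show ?case
  proof (induction x rule: Jp_Suc_induct)
    case (gen u y)
    then show ?case using Suc by (simp only: conv_assoc Jp_gen)
  qed (use Suc in \<open>auto simp only: conv_bilinear conv_zero_left Jp_add Jp_scl Jp_zero\<close>)
qed simp

lemma Jp_sgl_left: "x \<in> Jp n \<Longrightarrow> g \<in> carrier Gr \<Longrightarrow> sgl g \<star> x \<in> Jp n"
proof (induction n arbitrary: x)
  case (Suc n)
  obtain v e where g: "g = (v, e)" "v \<in> carrier P" "e \<in> carrier E" using Suc.prems(2) by auto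
  from Suc.prems(1) show ?case
  proof (induction x rule: Jp_Suc_induct)
    case (gen u y)
    \<comment> \<open>Generators move past group elements:
      \<open>g (u - 1) = (\<phi> e u - 1) g\<close> for \<open>g = (v, e)\<close>, where
      \<open>v\<close> passes because \<open>P\<close> is commutative. This makes the left ideals
      two-sided.\<close>
    have "sgl g \<star> (up u - one') = (up (\<phi> e u) - one') \<star> sgl g"
      using g gen by (simp add: conv_bilinear up_def one'_def P.m_comm)
    then have "sgl g \<star> ((up u - one') \<star> y) = (up (\<phi> e u) - one') \<star> (sgl g \<star> y)"
      by (metis conv_assoc)
    then show ?case using gen Suc.IH[of y] Suc.prems(2) g by (simp only: Jp_gen phi_closed)
  qed (use Suc in \<open>auto simp only: conv_bilinear conv_zero_right Jp_add Jp_scl Jp_zero\<close>)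
qed simp

lemma Jp_left: "a \<in> KG \<Longrightarrow> x \<in> Jp n \<Longrightarrow> a \<star> x \<in> Jp n"
  by (induction a rule: KG_induct)
     (auto simp only: conv_bilinear conv_zero_left Jp_add Jp_scl Jp_zero Jp_sgl_left)

lemma Jp_mult: "x \<in> Jp m \<Longrightarrow> y \<in> Jp n \<Longrightarrow> x \<star> y \<in> Jp (m + n)"
proof (induction m arbitrary: x)
  case 0
  then show ?case by (simp add: Jp_left)
next
  case (Suc m)
  from Suc.prems(1) show ?case
  proof (induction x rule: Jp_Suc_induct)
    case (gen u z)
    then show ?case using Suc by (simp only: conv_assoc Jp_gen add_Suc)
  qed (use Suc in \<open>auto simp only: conv_bilinear conv_zero_left Jp_add Jp_scl Jp_zero\<close>)
qed

lemma Jp_Suc_subset: "Jp (Suc n) \<subseteq> Jp n"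
proof
  fix x assume "x \<in> Jp (Suc n)"
  then show "x \<in> Jp n"
    by (induction x rule: Jp_Suc_induct) (auto simp only: Jp_add Jp_scl Jp_zero Jp_left KG_diff up_KG one_KG)
qed

lemma Jp_antimono: "m \<le> n \<Longrightarrow> Jp n \<subseteq> Jp m"
  using lift_Suc_antimono_le[of Jp] Jp_Suc_subset by blast

lemma aug_in_Jp1: "u \<in> carrier P \<Longrightarrow> up u - one' \<in> Jp 1"
  using Jp_gen[of u one' 0] by simp

section \<open>Nilpotency of \<open>J\<close>\<close>

definition aug_prod :: "'a list \<Rightarrow> ('a \<times> 'b \<Rightarrow> 'k) \<Rightarrow> ('a \<times> 'b \<Rightarrow> 'k)" where
  "aug_prod us y = foldr (\<lambda>u y. (up u - one') \<star> y) us y"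

lemma aug_prod_KG: "y \<in> KG \<Longrightarrow> aug_prod us y \<in> KG"
  by (cases us) (auto simp: aug_prod_def)

lemma Jp_span_aug_prod: "x \<in> Jp n \<Longrightarrow> x \<in> fv.span {aug_prod us y | us y. set us \<subseteq> carrier P \<and> length us = n \<and> y \<in> KG}"
proof (induction n arbitrary: x)
  case 0
  then show ?case by (intro fv.span_base) (auto simp: aug_prod_def)
next
  case (Suc n)
  from Suc.prems show ?case
  proof (induction x rule: Jp_Suc_induct)
    case (gen u y)
    have "y \<in> fv.span {aug_prod us y | us y. set us \<subseteq> carrier P \<and> length us = n \<and> y \<in> KG}"
      using gen Suc.IH by blast
    then show ?case
    proof (induction y rule: fv.span_induct_alt)
      case (step c x y)
      then obtain us z where x: "x = aug_prod us z" "set us \<subseteq> carrier P" "length us = n" "z \<in> KG" by blast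
      have "(up u - one') \<star> x = aug_prod (u # us) z" by (simp add: x aug_prod_def)
      then have "(up u - one') \<star> x \<in> fv.span {aug_prod us y | us y. set us \<subseteq> carrier P \<and> length us = Suc n \<and> y \<in> KG}"
        using x gen by (intro fv.span_base) (auto intro!: exI[of _ "u # us"])
      then show ?case using step by (simp only: conv_bilinear fv.span_add fv.span_scale)
    qed (simp add: fv.span_zero)
  qed (auto simp only: fv.span_add fv.span_scale fv.span_zero)
qed

lemma aug_commute:
  assumes "u \<in> carrier P" "v \<in> carrier P"
  shows "(up u - one') \<star> ((up v - one') \<star> y) = (up v - one') \<star> ((up u - one') \<star> y)"
proof -
  have "(up u - one') \<star> (up v - one') = (up v - one') \<star> (up u - one')"
    using assms by (simp add: conv_bilinear up_mult P.m_comm)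
  then show ?thesis by (metis conv_assoc)
qed

lemma aug_funpow_commute:
  assumes "u \<in> carrier P" "v \<in> carrier P"
  shows "(up v - one') \<star> (((\<lambda>y. (up u - one') \<star> y) ^^ c) y) = ((\<lambda>y. (up u - one') \<star> y) ^^ c) ((up v - one') \<star> y)"
  by (induction c) (simp_all add: aug_commute[OF assms(2,1)])

text \<open>The factors commute, so all those equal to \<open>u - 1\<close> can be moved to the
  front.\<close>

lemma aug_prod_split:
  assumes "set us \<subseteq> carrier P" "u \<in> carrier P"
  shows "aug_prod us y = ((\<lambda>y. (up u - one') \<star> y) ^^ count_list us u) (aug_prod (filter (\<lambda>v. v \<noteq> u) us) y)"
  using assms(1) by (induction us) (auto simp: aug_prod_def aug_funpow_commute[OF assms(2)])

lemma funpow_KG: "y \<in> KG \<Longrightarrow> ((\<lambda>y. a \<star> y) ^^ c) y \<in> KG"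
  by (cases c) auto

text \<open>The order of \<open>P\<close> is a power of \<open>p\<close>, so
  \<open>(u - 1)^|P| = u^|P| - 1 = 0\<close> by \<open>funpow_minus_id\<close>.\<close>

lemma aug_funpow_zero:
  assumes u: "u \<in> carrier P" and y: "y \<in> KG" and c: "Coset.order P \<le> c"
  shows "((\<lambda>y. (up u - one') \<star> y) ^^ c) y = 0"
proof -
  obtain n where n: "Coset.order P = p ^ n" using order_P by blast
  let ?X = "\<lambda>y. (up u - one') \<star> y"
  have pow: "(((\<star>) (up u)) ^^ m) z = up (u [^] m) \<star> z" if "z \<in> KG" for z m
    using that u by (induction m) (simp_all add: up_one up_mult_assoc P.m_comm)
  have X: "(?X ^^ m) z = ((\<lambda>y. up u \<star> y - y) ^^ m) z" if "z \<in> KG" for z m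
  proof (induction m)
    case (Suc m)
    then show ?case using funpow_KG[OF that, where a = "up u - one'" and c = m] by (simp add: conv_diff_left)
  qed simp
  have "(?X ^^ (p ^ n)) z = 0" if z: "z \<in> KG" for z
    using X[OF z] pow[OF z, of "p ^ n"] z P.pow_order_eq_1[OF u]
      funpow_minus_id[OF prime_p char_k, of "(\<star>) (up u)" n z]
    by (simp add: conv_bilinear n up_one)
  moreover have "?X ^^ c = ?X ^^ (p ^ n) \<circ> ?X ^^ (c - p ^ n)"
    using c n by (simp flip: funpow_add)
  ultimately show ?thesis using funpow_KG[OF y] by simp
qed

lemma Jp_nilpotent: "\<exists>N. Jp N = {0}"
proof -
  \<comment> \<open>Pigeonhole: a word of length \<open>|P| |P|\<close> in elements of
    \<open>P\<close> contains some letter at least \<open>|P|\<close> times.\<close>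
  define N where "N = card (carrier P) * Coset.order P"
  have "aug_prod us y = 0" if us: "set us \<subseteq> carrier P" "length us = N" and y: "y \<in> KG" for us y
  proof -
    have "\<exists>u\<in>carrier P. Coset.order P \<le> count_list us u"
    proof (rule ccontr)
      assume "\<not> ?thesis"
      then have "sum (count_list us) (carrier P) < (\<Sum>u\<in>carrier P. Coset.order P)"
        using P.one_closed by (intro sum_strict_mono) (auto simp: not_le)
      then show False using sum_count_set[OF us(1) fin_P] us(2) by (simp add: N_def)
    qed
    then obtain u where "u \<in> carrier P" "Coset.order P \<le> count_list us u" by blast
    then show ?thesis using aug_prod_split[OF us(1)] aug_funpow_zero aug_prod_KG[OF y] by metis
  qed
  then have "{aug_prod us y | us y. set us \<subseteq> carrier P \<and> length us = N \<and> y \<in> KG} \<subseteq> {0}" by blast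
  then have "Jp N \<subseteq> {0}" using Jp_span_aug_prod[of _ N] fv.span_mono fv.span_minimal
    by (metis (no_types, lifting) fv.span_singleton fv.subspace_single_0 subset_iff)
  then show ?thesis using Jp_zero by blast
qed

end

section \<open>Derivations and the radical filtration\<close>

lemma (in finite_group) conj_apply:
  assumes "g \<in> carrier G"
  shows "(sgl g \<star> (a \<star> sgl (inv g))) x = (if x \<in> carrier G then a (inv g \<otimes> (x \<otimes> g)) else 0)"
  using assms by (auto simp: conv_sgl_left conv_sgl_right m_assoc)

context p'_action
begin

declare Jp.simps(2) [simp del]

text \<open>Degree \<open>n\<close> means raising the \<open>J\<close>-adic order by
  \<open>n\<close>. It is imposed on \<open>P\<close> only; killing \<open>E\<close> spreads it to
  every power of \<open>J\<close> (\<open>Fil_Jp\<close>). It is a condition on representatives, not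
  on classes.\<close>

definition Fil :: "nat \<Rightarrow> (('a \<times> 'b \<Rightarrow> 'k) \<Rightarrow> ('a \<times> 'b \<Rightarrow> 'k)) \<Rightarrow> bool" where
  "Fil n d \<longleftrightarrow> d \<in> ders \<and> (\<forall>e\<in>carrier E. d (ue e) = 0) \<and> (\<forall>u\<in>carrier P. d (up u) \<in> Jp (Suc n))"

lemma der_one': "d \<in> ders \<Longrightarrow> d one' = 0"
  using der_one[of d] by (simp add: one'_def)

lemma der_sgl:
  assumes d: "d \<in> ders" "\<forall>e\<in>carrier E. d (ue e) = 0" and "u \<in> carrier P" "e \<in> carrier E"
  shows "d (sgl (u, e)) = d (up u) \<star> ue e"
  using der_mult[OF d(1), of "up u" "ue e"] assms by (simp add: up_ue)

text \<open>Leibniz on \<open>(u - 1) y\<close>: the term \<open>d(u) y\<close> has order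
  \<open>(n + 1) + m\<close> by definition, the term \<open>(u - 1) d(y)\<close> has order
  \<open>1 + (m + n)\<close> by induction.\<close>

lemma Fil_Jp:
  assumes d: "Fil n d" and x: "x \<in> Jp m"
  shows "d x \<in> Jp (m + n)"
  using x
proof (induction m arbitrary: x)
  case 0
  have dd: "d \<in> ders" using d by (simp add: Fil_def)
  from 0 have "x \<in> KG" by simp
  then have "d x \<in> Jp n"
  proof (induction x rule: KG_induct)
    case (sgl g)
    then obtain u e where g: "g = (u, e)" "u \<in> carrier P" "e \<in> carrier E" by auto
    have "d (up u) \<star> ue e \<in> Jp (Suc n)" using d g by (intro Jp_right) (auto simp: Fil_def)
    then show ?case using der_sgl[OF dd _ g(2,3)] d Jp_Suc_subset[of n] by (auto simp: g Fil_def)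
  qed (simp_all only: der_rules[OF dd] Jp_add Jp_scl Jp_zero)
  then show ?case by simp
next
  case (Suc m)
  have dd: "d \<in> ders" using d by (simp add: Fil_def)
  from Suc.prems show ?case
  proof (induction x rule: Jp_Suc_induct)
    case (gen u y)
    then have y: "y \<in> KG" using Jp_KG by blast
    have "d ((up u - one') \<star> y) = d (up u) \<star> y + (up u - one') \<star> d y"
      using y gen by (simp add: der_rules[OF dd] der_one'[OF dd])
    moreover have "d (up u) \<star> y \<in> Jp (Suc n + m)" using d gen by (intro Jp_mult) (auto simp: Fil_def)
    moreover have "(up u - one') \<star> d y \<in> Jp (Suc (m + n))" using Suc.IH gen by (intro Jp_gen) auto
    ultimately show ?case by (simp only: Jp_add add_Suc add.commute[of n m])
  qed (simp_all only: der_rules[OF dd] Jp_add Jp_scl Jp_zero Jp_KG)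
qed

lemma FilD: "Fil n d \<Longrightarrow> d \<in> ders" "Fil n d \<Longrightarrow> e \<in> carrier E \<Longrightarrow> d (ue e) = 0"
  "Fil n d \<Longrightarrow> u \<in> carrier P \<Longrightarrow> d (up u) \<in> Jp (Suc n)"
  by (auto simp: Fil_def)

lemma Fil_dbr:
  assumes "Fil m d" "Fil n d'"
  shows "Fil (m + n) (dbr d d')"
  unfolding Fil_def
proof (intro conjI ballI)
  note dd = FilD(1)[OF assms(1)] FilD(1)[OF assms(2)]
  show "dbr d d' \<in> ders" using dd by blast
  fix e assume "e \<in> carrier E"
  then show "dbr d d' (ue e) = 0"
    using FilD(2)[OF assms(1)] FilD(2)[OF assms(2)] dd by (simp add: dbr_apply der_zero)
next
  note dd = FilD(1)[OF assms(1)] FilD(1)[OF assms(2)]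
  fix u assume u: "u \<in> carrier P"
  have "d (d' (up u)) \<in> Jp (Suc n + m)" "d' (d (up u)) \<in> Jp (Suc m + n)"
    using Fil_Jp[OF assms(1) FilD(3)[OF assms(2) u]] Fil_Jp[OF assms(2) FilD(3)[OF assms(1) u]] .
  then show "dbr d d' (up u) \<in> Jp (Suc (m + n))"
    using u by (simp only: dbr_apply up_KG Jp_diff add_Suc add.commute[of n m])
qed

lemma Fil_dadd: "Fil n d \<Longrightarrow> Fil n d' \<Longrightarrow> Fil n (dadd d d')"
  by (auto simp: Fil_def dadd_apply simp del: Jp.simps)

lemma Fil_dscl: "Fil n d \<Longrightarrow> Fil n (dscl c d)"
  by (auto simp: Fil_def dscl_apply simp del: Jp.simps)

lemma Fil_zero: "Fil n (ad 0)"
  by (auto simp: Fil_def ad_apply simp del: Jp.simps)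

lemma Fil_antimono: "m \<le> n \<Longrightarrow> Fil n d \<Longrightarrow> Fil m d"
  using Jp_antimono[of "Suc m" "Suc n"] by (auto simp: Fil_def simp del: Jp.simps)

lemma Fil_eq_zero:
  assumes "Fil n d" "Jp (Suc n) = {0}"
  shows "d = ad 0"
proof (rule ders_eqI)
  note dd = FilD(1)[OF assms(1)]
  show "d \<in> ders" "ad 0 \<in> ders" using dd by auto
  fix g assume "g \<in> carrier Gr"
  then obtain u e where g: "g = (u, e)" "u \<in> carrier P" "e \<in> carrier E" by auto
  then show "d (sgl g) = ad 0 (sgl g)"
    using der_sgl[OF dd _ g(2,3)] FilD(2,3)[OF assms(1)] assms(2) by (auto simp: ad_apply simp del: Jp.simps)
qed

text \<open>In positive degrees brackets raise the degree by \<open>Fil_dbr\<close>, but two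
  elements of degree 0 give only degree 0. \<open>H1\<close> bridges this single step, and
  nilpotency of \<open>J\<close> ends the series.\<close>

lemma lie_solvable_of_Fil:
  assumes H0: "\<And>d. d \<in> ders \<Longrightarrow> \<exists>a\<in>KG. Fil 0 (dadd (ad a) d)"
    and H1: "\<And>d d'. Fil 0 d \<Longrightarrow> Fil 0 d' \<Longrightarrow> \<exists>a\<in>KG. Fil 1 (dadd (ad a) (dbr d d'))"
  shows "lie_solvable (HA :: ('k, _) module)"
proof -
  have sub: "submodule (cls ` {d. Fil n d}) (ring_of_type_algebra :: 'k ring) HA" for n
    by (rule submodule_cls) (auto simp: FilD Fil_dadd Fil_dscl Fil_zero)
  have car: "carrier HA \<subseteq> cls ` {d. Fil 0 d}"
  proof
    fix x assume "x \<in> carrier (HA :: ('k, _) module)"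
    then obtain d where d: "d \<in> ders" "x = cls d" by (auto simp: HA_carrier)
    obtain a where "a \<in> KG" "Fil 0 (dadd (ad a) d)" using H0[OF d(1)] by blast
    then show "x \<in> cls ` {d. Fil 0 d}" using cls_eq[OF d(1)] d(2) by auto
  qed
  have der: "(lie_derived HA ^^ Suc n) (carrier HA) \<subseteq> cls ` {d. Fil (Suc n) d}" for n
  proof (induction n)
    case 0
    have "cls (dbr f g) \<in> cls ` {d. Fil 1 d}" if f: "f \<in> {d. Fil 0 d}" and g: "g \<in> {d. Fil 0 d}" for f g
    proof -
      have fg: "dbr f g \<in> ders" using f g FilD(1) by blast
      obtain a where "a \<in> KG" "Fil 1 (dadd (ad a) (dbr f g))" using H1[of f g] f g by blast
      then show ?thesis using cls_eq[OF fg] by (metis imageI mem_Collect_eq)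
    qed
    then have "lie_derived HA (carrier HA) \<subseteq> cls ` {d. Fil 1 d}"
      by (intro lie_derived_cls_subset[OF _ sub _ car]) (auto simp: FilD)
    then show ?case by simp
  next
    case (Suc n)
    have "cls (dbr f g) \<in> cls ` {d. Fil (Suc (Suc n)) d}"
      if "f \<in> {d. Fil (Suc n) d}" "g \<in> {d. Fil (Suc n) d}" for f g
    proof -
      have "Fil (Suc n + Suc n) (dbr f g)" using that by (intro Fil_dbr) auto
      then have "Fil (Suc (Suc n)) (dbr f g)" by (rule Fil_antimono[rotated]) simp
      then show ?thesis by blast
    qed
    then have "lie_derived HA ((lie_derived HA ^^ Suc n) (carrier HA)) \<subseteq> cls ` {d. Fil (Suc (Suc n)) d}"
      by (intro lie_derived_cls_subset[OF _ sub _ Suc.IH]) (auto simp: FilD)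
    then show ?case by simp
  qed
  obtain N where N: "Jp N = {0}" using Jp_nilpotent by blast
  \<comment> \<open>Degree \<open>Suc N\<close> puts each \<open>d(u)\<close> into
    \<open>Jp (Suc (Suc N))\<close>, which is contained in \<open>Jp N\<close> and thus
    zero.\<close>
  have "cls ` {d. Fil (Suc N) d} \<subseteq> {inn}"
  proof -
    have "Jp (Suc (Suc N)) \<subseteq> {0}" using Jp_antimono[of N "Suc (Suc N)"] N by simp
    then have "Jp (Suc (Suc N)) = {0}" using Jp_zero[of "Suc (Suc N)"] by blast
    then show ?thesis using Fil_eq_zero[of "Suc N"] cls_zero by auto
  qed
  then have "(lie_derived HA ^^ Suc N) (carrier (HA :: ('k, _) module)) \<subseteq> {inn}" by (rule order_trans[OF der])
  moreover have "inn \<in> (lie_derived HA ^^ Suc N) (carrier (HA :: ('k, _) module))"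
    by (simp add: zero_in_lie_derived)
  ultimately have "(lie_derived HA ^^ Suc N) (carrier (HA :: ('k, _) module)) = {\<zero>\<^bsub>(HA :: ('k, _) module)\<^esub>}"
    by (auto simp: HA_zero)
  then show ?thesis unfolding lie_solvable_def by blast
qed

text \<open>A nilpotent ideal lies in every maximal left ideal \<open>M\<close>: otherwise
  \<open>1 = m + a x\<close> with \<open>m\<close> in \<open>M\<close>, and multiplication by powers
  of the ideal pulls these powers into \<open>M\<close> one after the other.\<close>

lemma Jp1_in_jacobson:
  assumes x: "x \<in> Jp 1"
  shows "x \<in> jacobson_radical (A :: ('k, _) module)"
proof -
  have "x \<in> M" if M: "maximal_left_ideal M (A :: ('k, _) module)" for M
  proof (rule ccontr)
    assume nx: "x \<notin> M"
    have li: "left_ideal M (A :: ('k, _) module)" and ne: "M \<noteq> KG"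
      using M by (auto simp: maximal_left_ideal_def)
    interpret M: additive_subgroup M "A :: ('k, _) module"
      using li by (simp add: left_ideal_def)
    interpret AG: abelian_group "A :: ('k, _) module" by (rule abelian_group_A)
    have Mk: "m \<in> KG" if "m \<in> M" for m using M.a_subset that by auto
    have Madd: "m + m' \<in> M" if "m \<in> M" "m' \<in> M" for m m' using M.a_closed[OF that] by simp
    have Mneg: "- m \<in> M" if "m \<in> M" for m
      using M.a_inv_closed[of m] that Mk[OF that] by simp
    have M0: "0 \<in> M" using M.zero_closed by simp
    have Mmul: "r \<star> m \<in> M" if "r \<in> KG" "m \<in> M" for r m
      using li that by (auto simp: left_ideal_def)
    have xK: "x \<in> KG" using x Jp_KG by blast
    \<comment> \<open>In this proof \<open>J\<close> denotes the left ideal \<open>M + KG x\<close>,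
      not the ideal \<open>Jp 1\<close>.\<close>
    define J where "J = {m + a \<star> x | m a. m \<in> M \<and> a \<in> KG}"
    have Jk: "J \<subseteq> KG" using Mk xK by (auto simp: J_def)
    have "left_ideal J (A :: ('k, _) module)"
      unfolding left_ideal_def
    proof (intro conjI ballI)
      show "additive_subgroup J (A :: ('k, _) module)"
      proof (rule additive_subgroupI, rule group.subgroupI[OF AG.a_group])
        show "J \<subseteq> carrier (add_monoid A)" using Jk by simp
        show "J \<noteq> {}" using M0 by (auto simp: J_def)
      next
        fix y assume y: "y \<in> J"
        then obtain m a where ma: "m \<in> M" "a \<in> KG" "y = m + a \<star> x" by (auto simp: J_def)
        have "- y = - m + (- a) \<star> x" using ma by (simp add: conv_bilinear)
        then have "- y \<in> J" using Mneg[OF ma(1)] ma(2) unfolding J_def by blast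
        then show "inv\<^bsub>add_monoid A\<^esub> y \<in> J"
          using a_inv_A[of y] Jk y by (auto simp: a_inv_def)
      next
        fix y z assume "y \<in> J" "z \<in> J"
        then obtain m a m' a' where ma: "m \<in> M" "a \<in> KG" "y = m + a \<star> x" "m' \<in> M" "a' \<in> KG" "z = m' + a' \<star> x"
          by (auto simp: J_def)
        then have "y + z = (m + m') + (a + a') \<star> x" by (simp add: conv_bilinear)
        then have "y + z \<in> J" unfolding J_def using Madd[OF ma(1,4)] KG_add[OF ma(2,5)] by blast
        then show "y \<otimes>\<^bsub>add_monoid A\<^esub> z \<in> J" by simp
      qed
    next
      fix r y assume r: "r \<in> carrier (A :: ('k, _) module)" and y: "y \<in> J"
      then obtain m a where ma: "m \<in> M" "a \<in> KG" "y = m + a \<star> x" by (auto simp: J_def)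
      then have "r \<star> y = r \<star> m + (r \<star> a) \<star> x" by (simp add: conv_bilinear conv_assoc)
      then show "r \<otimes>\<^bsub>A\<^esub> y \<in> J" using Mmul ma r by (auto simp: J_def)
    qed
    moreover have "M \<subseteq> J"
    proof
      fix m assume "m \<in> M"
      moreover have "m = m + 0 \<star> x" by simp
      ultimately show "m \<in> J" unfolding J_def by blast
    qed
    moreover have "x = 0 + one' \<star> x" using xK by simp
    then have "x \<in> J" unfolding J_def using M0 one_KG by blast
    ultimately have "J = KG" using M nx by (auto simp: maximal_left_ideal_def)
    then have "one' \<in> J" by simp
    then obtain m a where ma: "m \<in> M" "a \<in> KG" "one' = m + a \<star> x" by (auto simp: J_def)
    obtain N where N: "Jp N = {0}" using Jp_nilpotent by blast
    have y: "a \<star> x \<in> Jp 1" using ma x by (intro Jp_left)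
    \<comment> \<open>Downward induction from \<open>Jp N = {0}\<close>: in
      \<open>z = z m + z (a x)\<close> the second term has one order more than \<open>z\<close>. At
      \<open>n = 0\<close> all of \<open>KG\<close> is swallowed.\<close>
    have "Jp n \<subseteq> M" if "n \<le> N" for n
      using that
    proof (induction n rule: inc_induct)
      case base
      then show ?case using N M0 by simp
    next
      case (step n)
      show ?case
      proof
        fix z assume z: "z \<in> Jp n"
        have "z \<star> (a \<star> x) \<in> M" using Jp_mult[OF z y] step by (auto simp del: Jp.simps)
        moreover have "z \<star> m \<in> M" using Mmul Jp_KG[OF z] ma by blast
        moreover have "z = z \<star> m + z \<star> (a \<star> x)" using Jp_KG[OF z] ma(3) by (metis conv_add_right one'_right)
        ultimately show "z \<in> M" using Madd by metis
      qed
    qed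
    from this[of 0] have "KG \<subseteq> M" by simp
    then show False using ne Mk by blast
  qed
  then show ?thesis using Jp_KG[OF x] by (auto simp: jacobson_radical_def)
qed

lemma order_E_nonzero: "of_nat (Coset.order E) \<noteq> (0 :: 'k)"
proof
  assume "of_nat (Coset.order E) = (0 :: 'k)"
  then have "p dvd Coset.order E" using char_k of_nat_eq_0_iff_char_dvd[where 'a = 'k] by simp
  then have "is_unit p" using coprime_E by (meson coprime_common_divisor dvd_refl)
  then show False using prime_p not_prime_unit by blast
qed

text \<open>On a \<open>p'\<close>-group the cocycle \<open>f \<mapsto> d(f) f^(-1)\<close> is a
  coboundary. Its sum \<open>b\<close> over \<open>E\<close> satisfies
  \<open>e b = b e - |E| d(e)\<close>, so \<open>a = - b / |E|\<close> is the correction.\<close>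

lemma kill_E:
  assumes d: "d \<in> ders"
  obtains a where "a \<in> KG" "\<And>e. e \<in> carrier E \<Longrightarrow> dadd (ad a) d (ue e) = 0"
proof -
  define b where "b = (\<Sum>f\<in>carrier E. d (ue f) \<star> ue (inv\<^bsub>E\<^esub> f))"
  have bK: "b \<in> KG" unfolding b_def by (intro KG_sum) simp
  let ?n = "of_nat (Coset.order E) :: 'k"
  have *: "ue e \<star> b = b \<star> ue e - scl ?n (d (ue e))" if e: "e \<in> carrier E" for e
  proof -
    have "ue e \<star> b = (\<Sum>f\<in>carrier E. ue e \<star> d (ue f) \<star> ue (inv\<^bsub>E\<^esub> f))"
      by (simp add: b_def conv_sum_right conv_assoc)
    also have "\<dots> = (\<Sum>f\<in>carrier E. d (ue (e \<otimes>\<^bsub>E\<^esub> f)) \<star> ue (inv\<^bsub>E\<^esub> (e \<otimes>\<^bsub>E\<^esub> f)) \<star> ue e - d (ue e))"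
    proof (rule sum.cong)
      fix f assume f: "f \<in> carrier E"
      have "d (ue (e \<otimes>\<^bsub>E\<^esub> f)) = d (ue e) \<star> ue f + ue e \<star> d (ue f)"
        using der_mult[OF d, of "ue e" "ue f"] e f by (simp add: ue_mult)
      moreover have "ue (inv\<^bsub>E\<^esub> (e \<otimes>\<^bsub>E\<^esub> f)) \<star> ue e = ue (inv\<^bsub>E\<^esub> f)"
        using e f by (simp add: ue_mult E.inv_mult_group E.m_assoc)
      ultimately show "ue e \<star> d (ue f) \<star> ue (inv\<^bsub>E\<^esub> f) =
          d (ue (e \<otimes>\<^bsub>E\<^esub> f)) \<star> ue (inv\<^bsub>E\<^esub> (e \<otimes>\<^bsub>E\<^esub> f)) \<star> ue e - d (ue e)"
        using e f by (simp add: conv_assoc conv_bilinear ue_mult ue_one der_closed[OF d]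
            E.inv_mult_group E.m_assoc)
    qed simp
    also have "\<dots> = (\<Sum>f\<in>carrier E. d (ue (e \<otimes>\<^bsub>E\<^esub> f)) \<star> ue (inv\<^bsub>E\<^esub> (e \<otimes>\<^bsub>E\<^esub> f)) \<star> ue e) - scl ?n (d (ue e))"
      by (simp add: sum_subtractf fv.sum_constant_scale Coset.order_def del: sum_constant)
    also have "(\<Sum>f\<in>carrier E. d (ue (e \<otimes>\<^bsub>E\<^esub> f)) \<star> ue (inv\<^bsub>E\<^esub> (e \<otimes>\<^bsub>E\<^esub> f)) \<star> ue e) =
        (\<Sum>f\<in>carrier E. d (ue f) \<star> ue (inv\<^bsub>E\<^esub> f) \<star> ue e)"
      by (rule sum.reindex_bij_witness[where i = "\<lambda>f. inv\<^bsub>E\<^esub> e \<otimes>\<^bsub>E\<^esub> f" and j = "\<lambda>f. e \<otimes>\<^bsub>E\<^esub> f"])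
         (use e in \<open>auto simp flip: E.m_assoc\<close>)
    also have "\<dots> = b \<star> ue e" by (simp add: b_def conv_sum_left)
    finally show ?thesis .
  qed
  show thesis
  proof (rule that[of "scl (- inverse ?n) b"])
    show "scl (- inverse ?n) b \<in> KG" using bK by simp
    fix e assume "e \<in> carrier E"
    then show "dadd (ad (scl (- inverse ?n) b)) d (ue e) = 0"
      using * order_E_nonzero
      by (simp add: dadd_apply ad_apply conv_bilinear fv.scale_right_diff_distrib fv.scale_minus_left)
  qed
qed

end

section \<open>Derivations map into the radical\<close>

context p'_action
begin

definition log_der :: "(('a \<times> 'b \<Rightarrow> 'k) \<Rightarrow> ('a \<times> 'b \<Rightarrow> 'k)) \<Rightarrow> 'a \<Rightarrow> 'a \<times> 'b \<Rightarrow> 'k" where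
  "log_der d u = d (up u) \<star> up (inv u)"

text \<open>Conjugation by \<open>u\<close> maps \<open>(v, f)\<close> to
  \<open>(twist f u \<otimes> v, f)\<close>, so on the coset \<open>Pf\<close> it is a translation.
  The image of \<open>twist f\<close> is \<open>[P,f]\<close>, its kernel
  \<open>C_P(f)\<close>.\<close>

definition twist :: "'b \<Rightarrow> 'a \<Rightarrow> 'a" where
  "twist f u = u \<otimes> inv (\<phi> f u)"

definition Rf :: "'b \<Rightarrow> 'a set" where "Rf f = twist f ` carrier P"

definition Cf :: "'b \<Rightarrow> 'a set" where "Cf f = {c \<in> carrier P. \<phi> f c = c}"

lemma twist_closed [simp, intro]: "f \<in> carrier E \<Longrightarrow> u \<in> carrier P \<Longrightarrow> twist f u \<in> carrier P"
  by (simp add: twist_def)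

lemma twist_mult: "f \<in> carrier E \<Longrightarrow> u \<in> carrier P \<Longrightarrow> v \<in> carrier P \<Longrightarrow>
    twist f (u \<otimes> v) = twist f u \<otimes> twist f v"
  by (simp add: twist_def phi_mult P.inv_mult P.m_ac)

lemma twist_hom: "f \<in> carrier E \<Longrightarrow> group_hom P P (twist f)"
  by (unfold_locales) (auto simp: hom_def twist_mult)

lemma Rf_subgroup: "f \<in> carrier E \<Longrightarrow> subgroup (Rf f) P"
  unfolding Rf_def by (rule group_hom.img_is_subgroup[OF twist_hom])

lemma Cf_subgroup: "f \<in> carrier E \<Longrightarrow> subgroup (Cf f) P"
  by (rule P.subgroupI) (auto simp: Cf_def phi_mult phi_inv intro!: exI[of _ "\<one>"])

lemma twist_eq_one: "f \<in> carrier E \<Longrightarrow> c \<in> carrier P \<Longrightarrow> twist f c = \<one> \<longleftrightarrow> \<phi> f c = c"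
  unfolding twist_def by (metis P.inv_equality P.inv_inv P.inv_closed P.r_inv phi_closed)

text \<open>If \<open>r = u (f u)^(-1)\<close> is fixed by \<open>f\<close>, its powers telescope to
  \<open>r^m = u (f^m u)^(-1)\<close>. For \<open>m = |E|\<close> this is 1, while the order of
  \<open>r\<close> divides \<open>|P|\<close>, which is coprime to \<open>|E|\<close>.\<close>

lemma Rf_Cf_trivial:
  assumes f: "f \<in> carrier E" and r: "r \<in> Rf f" "r \<in> Cf f"
  shows "r = \<one>"
proof -
  obtain u where u: "u \<in> carrier P" "r = twist f u" using r by (auto simp: Rf_def)
  have rP: "r \<in> carrier P" using u f by simp
  have fixed: "\<phi> (f [^]\<^bsub>E\<^esub> i) r = r" for i :: nat
    using r f rP by (induction i) (auto simp: Cf_def phi_comp)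
  have "r [^] m = u \<otimes> inv (\<phi> (f [^]\<^bsub>E\<^esub> m) u)" for m :: nat
  proof (induction m)
    case (Suc m)
    let ?g = "f [^]\<^bsub>E\<^esub> m"
    have g: "?g \<in> carrier E" using f by simp
    have "r = \<phi> ?g (u \<otimes> inv (\<phi> f u))" using fixed[of m] u by (simp add: twist_def)
    also have "\<dots> = \<phi> ?g u \<otimes> inv (\<phi> (?g \<otimes>\<^bsub>E\<^esub> f) u)"
      using u f g by (simp add: phi_mult phi_inv phi_comp)
    finally have "r [^] Suc m = (u \<otimes> inv (\<phi> ?g u)) \<otimes> (\<phi> ?g u \<otimes> inv (\<phi> (?g \<otimes>\<^bsub>E\<^esub> f) u))"
      using Suc by simp
    also have "\<dots> = u \<otimes> inv (\<phi> (?g \<otimes>\<^bsub>E\<^esub> f) u)"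
      using u f g by (metis E.m_closed P.inv_closed P.inv_solve_left P.m_assoc P.m_closed phi_closed)
    finally show ?case by simp
  qed (use u in simp)
  from this[of "Coset.order E"] have "r [^] Coset.order E = \<one>"
    using u f by (simp add: E.pow_order_eq_1)
  then have "P.ord r dvd Coset.order E" using rP P.pow_eq_id by blast
  moreover have "P.ord r dvd Coset.order P" using rP P.ord_dvd_group_order by blast
  moreover have "coprime (Coset.order E) (Coset.order P)"
    using order_P coprime_E by (auto simp: coprime_power_right_iff)
  ultimately have "P.ord r = 1" by (metis coprime_def nat_dvd_1_iff_1)
  then show ?thesis using rP P.ord_eq_1 by blast
qed

text \<open>By \<open>Rf_Cf_trivial\<close>, \<open>twist f\<close> is injective and hence bijective
  on the finite group \<open>[P,f]\<close>. The \<open>r\<close> in \<open>[P,f]\<close> with the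
  same twist as \<open>u\<close> leaves \<open>r^(-1) u\<close> in the kernel.\<close>

lemma Rf_Cf_decomp:
  assumes f: "f \<in> carrier E" and u: "u \<in> carrier P"
  obtains r c where "r \<in> Rf f" "c \<in> Cf f" "u = r \<otimes> c"
proof -
  interpret R: subgroup "Rf f" P by (rule Rf_subgroup[OF f])
  have RP: "r \<in> carrier P" if "r \<in> Rf f" for r using that R.subset by blast
  have "inj_on (twist f) (Rf f)"
  proof (rule inj_onI)
    fix r s assume rs: "r \<in> Rf f" "s \<in> Rf f" "twist f r = twist f s"
    interpret T: group_hom P P "twist f" by (rule twist_hom[OF f])
    have "twist f (r \<otimes> inv s) = \<one>" using rs RP f by (simp add: T.hom_mult)
    moreover have *: "r \<otimes> inv s \<in> Rf f" using rs by (intro R.m_closed R.m_inv_closed)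
    ultimately have "r \<otimes> inv s \<in> Cf f" using twist_eq_one[OF f] RP by (auto simp: Cf_def)
    then have "r \<otimes> inv s = \<one>" using Rf_Cf_trivial[OF f *] by simp
    then show "r = s" using RP rs by (metis P.inv_equality P.inv_inv P.inv_closed)
  qed
  moreover have "twist f ` Rf f \<subseteq> Rf f" using RP by (auto simp: Rf_def)
  moreover have "finite (Rf f)" by (simp add: Rf_def)
  ultimately have "twist f ` Rf f = Rf f" by (intro endo_inj_surj)
  moreover have "twist f u \<in> Rf f" using u by (simp add: Rf_def)
  ultimately obtain r where r: "r \<in> Rf f" "twist f u = twist f r" by (metis imageE)
  interpret T: group_hom P P "twist f" by (rule twist_hom[OF f])
  have "twist f (inv r \<otimes> u) = \<one>" using r RP f u by (simp add: T.hom_mult)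
  then have "inv r \<otimes> u \<in> Cf f"
    using twist_eq_one[OF f, of "inv r \<otimes> u"] RP[OF r(1)] u by (auto simp: Cf_def)
  moreover have "u = r \<otimes> (inv r \<otimes> u)" using RP r u by (simp flip: P.m_assoc)
  ultimately show thesis using that r by blast
qed

lemma Rf_Cf_unique:
  assumes f: "f \<in> carrier E" and "r \<in> Rf f" "c \<in> Cf f" "r' \<in> Rf f" "c' \<in> Cf f"
    and eq: "r \<otimes> c = r' \<otimes> c'"
  shows "r = r' \<and> c = c'"
proof -
  interpret R: subgroup "Rf f" P by (rule Rf_subgroup[OF f])
  interpret C: subgroup "Cf f" P by (rule Cf_subgroup[OF f])
  have P: "r \<in> carrier P" "c \<in> carrier P" "r' \<in> carrier P" "c' \<in> carrier P" using assms by auto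
  interpret PG: finite_group P by unfold_locales auto
  have "inv r' \<otimes> r = inv r' \<otimes> (r \<otimes> c) \<otimes> inv c"
    using P by (simp add: P.m_assoc)
  also have "\<dots> = c' \<otimes> inv c"
    unfolding eq using P by (simp add: P.m_assoc)
  finally have *: "inv r' \<otimes> r = c' \<otimes> inv c" .
  have "inv r' \<otimes> r \<in> Rf f" using assms(2,4) by (intro R.m_closed R.m_inv_closed)
  moreover have "inv r' \<otimes> r \<in> Cf f" unfolding * using assms(3,5) by (intro C.m_closed C.m_inv_closed)
  ultimately have "inv r' \<otimes> r = \<one>" by (rule Rf_Cf_trivial[OF f])
  then have "r = r'" using P by (metis P.inv_equality P.inv_inv P.inv_closed P.m_comm)
  then show ?thesis using eq P by simp
qed

lemma sum_P_Rf:
  fixes h :: "'a \<Rightarrow> 'x::comm_monoid_add"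
  assumes f: "f \<in> carrier E"
  shows "(\<Sum>v\<in>carrier P. h v) = (\<Sum>c\<in>Cf f. \<Sum>r\<in>Rf f. h (r \<otimes> c))"
proof -
  interpret R: subgroup "Rf f" P by (rule Rf_subgroup[OF f])
  interpret C: subgroup "Cf f" P by (rule Cf_subgroup[OF f])
  have "bij_betw (\<lambda>(c, r). r \<otimes> c) (Cf f \<times> Rf f) (carrier P)"
  proof (rule bij_betwI')
    fix x y assume "x \<in> Cf f \<times> Rf f" "y \<in> Cf f \<times> Rf f"
    then show "(case x of (c, r) \<Rightarrow> r \<otimes> c) = (case y of (c, r) \<Rightarrow> r \<otimes> c) \<longleftrightarrow> x = y"
      by (auto dest: Rf_Cf_unique[OF f])
  next
    fix y assume "y \<in> carrier P"
    then obtain r c where "r \<in> Rf f" "c \<in> Cf f" "y = r \<otimes> c" using Rf_Cf_decomp[OF f] by metis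
    then show "\<exists>x\<in>Cf f \<times> Rf f. y = (case x of (c, r) \<Rightarrow> r \<otimes> c)" by (intro bexI[of _ "(c, r)"]) auto
  qed auto
  from sum.reindex_bij_betw[OF this, of h] show ?thesis
    by (simp add: sum.cartesian_product case_prod_unfold)
qed

text \<open>A non-trivial \<open>p\<close>-subgroup has order 0 in \<open>k\<close>; this kills sums
  of functions that are constant on the cosets of \<open>[P,f]\<close>.\<close>

lemma card_Rf:
  assumes f: "f \<in> carrier E" and u: "u \<in> carrier P" "\<phi> f u \<noteq> u"
  shows "of_nat (card (Rf f)) = (0 :: 'k)"
proof -
  obtain n where n: "Coset.order P = p ^ n" using order_P by blast
  have "card (Rf f) dvd p ^ n"
    using P.lagrange[OF Rf_subgroup[OF f]] n by (metis dvd_triv_right)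
  then obtain i where i: "card (Rf f) = p ^ i" using divides_primepow_nat[OF prime_p] by blast
  have "card {twist f u, \<one>} \<le> card (Rf f)"
    by (rule card_mono) (use f u subgroup.one_closed[OF Rf_subgroup[OF f]] in \<open>auto simp: Rf_def\<close>)
  moreover have "twist f u \<noteq> \<one>" using twist_eq_one f u by blast
  ultimately have "i \<noteq> 0" using i by (cases "i = 0") auto
  then have "p dvd card (Rf f)" using i by simp
  then show ?thesis using char_k of_nat_eq_0_iff_char_dvd[where 'a = 'k] by simp
qed

lemma up_inv: "u \<in> carrier P \<Longrightarrow> up (inv u) = sgl (inv\<^bsub>Gr\<^esub> (u, \<one>\<^bsub>E\<^esub>))"
  and ue_inv: "e \<in> carrier E \<Longrightarrow> ue (inv\<^bsub>E\<^esub> e) = sgl (inv\<^bsub>Gr\<^esub> (\<one>, e))"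
  by (simp_all add: up_def ue_def Gr_inv)

lemma up_conj_apply:
  assumes "u \<in> carrier P" "v \<in> carrier P" "f \<in> carrier E"
  shows "(up u \<star> (a \<star> up (inv u))) (v, f) = a (inv (twist f u) \<otimes> v, f)"
  using assms conj_apply[of "(u, \<one>\<^bsub>E\<^esub>)" a "(v, f)"]
  by (simp add: up_inv up_def[of u] Gr_inv twist_def P.inv_mult P.m_ac)

lemma ue_conj_apply:
  assumes "e \<in> carrier E" "v \<in> carrier P" "f \<in> carrier E"
  shows "(ue e \<star> (a \<star> ue (inv\<^bsub>E\<^esub> e))) (v, f) = a (\<phi> (inv\<^bsub>E\<^esub> e) v, inv\<^bsub>E\<^esub> e \<otimes>\<^bsub>E\<^esub> (f \<otimes>\<^bsub>E\<^esub> e))"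
  using assms conj_apply[of "(\<one>, e)" a "(v, f)"]
  by (simp add: ue_inv ue_def[of e] Gr_inv)

lemma log_der_KG [simp]: "log_der d u \<in> KG"
  by (simp add: log_der_def)

lemma der_up: "d \<in> ders \<Longrightarrow> u \<in> carrier P \<Longrightarrow> d (up u) = log_der d u \<star> up u"
  by (simp add: log_der_def conv_assoc up_mult up_one der_closed)

lemma log_der_mult_conv:
  assumes d: "d \<in> ders" and "u \<in> carrier P" "w \<in> carrier P"
  shows "log_der d (u \<otimes> w) = log_der d u + up u \<star> (log_der d w \<star> up (inv u))"
proof -
  interpret PG: finite_group P by unfold_locales auto
  have "d (up (u \<otimes> w)) = d (up u) \<star> up w + up u \<star> d (up w)"
    using der_mult[OF d, of "up u" "up w"] assms by (simp add: up_mult)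
  moreover have "up (inv (u \<otimes> w)) = up (inv w) \<star> up (inv u)"
    using assms by (simp add: up_mult P.inv_mult P.m_comm)
  ultimately show ?thesis
    using assms by (simp add: log_der_def conv_bilinear conv_assoc up_mult P.inv_mult)
qed

lemma log_der_mult:
  assumes "d \<in> ders" and "u \<in> carrier P" "w \<in> carrier P" "v \<in> carrier P" "f \<in> carrier E"
  shows "log_der d (u \<otimes> w) (v, f) = log_der d u (v, f) + log_der d w (inv (twist f u) \<otimes> v, f)"
  using assms by (simp add: log_der_mult_conv up_conj_apply plus_fun_apply)

lemma up_phi: "u \<in> carrier P \<Longrightarrow> e \<in> carrier E \<Longrightarrow> up (\<phi> e u) = ue e \<star> (up u \<star> ue (inv\<^bsub>E\<^esub> e))"
  by (simp add: up_def ue_def)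

lemma der_up_phi:
  assumes d: "d \<in> ders" "\<And>e. e \<in> carrier E \<Longrightarrow> d (ue e) = 0" and "u \<in> carrier P" "e \<in> carrier E"
  shows "d (up (\<phi> e u)) = ue e \<star> (d (up u) \<star> ue (inv\<^bsub>E\<^esub> e))"
  using assms by (simp add: up_phi der_mult[OF d(1)])

lemma log_der_phi:
  assumes d: "d \<in> ders" "\<And>e. e \<in> carrier E \<Longrightarrow> d (ue e) = 0"
    and "u \<in> carrier P" "e \<in> carrier E" "v \<in> carrier P" "f \<in> carrier E"
  shows "log_der d (\<phi> e u) (v, f) = log_der d u (\<phi> (inv\<^bsub>E\<^esub> e) v, inv\<^bsub>E\<^esub> e \<otimes>\<^bsub>E\<^esub> (f \<otimes>\<^bsub>E\<^esub> e))"
proof -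
  have "up (inv (\<phi> e u)) = ue e \<star> (up (inv u) \<star> ue (inv\<^bsub>E\<^esub> e))"
    using assms by (simp flip: up_phi phi_inv)
  then have "log_der d (\<phi> e u) = ue e \<star> (d (up u) \<star> (ue (inv\<^bsub>E\<^esub> e) \<star> (ue e \<star> (up (inv u) \<star> ue (inv\<^bsub>E\<^esub> e)))))"
    using der_up_phi[OF d assms(3,4)] by (simp add: log_der_def conv_assoc)
  also have "\<dots> = ue e \<star> (log_der d u \<star> ue (inv\<^bsub>E\<^esub> e))"
    using assms by (simp add: ue_mult_assoc ue_one log_der_def conv_assoc)
  finally show ?thesis using assms by (simp add: ue_conj_apply)
qed

text \<open>The augmentation of the \<open>k[Pf]\<close>-component of the cocycle. Conjugation by
  \<open>P\<close> only permutes \<open>Pf\<close>, so the cocycle becomes a genuine homomorphism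
  from \<open>P\<close> to \<open>k\<close>.\<close>

definition aug_comp :: "(('a \<times> 'b \<Rightarrow> 'k) \<Rightarrow> ('a \<times> 'b \<Rightarrow> 'k)) \<Rightarrow> 'b \<Rightarrow> 'a \<Rightarrow> 'k" where
  "aug_comp d f u = (\<Sum>v\<in>carrier P. log_der d u (v, f))"

lemma aug_comp_mult:
  assumes "d \<in> ders" "u \<in> carrier P" "w \<in> carrier P" "f \<in> carrier E"
  shows "aug_comp d f (u \<otimes> w) = aug_comp d f u + aug_comp d f w"
proof -
  interpret PG: finite_group P by unfold_locales auto
  show ?thesis
    using assms PG.sum_left_translate[of "twist f u" "\<lambda>v. log_der d w (v, f)"]
    by (simp add: aug_comp_def log_der_mult sum.distrib)
qed

lemma aug_comp_phi:
  assumes "d \<in> ders" "\<And>e. e \<in> carrier E \<Longrightarrow> d (ue e) = 0" "u \<in> carrier P" "e \<in> carrier E" "f \<in> carrier E"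
  shows "aug_comp d f (\<phi> e u) = aug_comp d (inv\<^bsub>E\<^esub> e \<otimes>\<^bsub>E\<^esub> (f \<otimes>\<^bsub>E\<^esub> e)) u"
proof -
  have "aug_comp d f (\<phi> e u) = (\<Sum>v\<in>carrier P. log_der d u (\<phi> (inv\<^bsub>E\<^esub> e) v, inv\<^bsub>E\<^esub> e \<otimes>\<^bsub>E\<^esub> (f \<otimes>\<^bsub>E\<^esub> e)))"
    using assms by (simp add: aug_comp_def log_der_phi)
  also have "\<dots> = aug_comp d (inv\<^bsub>E\<^esub> e \<otimes>\<^bsub>E\<^esub> (f \<otimes>\<^bsub>E\<^esub> e)) u"
    unfolding aug_comp_def
    by (rule sum.reindex_bij_witness[where i = "\<phi> e" and j = "\<phi> (inv\<^bsub>E\<^esub> e)"]) (use assms in auto)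
  finally show ?thesis .
qed

text \<open>Write \<open>D\<close> for the cocycle and evaluate it at \<open>t u = u t\<close>. As
  \<open>t\<close> acts trivially on \<open>Pf\<close>, this gives
  \<open>D(t) + D(u) = D(u) + u D(t) u^(-1)\<close> there, so \<open>D(t)\<close> is unchanged by
  translation with \<open>twist f u\<close>.\<close>

lemma log_der_Cf_invariant:
  assumes d: "d \<in> ders" and f: "f \<in> carrier E" and t: "t \<in> Cf f" and r: "r \<in> Rf f" and v: "v \<in> carrier P"
  shows "log_der d t (r \<otimes> v, f) = log_der d t (v, f)"
proof -
  have tP: "t \<in> carrier P" "twist f t = \<one>" using t f twist_eq_one by (auto simp: Cf_def)
  obtain u where u: "u \<in> carrier P" "r = twist f u" using r by (auto simp: Rf_def)
  let ?w = "r \<otimes> v"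
  have w: "?w \<in> carrier P" "inv r \<otimes> ?w = v" using u v f by (simp_all flip: P.m_assoc)
  have "log_der d (t \<otimes> u) (?w, f) = log_der d t (?w, f) + log_der d u (?w, f)"
    using log_der_mult[OF d tP(1) u(1) w(1) f] tP w by simp
  moreover have "log_der d (u \<otimes> t) (?w, f) = log_der d u (?w, f) + log_der d t (v, f)"
    using log_der_mult[OF d u(1) tP(1) w(1) f] u w by simp
  ultimately show ?thesis using P.m_comm[of t u] tP u by simp
qed

lemma sgl_sum_KG: "a \<in> KG \<Longrightarrow> a = (\<Sum>f\<in>carrier E. \<Sum>v\<in>carrier P. scl (a (v, f)) (sgl (v, f)))"
proof -
  assume "a \<in> KG"
  then have "a = (\<Sum>x\<in>carrier P \<times> carrier E. scl (a x) (sgl x))"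
    using expand[of a] by simp
  also have "\<dots> = (\<Sum>f\<in>carrier E. \<Sum>v\<in>carrier P. scl (a (v, f)) (sgl (v, f)))"
    by (subst sum.swap) (simp add: sum.cartesian_product case_prod_unfold)
  finally show ?thesis .
qed

text \<open>On each coset \<open>Pf\<close> the augmentation times \<open>f\<close> may be
  subtracted, and what remains is a combination of the elements \<open>(v - 1) f\<close>.\<close>

lemma Jp1I:
  assumes a: "a \<in> KG" and z: "\<And>f. f \<in> carrier E \<Longrightarrow> (\<Sum>v\<in>carrier P. a (v, f)) = 0"
  shows "a \<in> Jp 1"
proof -
  have inner: "(\<Sum>v\<in>carrier P. scl (a (v, f)) (sgl (v, f))) \<in> Jp 1" if f: "f \<in> carrier E" for f
  proof -
    have "(\<Sum>v\<in>carrier P. scl (a (v, f)) (sgl (v, f))) =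
        (\<Sum>v\<in>carrier P. scl (a (v, f)) ((up v - one') \<star> ue f)) + (\<Sum>v\<in>carrier P. scl (a (v, f)) (ue f))"
      using f by (simp add: conv_bilinear up_ue fv.scale_right_diff_distrib sum_subtractf)
    also have "(\<Sum>v\<in>carrier P. scl (a (v, f)) (ue f)) = 0"
      using z[OF f] by (simp flip: fv.scale_sum_left)
    finally show ?thesis
      using f aug_in_Jp1 by (auto intro!: Jp_sum Jp_scl Jp_right)
  qed
  then show ?thesis by (subst sgl_sum_KG[OF a]) (rule Jp_sum, rule inner)
qed

end

locale p'_action_central = p'_action P E \<phi> p kk
  for P :: "'a monoid" (structure) and E :: "'b monoid" and \<phi> :: "'b \<Rightarrow> 'a \<Rightarrow> 'a" and p :: nat and kk :: "'k::field itself" +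
  assumes commutator_eq: "action_commutator P E \<phi> = carrier P"
    and ker_central: "kernel E (AutoGroup P) \<phi> \<subseteq> group_center E"
    and quotient_comm: "comm_group (E Mod kernel E (AutoGroup P) \<phi>)"
begin

definition act_ker :: "'b set" where "act_ker = kernel E (AutoGroup P) \<phi>"

lemma act_ker_iff: "f \<in> act_ker \<longleftrightarrow> f \<in> carrier E \<and> (\<forall>u\<in>carrier P. \<phi> f u = u)"
proof -
  have "\<phi> f = (\<lambda>x\<in>carrier P. x) \<longleftrightarrow> (\<forall>u\<in>carrier P. \<phi> f u = u)" if "f \<in> carrier E"
    using phi_auto[OF that] by (auto simp: auto_def Bij_def extensional_def fun_eq_iff)
  then show ?thesis by (auto simp: act_ker_def kernel_def AutoGroup_def BijGroup_def)
qed

lemma act_ker_central: "f \<in> act_ker \<Longrightarrow> e \<in> carrier E \<Longrightarrow> f \<otimes>\<^bsub>E\<^esub> e = e \<otimes>\<^bsub>E\<^esub> f"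
  using ker_central by (auto simp: act_ker_def group_center_def)

lemma phi_commute:
  assumes e: "e \<in> carrier E" and f: "f \<in> carrier E" and u: "u \<in> carrier P"
  shows "\<phi> e (\<phi> f u) = \<phi> f (\<phi> e u)"
proof -
  interpret Phi: group_hom E "AutoGroup P" \<phi>
    by (intro group_hom.intro group_hom_axioms.intro E.is_group P.AutoGroup phi_hom)
  interpret Z: normal act_ker E unfolding act_ker_def by (rule Phi.normal_kernel)
  have "(act_ker #>\<^bsub>E\<^esub> e) <#>\<^bsub>E\<^esub> (act_ker #>\<^bsub>E\<^esub> f) = (act_ker #>\<^bsub>E\<^esub> f) <#>\<^bsub>E\<^esub> (act_ker #>\<^bsub>E\<^esub> e)"
    using comm_groupE(4)[OF quotient_comm, of "act_ker #>\<^bsub>E\<^esub> e" "act_ker #>\<^bsub>E\<^esub> f"] e f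
    by (auto simp: FactGroup_def act_ker_def RCOSETS_def)
  then have "act_ker #>\<^bsub>E\<^esub> (e \<otimes>\<^bsub>E\<^esub> f) = act_ker #>\<^bsub>E\<^esub> (f \<otimes>\<^bsub>E\<^esub> e)"
    using e f by (simp add: Z.rcos_sum)
  then have "e \<otimes>\<^bsub>E\<^esub> f \<in> act_ker #>\<^bsub>E\<^esub> (f \<otimes>\<^bsub>E\<^esub> e)"
    using e f E.rcos_self[OF _ Z.is_subgroup, of "e \<otimes>\<^bsub>E\<^esub> f"] by simp
  \<comment> \<open>\<open>e\<close> and \<open>f\<close> commute up to an element \<open>z\<close>
    that acts trivially on \<open>P\<close>.\<close>
  then obtain z where z: "z \<in> act_ker" "e \<otimes>\<^bsub>E\<^esub> f = z \<otimes>\<^bsub>E\<^esub> (f \<otimes>\<^bsub>E\<^esub> e)" by (auto simp: r_coset_def)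
  have "\<phi> (e \<otimes>\<^bsub>E\<^esub> f) u = \<phi> z (\<phi> (f \<otimes>\<^bsub>E\<^esub> e) u)"
    unfolding z(2) using z(1) e f u by (intro phi_comp) (auto simp: act_ker_iff)
  also have "\<dots> = \<phi> (f \<otimes>\<^bsub>E\<^esub> e) u"
  proof -
    have "\<phi> (f \<otimes>\<^bsub>E\<^esub> e) u \<in> carrier P" using e f u by (intro phi_closed E.m_closed)
    then show ?thesis using z(1) unfolding act_ker_iff by blast
  qed
  finally show ?thesis by (simp only: phi_comp[OF e f u] phi_comp[OF f e u])
qed

text \<open>For \<open>f\<close> outside the kernel \<open>d\<close> is not modified here: the
  homomorphism dies separately on the factors \<open>[P,f]\<close> and
  \<open>C_P(f)\<close>.\<close>

lemma aug_comp_zero: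
  assumes d: "d \<in> ders" "\<And>e. e \<in> carrier E \<Longrightarrow> d (ue e) = 0" and f: "f \<in> carrier E" and u: "u \<in> carrier P"
  shows "aug_comp d f u = 0"
proof (cases "f \<in> act_ker")
  case True
  have inv: "aug_comp d f (\<phi> e w) = aug_comp d f w" if e: "e \<in> carrier E" and w: "w \<in> carrier P" for e w
    using aug_comp_phi[OF d w e f] act_ker_central[OF True e] e f by (simp flip: E.m_assoc)
  have one: "aug_comp d f \<one> = 0"
  proof -
    have "aug_comp d f \<one> = aug_comp d f \<one> + aug_comp d f \<one>"
      using aug_comp_mult[OF d(1) P.one_closed P.one_closed f] by (simp only: P.l_one P.one_closed)
    then show ?thesis by (simp only: add_cancel_right_right)
  qed
  have aug_comp_inv: "aug_comp d f (inv w) = - aug_comp d f w" if w: "w \<in> carrier P" for w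
    using aug_comp_mult[OF d(1) w _ f, of "inv w"] w one by (simp add: eq_neg_iff_add_eq_0 add.commute)
  have "u \<in> generate P {\<phi> e u \<otimes> inv u | u e. u \<in> carrier P \<and> e \<in> carrier E}"
    using u commutator_eq by (simp add: action_commutator_def)
  then have "u \<in> carrier P \<and> aug_comp d f u = 0"
  proof (induction rule: generate.induct)
    case one
    show ?case using \<open>aug_comp d f \<one> = 0\<close> by simp
  next
    case (incl h)
    then show ?case using inv aug_comp_inv f by (auto simp: aug_comp_mult[OF d(1)])
  next
    case (inv h)
    then show ?case using \<open>\<And>e w. _ \<Longrightarrow> _ \<Longrightarrow> aug_comp d f (\<phi> e w) = aug_comp d f w\<close> aug_comp_inv f by (auto simp: aug_comp_mult[OF d(1)])
  next
    case (eng h1 h2)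
    then show ?case using f by (simp add: aug_comp_mult[OF d(1)])
  qed
  then show ?thesis by simp
next
  case False
  then obtain w0 where w0: "w0 \<in> carrier P" "\<phi> f w0 \<noteq> w0" using f act_ker_iff by blast
  obtain r c where rc: "r \<in> Rf f" "c \<in> Cf f" "u = r \<otimes> c" using Rf_Cf_decomp[OF f u] .
  obtain w where w: "w \<in> carrier P" "r = twist f w" using rc by (auto simp: Rf_def)
  have P: "r \<in> carrier P" "c \<in> carrier P" using w f rc by (auto simp: Cf_def)
  \<comment> \<open>The cocycle at \<open>c\<close> is constant on cosets of \<open>[P,f]\<close>,
    so each inner sum is a multiple of \<open>|[P,f]|\<close>.\<close>
  have "aug_comp d f c = (\<Sum>t\<in>Cf f. \<Sum>r\<in>Rf f. log_der d c (t, f))"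
    unfolding aug_comp_def sum_P_Rf[OF f]
    by (intro sum.cong refl log_der_Cf_invariant[OF d(1) f rc(2)]) (auto simp: Cf_def)
  also have "\<dots> = 0" by (simp add: card_Rf[OF f w0])
  finally have c: "aug_comp d f c = 0" .
  \<comment> \<open>\<open>w = r (f w)\<close>, and \<open>w\<close> and \<open>f w\<close> have the
    same augmentation because conjugating \<open>f\<close> by itself changes nothing. Hence
    \<open>r\<close> contributes 0.\<close>
  have "aug_comp d f w = aug_comp d f (r \<otimes> \<phi> f w)"
    using w f by (simp add: twist_def P.m_assoc)
  also have "\<dots> = aug_comp d f r + aug_comp d f w"
    using aug_comp_mult[OF d(1) P(1) _ f, of "\<phi> f w"] aug_comp_phi[OF d w(1) f f] w f by (simp flip: E.m_assoc)
  finally have "aug_comp d f r = 0" by simp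
  then show ?thesis using c rc aug_comp_mult[OF d(1) P f] by simp
qed

lemma log_der_Jp1:
  assumes "d \<in> ders" "\<And>e. e \<in> carrier E \<Longrightarrow> d (ue e) = 0" and "u \<in> carrier P"
  shows "log_der d u \<in> Jp 1"
  using aug_comp_zero[OF assms(1,2) _ assms(3)] by (intro Jp1I) (auto simp: aug_comp_def)

lemma Fil_0:
  assumes "d \<in> ders" "\<And>e. e \<in> carrier E \<Longrightarrow> d (ue e) = 0"
  shows "Fil 0 d"
  using log_der_Jp1[OF assms] assms by (auto simp: Fil_def der_up Jp_right simp flip: One_nat_def)

lemma ex_Fil_0:
  assumes d: "d \<in> ders"
  shows "\<exists>a\<in>KG. Fil 0 (dadd (ad a) d)"
proof -
  obtain a where a: "a \<in> KG" "\<And>e. e \<in> carrier E \<Longrightarrow> dadd (ad a) d (ue e) = 0"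
    using kill_E[OF d] by blast
  moreover have "dadd (ad a) d \<in> ders" using a d by blast
  ultimately show ?thesis using Fil_0 by blast
qed

text \<open>At order 0 \<open>Fil_Jp\<close> gives nothing beyond \<open>KG\<close>; the sharper
  bound comes from \<open>d(u e) = d(u) e\<close> on the basis.\<close>

lemma Fil_0_range:
  assumes d: "Fil 0 d" and x: "x \<in> KG"
  shows "d x \<in> Jp 1"
  using x
proof (induction x rule: KG_induct)
  case (sgl g)
  then obtain u e where g: "g = (u, e)" "u \<in> carrier P" "e \<in> carrier E" by auto
  then show ?case using FilD[OF d] der_sgl[of d u e] by (simp add: Jp_right)
qed (simp_all only: der_rules[OF FilD(1)[OF d]] Jp_add Jp_scl Jp_zero)

lemma HH1_rep_jacobson:
  assumes "C \<in> carrier (HA :: ('k, _) module)"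
  shows "\<exists>d\<in>C. d ` carrier (A :: ('k, _) module) \<subseteq> jacobson_radical A"
proof -
  obtain d where d: "d \<in> ders" "C = cls d" using assms by (auto simp: HA_carrier)
  obtain a where a: "a \<in> KG" "Fil 0 (dadd (ad a) d)" using ex_Fil_0[OF d(1)] by blast
  have "dadd (ad a) d \<in> C" using d a by (auto simp: cls_def)
  moreover have "dadd (ad a) d ` carrier A \<subseteq> jacobson_radical A"
    using Fil_0_range[OF a(2)] Jp1_in_jacobson by auto
  ultimately show ?thesis by blast
qed

end

section \<open>Components outside the kernel of the action\<close>

context p'_action
begin

text \<open>Modulo \<open>J^2\<close> the map \<open>u \<mapsto> u - 1\<close> turns products into
  sums, since \<open>(r - 1) (q - 1)\<close> lies in \<open>J^2\<close>.\<close>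

lemma sum_aug_prod:
  assumes "finite S" "S \<subseteq> carrier P"
  shows "(\<Sum>r\<in>S. up r - one') - (up (finprod P (\<lambda>x. x) S) - one') \<in> Jp 2"
  using assms
proof (induction S rule: finite_induct)
  case empty
  then show ?case by (simp add: up_one)
next
  case (insert r S)
  let ?q = "finprod P (\<lambda>x. x) S"
  have q: "?q \<in> carrier P" using insert by (intro P.finprod_closed) auto
  have r: "r \<in> carrier P" using insert by auto
  have "finprod P (\<lambda>x. x) (insert r S) = r \<otimes> ?q"
    using insert by (intro P.finprod_insert) auto
  then have "(\<Sum>r\<in>insert r S. up r - one') - (up (finprod P (\<lambda>x. x) (insert r S)) - one') =
      ((\<Sum>r\<in>S. up r - one') - (up ?q - one')) - (up r - one') \<star> (up ?q - one')"
    using insert q r by (simp add: conv_bilinear up_mult)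
  moreover have "(up r - one') \<star> (up ?q - one') \<in> Jp 2"
    using Jp_mult[OF aug_in_Jp1[OF r] aug_in_Jp1[OF q]] by (simp add: numeral_2_eq_2)
  ultimately show ?case using insert by (simp only: Jp_diff insert_subset)
qed

lemma phi_twist: "e \<in> carrier E \<Longrightarrow> f \<in> carrier E \<Longrightarrow> u \<in> carrier P \<Longrightarrow>
    \<phi> e (twist f u) = twist (e \<otimes>\<^bsub>E\<^esub> (f \<otimes>\<^bsub>E\<^esub> inv\<^bsub>E\<^esub> e)) (\<phi> e u)"
  by (simp add: twist_def phi_mult phi_inv phi_comp)

text \<open>As \<open>|[P,f]|\<close> is 0 in \<open>k\<close>, the sum equals the sum of all
  \<open>r - 1\<close>, congruent to \<open>q - 1\<close> for the product \<open>q\<close> of all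
  elements of \<open>[P,f]\<close>. This \<open>q\<close> lies in \<open>[P,f]\<close> and is fixed
  by \<open>f\<close>, so it is 1. In a general abelian 2-group such a product may be an involution;
  fixed-point freeness of \<open>f\<close> on \<open>[P,f]\<close> excludes that.\<close>

lemma Rf_norm:
  assumes f: "f \<in> carrier E" and u: "u \<in> carrier P" "\<phi> f u \<noteq> u"
  shows "(\<Sum>r\<in>Rf f. up r) \<in> Jp 2"
proof -
  interpret R: subgroup "Rf f" P by (rule Rf_subgroup[OF f])
  have fin: "finite (Rf f)" by (simp add: Rf_def)
  let ?q = "finprod P (\<lambda>x. x) (Rf f)"
  have img: "\<phi> f ` Rf f = Rf f"
  proof (rule endo_inj_surj[OF fin])
    show "\<phi> f ` Rf f \<subseteq> Rf f"
      using phi_twist[OF f f] f by (auto simp: Rf_def)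
    show "inj_on (\<phi> f) (Rf f)" using phi_inj[OF f] by (auto intro: inj_onI)
  qed
  have qR: "?q \<in> Rf f"
  proof -
    have "finprod P (\<lambda>x. x) S \<in> Rf f" if "finite S" "S \<subseteq> Rf f" for S
      using that
    proof (induction S rule: finite_induct)
      case (insert x S)
      then have "finprod P (\<lambda>x. x) (insert x S) = x \<otimes> finprod P (\<lambda>x. x) S"
        by (intro P.finprod_insert) auto
      then show ?case using insert by auto
    qed simp
    then show ?thesis using fin by blast
  qed
  have "\<phi> f (finprod P (\<lambda>x. x) S) = finprod P (\<lambda>x. \<phi> f x) S" if "finite S" "S \<subseteq> carrier P" for S
    using that
  proof (induction S rule: finite_induct)
    case (insert x S)
    have "finprod P (\<lambda>x. x) (insert x S) = x \<otimes> finprod P (\<lambda>x. x) S"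
      using insert by (intro P.finprod_insert) auto
    moreover have "finprod P (\<lambda>x. \<phi> f x) (insert x S) = \<phi> f x \<otimes> finprod P (\<lambda>x. \<phi> f x) S"
      using insert f by (intro P.finprod_insert) auto
    moreover have "finprod P (\<lambda>x. x) S \<in> carrier P" using insert by (intro P.finprod_closed) auto
    ultimately show ?case using insert f by (simp add: phi_mult)
  qed (use f in simp)
  from this[OF fin R.subset] have "\<phi> f ?q = finprod P (\<lambda>x. \<phi> f x) (Rf f)" .
  also have "\<dots> = finprod P (\<lambda>x. x) (\<phi> f ` Rf f)"
    using phi_inj[OF f] f by (intro P.finprod_reindex[symmetric]) (auto intro: inj_onI)
  also have "\<dots> = ?q" by (simp only: img)
  finally have "?q \<in> Cf f" using qR by (auto simp: Cf_def)
  then have "?q = \<one>" using Rf_Cf_trivial[OF f qR] by simp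
  then have "(\<Sum>r\<in>Rf f. up r - one') \<in> Jp 2"
    using sum_aug_prod[OF fin R.subset] by (simp add: up_one)
  moreover have "(\<Sum>r\<in>Rf f. up r - one') = (\<Sum>r\<in>Rf f. up r)"
    using card_Rf[OF f u] by (simp add: sum_subtractf fv.sum_constant_scale del: sum_constant)
  ultimately show ?thesis by simp
qed

text \<open>On \<open>Pf\<close> such an \<open>a\<close> is a combination of right multiples of the
  sum over \<open>[P,f]\<close>, one for each element of \<open>C_P(f)\<close>.\<close>

lemma Jp2I:
  assumes a: "a \<in> KG"
    and inv: "\<And>f v r. f \<in> carrier E \<Longrightarrow> v \<in> carrier P \<Longrightarrow> r \<in> Rf f \<Longrightarrow> a (r \<otimes> v, f) = a (v, f)"
    and triv: "\<And>f v. f \<in> carrier E \<Longrightarrow> \<forall>u\<in>carrier P. \<phi> f u = u \<Longrightarrow> v \<in> carrier P \<Longrightarrow> a (v, f) = 0"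
  shows "a \<in> Jp 2"
proof -
  have inner: "(\<Sum>v\<in>carrier P. scl (a (v, f)) (sgl (v, f))) \<in> Jp 2" if f: "f \<in> carrier E" for f
  proof (cases "\<forall>u\<in>carrier P. \<phi> f u = u")
    case True
    then show ?thesis using triv f by (auto intro!: Jp_sum)
  next
    case False
    then obtain u where u: "u \<in> carrier P" "\<phi> f u \<noteq> u" by blast
    interpret R: subgroup "Rf f" P by (rule Rf_subgroup[OF f])
    have C: "Cf f \<subseteq> carrier P" by (auto simp: Cf_def)
    have "(\<Sum>v\<in>carrier P. scl (a (v, f)) (sgl (v, f))) =
        (\<Sum>c\<in>Cf f. \<Sum>r\<in>Rf f. scl (a (r \<otimes> c, f)) (sgl (r \<otimes> c, f)))"
      by (rule sum_P_Rf[OF f])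
    also have "\<dots> = (\<Sum>c\<in>Cf f. scl (a (c, f)) ((\<Sum>r\<in>Rf f. up r) \<star> sgl (c, f)))"
    proof (rule sum.cong[OF refl])
      fix c assume c: "c \<in> Cf f"
      have "(\<Sum>r\<in>Rf f. scl (a (r \<otimes> c, f)) (sgl (r \<otimes> c, f))) =
          (\<Sum>r\<in>Rf f. scl (a (c, f)) (up r \<star> sgl (c, f)))"
        using c C f by (intro sum.cong refl) (auto simp: inv up_def subset_iff)
      then show "(\<Sum>r\<in>Rf f. scl (a (r \<otimes> c, f)) (sgl (r \<otimes> c, f))) =
          scl (a (c, f)) ((\<Sum>r\<in>Rf f. up r) \<star> sgl (c, f))"
        by (simp add: fv.scale_sum_right conv_sum_left)
    qed
    also have "\<dots> \<in> Jp 2"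
    proof (rule Jp_sum)
      fix c assume "c \<in> Cf f"
      then show "scl (a (c, f)) ((\<Sum>r\<in>Rf f. up r) \<star> sgl (c, f)) \<in> Jp 2"
        using Rf_norm[OF f u] C f by (intro Jp_scl Jp_right[of "\<Sum>r\<in>Rf f. up r"]) auto
    qed
    finally show ?thesis .
  qed
  then show ?thesis by (subst sgl_sum_KG[OF a]) (rule Jp_sum, rule inner)
qed

lemma twist_image:
  assumes f: "f \<in> carrier E" and v: "v \<in> carrier P"
  obtains r c where "r \<in> Rf f" "c \<in> Cf f" "v = twist f r \<otimes> c"
proof -
  obtain s c where sc: "s \<in> Rf f" "c \<in> Cf f" "v = s \<otimes> c" using Rf_Cf_decomp[OF f v] .
  obtain u where u: "u \<in> carrier P" "s = twist f u" using sc by (auto simp: Rf_def)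
  obtain r c' where rc: "r \<in> Rf f" "c' \<in> Cf f" "u = r \<otimes> c'" using Rf_Cf_decomp[OF f u(1)] .
  have "r \<in> carrier P" "c' \<in> carrier P" using rc f by (auto simp: Rf_def Cf_def)
  moreover have "twist f c' = \<one>" using rc f twist_eq_one by (auto simp: Cf_def)
  ultimately have "s = twist f r" using u rc f by (simp add: twist_mult)
  then show thesis using that rc sc by blast
qed

lemma twist_unique:
  assumes f: "f \<in> carrier E" and "r \<in> Rf f" "c \<in> Cf f" "r' \<in> Rf f" "c' \<in> Cf f"
    and eq: "twist f r \<otimes> c = twist f r' \<otimes> c'"
  shows "r = r'"
proof -
  interpret R: subgroup "Rf f" P by (rule Rf_subgroup[OF f])
  interpret T: group_hom P P "twist f" by (rule twist_hom[OF f])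
  have P: "r \<in> carrier P" "r' \<in> carrier P" using assms by auto
  then have "twist f r \<in> Rf f" "twist f r' \<in> Rf f" by (auto simp: Rf_def)
  then have "twist f r = twist f r'" using Rf_Cf_unique[OF f _ _ _ _ eq] assms by blast
  then have "twist f (r \<otimes> inv r') = \<one>" using P f by (simp add: T.hom_mult)
  then have "r \<otimes> inv r' \<in> Cf f"
    using twist_eq_one[OF f, of "r \<otimes> inv r'"] P by (auto simp: Cf_def)
  moreover have "r \<otimes> inv r' \<in> Rf f" using assms(2,4) by (intro R.m_closed R.m_inv_closed)
  ultimately have "r \<otimes> inv r' = \<one>" using Rf_Cf_trivial[OF f] by blast
  then show "r = r'" using P by (metis P.inv_equality P.inv_inv P.inv_closed)
qed

text \<open>Each \<open>[P,f]\<close>-orbit on \<open>Pf\<close> contains exactly one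
  \<open>(c, f)\<close> with \<open>c\<close> in \<open>C_P(f)\<close>; the root is the element of
  \<open>[P,f]\<close> whose conjugation carries this base point to \<open>(v, f)\<close>.\<close>

definition twist_root :: "'b \<Rightarrow> 'a \<Rightarrow> 'a" where
  "twist_root f v = (THE r. r \<in> Rf f \<and> (\<exists>c\<in>Cf f. v = twist f r \<otimes> c))"

lemma twist_root_eq:
  assumes f: "f \<in> carrier E" and "r \<in> Rf f" "c \<in> Cf f"
  shows "twist_root f (twist f r \<otimes> c) = r"
  unfolding twist_root_def
  by (rule the_equality) (use assms twist_unique[OF f] in blast)+

text \<open>\<open>[P,f]\<close> acts freely on the coset \<open>Pf\<close>, so that a cocycle with values in \<open>k[Pf]\<close> is, on \<open>[P,f]\<close>,
  the coboundary of the following element.\<close>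

definition cobound :: "(('a \<times> 'b \<Rightarrow> 'k) \<Rightarrow> ('a \<times> 'b \<Rightarrow> 'k)) \<Rightarrow> 'a \<times> 'b \<Rightarrow> 'k" where
  "cobound d = (\<lambda>(v, f). if v \<in> carrier P \<and> f \<in> carrier E \<and> (\<exists>u\<in>carrier P. \<phi> f u \<noteq> u)
     then log_der d (twist_root f v) (v, f) else 0)"

lemma cobound_KG: "cobound d \<in> KG"
  by (auto simp: cobound_def intro!: KG_I)

text \<open>The base points and roots are compatible with the action of \<open>E\<close>. Invariance
  of \<open>cobound d\<close> is what keeps the corrected derivation zero on
  \<open>E\<close>.\<close>

lemma cobound_conj:
  assumes d: "d \<in> ders" "\<And>e. e \<in> carrier E \<Longrightarrow> d (ue e) = 0" and e: "e \<in> carrier E"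
  shows "ue e \<star> (cobound d \<star> ue (inv\<^bsub>E\<^esub> e)) = cobound d"
proof
  fix x :: "'a \<times> 'b"
  show "(ue e \<star> (cobound d \<star> ue (inv\<^bsub>E\<^esub> e))) x = cobound d x"
  proof (cases "x \<in> carrier Gr")
    case False
    then show ?thesis using KG_D[OF KG_conv False] KG_D[OF cobound_KG False] by simp
  next
    case True
    then obtain v f where x: "x = (v, f)" "v \<in> carrier P" "f \<in> carrier E" by auto
    let ?i = "inv\<^bsub>E\<^esub> e"
    let ?g = "?i \<otimes>\<^bsub>E\<^esub> (f \<otimes>\<^bsub>E\<^esub> e)"
    have i: "?i \<in> carrier E" "?g \<in> carrier E" using e x by auto
    have g_phi: "\<phi> ?g u = \<phi> ?i (\<phi> f (\<phi> e u))" if "u \<in> carrier P" for u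
      using that e x i by (simp add: phi_comp)
    have triv: "(\<exists>u\<in>carrier P. \<phi> ?g u \<noteq> u) \<longleftrightarrow> (\<exists>u\<in>carrier P. \<phi> f u \<noteq> u)"
    proof
      assume "\<exists>u\<in>carrier P. \<phi> ?g u \<noteq> u"
      then obtain u where "u \<in> carrier P" "\<phi> ?g u \<noteq> u" by blast
      then have "\<phi> f (\<phi> e u) \<noteq> \<phi> e u" using g_phi e by auto
      then show "\<exists>u\<in>carrier P. \<phi> f u \<noteq> u" using \<open>u \<in> carrier P\<close> e by blast
    next
      assume "\<exists>u\<in>carrier P. \<phi> f u \<noteq> u"
      then obtain u where u: "u \<in> carrier P" "\<phi> f u \<noteq> u" by blast
      then have "\<phi> ?g (\<phi> ?i u) \<noteq> \<phi> ?i u" using g_phi[of "\<phi> ?i u"] e x i phi_inj[of ?i "\<phi> f u" u] by auto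
      then show "\<exists>u\<in>carrier P. \<phi> ?g u \<noteq> u" using u i by blast
    qed
    obtain r c where rc: "r \<in> Rf f" "c \<in> Cf f" "v = twist f r \<otimes> c" using twist_image[OF x(3,2)] .
    obtain w where w: "w \<in> carrier P" "r = twist f w" using rc by (auto simp: Rf_def)
    have P: "r \<in> carrier P" "c \<in> carrier P" using w rc x by (auto simp: Cf_def)
    have g': "?i \<otimes>\<^bsub>E\<^esub> (f \<otimes>\<^bsub>E\<^esub> inv\<^bsub>E\<^esub> ?i) = ?g" using e by simp
    have "\<phi> ?i r \<in> Rf ?g" using w phi_twist[OF i(1) x(3) w(1)] g' i by (auto simp: Rf_def)
    moreover have "\<phi> ?i c \<in> Cf ?g" using rc(2) P e x i g_phi[of "\<phi> ?i c"] by (auto simp: Cf_def)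
    moreover have "\<phi> ?i v = twist ?g (\<phi> ?i r) \<otimes> \<phi> ?i c"
      using rc P x i phi_twist[OF i(1) x(3) P(1)] g' by (simp add: phi_mult)
    ultimately have "twist_root ?g (\<phi> ?i v) = \<phi> ?i r" using twist_root_eq[OF i(2)] by metis
    moreover have "twist_root f v = r" using twist_root_eq[OF x(3) rc(1,2)] rc by simp
    moreover have "log_der d (\<phi> ?i r) (\<phi> ?i v, ?g) = log_der d r (v, f)"
      using log_der_phi[OF d P(1) i(1), of "\<phi> ?i v" ?g] x e i
      by (simp add: E.m_assoc) (simp flip: E.m_assoc)
    ultimately show ?thesis
      using x e i triv ue_conj_apply[OF e x(2,3)] by (simp add: cobound_def)
  qed
qed

text \<open>The cocycle identity at \<open>q = s (s^(-1) q)\<close> makes the corrected cocycle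
  vanish at every \<open>s\<close> in \<open>[P,f]\<close>, on the component at \<open>f\<close>. So
  it depends only on the \<open>C_P(f)\<close>-part of its argument, to which
  \<open>log_der_Cf_invariant\<close> applies.\<close>

lemma cobound_correct:
  assumes d: "d \<in> ders" "\<And>e. e \<in> carrier E \<Longrightarrow> d (ue e) = 0"
  defines "d1 \<equiv> dadd (ad (- cobound d)) d"
  shows "d1 \<in> ders" "\<And>e. e \<in> carrier E \<Longrightarrow> d1 (ue e) = 0"
    and "\<And>u v f r. u \<in> carrier P \<Longrightarrow> v \<in> carrier P \<Longrightarrow> f \<in> carrier E \<Longrightarrow> \<exists>u\<in>carrier P. \<phi> f u \<noteq> u \<Longrightarrow>
      r \<in> Rf f \<Longrightarrow> log_der d1 u (r \<otimes> v, f) = log_der d1 u (v, f)"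
proof -
  note cK = cobound_KG[of d]
  show d1: "d1 \<in> ders" unfolding d1_def using d cK by (intro dadd_ders ad_ders) auto
  show "d1 (ue e) = 0" if e: "e \<in> carrier E" for e
  proof -
    have "cobound d \<star> ue e = ue e \<star> (cobound d \<star> ue (inv\<^bsub>E\<^esub> e)) \<star> ue e"
      by (simp only: cobound_conj[OF d e])
    also have "\<dots> = ue e \<star> cobound d" using e cK by (simp add: conv_assoc ue_mult ue_one)
    finally show ?thesis using e d cK by (simp add: d1_def dadd_apply ad_apply conv_bilinear)
  qed
  fix u v f r
  assume u: "u \<in> carrier P" and v: "v \<in> carrier P" and f: "f \<in> carrier E"
    and nt: "\<exists>u\<in>carrier P. \<phi> f u \<noteq> u" and r: "r \<in> Rf f"
  interpret PG: finite_group P by unfold_locales auto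
  interpret R: subgroup "Rf f" P by (rule Rf_subgroup[OF f])
  interpret T: group_hom P P "twist f" by (rule twist_hom[OF f])
  have dl1: "log_der d1 s (w, f) = log_der d s (w, f) - cobound d (w, f) + cobound d (inv (twist f s) \<otimes> w, f)"
    if s: "s \<in> carrier P" and w: "w \<in> carrier P" for s w
  proof -
    have "d1 (up s) = d (up s) - cobound d \<star> up s + up s \<star> cobound d"
      using s cK by (simp add: d1_def dadd_apply ad_apply conv_bilinear)
    then have "log_der d1 s = log_der d s - cobound d + up s \<star> (cobound d \<star> up (inv s))"
      using s cK by (simp add: log_der_def conv_bilinear conv_assoc up_mult up_one)
    then show ?thesis using s w f up_conj_apply[OF s w f] by (simp add: pointwise)
  qed
  have zero: "log_der d1 s (w, f) = 0" if s: "s \<in> Rf f" and w: "w \<in> carrier P" for s w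
  proof -
    obtain q c where qc: "q \<in> Rf f" "c \<in> Cf f" "w = twist f q \<otimes> c" using twist_image[OF f w] .
    have P: "s \<in> carrier P" "q \<in> carrier P" "c \<in> carrier P" using s qc by (auto simp: Cf_def)
    have "inv (twist f s) \<otimes> w = twist f (inv s \<otimes> q) \<otimes> c"
      using P qc f by (simp add: T.hom_mult P.m_assoc)
    moreover have "inv s \<otimes> q \<in> Rf f" using s qc by (intro R.m_closed R.m_inv_closed)
    ultimately have "twist_root f (inv (twist f s) \<otimes> w) = inv s \<otimes> q"
      using twist_root_eq[OF f _ qc(2)] by simp
    moreover have "twist_root f w = q" using twist_root_eq[OF f qc(1,2)] qc by simp
    moreover have "log_der d (s \<otimes> (inv s \<otimes> q)) (w, f) =
        log_der d s (w, f) + log_der d (inv s \<otimes> q) (inv (twist f s) \<otimes> w, f)"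
      using P w f by (intro log_der_mult[OF d(1)]) auto
    ultimately show ?thesis using dl1[OF P(1) w] nt f w P by (simp add: cobound_def)
  qed
  obtain s c where sc: "s \<in> Rf f" "c \<in> Cf f" "u = s \<otimes> c" using Rf_Cf_decomp[OF f u] .
  have P: "s \<in> carrier P" "c \<in> carrier P" "r \<in> carrier P" using sc r by (auto simp: Cf_def)
  have tR: "inv (twist f s) \<in> Rf f" using P by (intro R.m_inv_closed) (auto simp: Rf_def)
  have eq: "log_der d1 u (w, f) = log_der d1 c (w, f)" if w: "w \<in> carrier P" for w
    using log_der_mult[OF d1 P(1,2) w f] zero[OF sc(1) w] log_der_Cf_invariant[OF d1 f sc(2) tR w] sc by simp
  show "log_der d1 u (r \<otimes> v, f) = log_der d1 u (v, f)"
    using eq v P log_der_Cf_invariant[OF d1 f sc(2) r v] by simp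
qed

end

section \<open>Solvability for cyclic Frattini quotients\<close>

context p'_action
begin

lemma Jp_sandwich: "a \<in> KG \<Longrightarrow> b \<in> KG \<Longrightarrow> x \<in> Jp n \<Longrightarrow> a \<star> (x \<star> b) \<in> Jp n"
  by (intro Jp_left Jp_right)

section \<open>The map \<open>u - 1\<close> modulo \<open>J^2\<close> and the Frattini
  subgroup\<close>

lemma aug_mult:
  assumes "u \<in> carrier P" "v \<in> carrier P"
  shows "up (u \<otimes> v) - one' - ((up u - one') + (up v - one')) \<in> Jp 2"
proof -
  have "up (u \<otimes> v) - one' - ((up u - one') + (up v - one')) = (up u - one') \<star> (up v - one')"
    using assms by (simp add: conv_bilinear up_mult)
  then show ?thesis
    using Jp_mult[OF aug_in_Jp1[OF assms(1)] aug_in_Jp1[OF assms(2)]] by (simp add: numeral_2_eq_2)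
qed

text \<open>The second dimension subgroup modulo \<open>p\<close>. It will turn out to be the
  Frattini subgroup (\<open>frattini_eq_Kp\<close>), described through \<open>J\<close> instead of
  an intersection.\<close>

definition Kp :: "'a set" where "Kp = {v \<in> carrier P. up v - one' \<in> Jp 2}"

lemma Kp_subgroup: "subgroup Kp P"
proof (rule P.finite_subgroupI[OF fin_P])
  show "Kp \<noteq> {}" using up_one by (auto simp: Kp_def intro!: exI[of _ "\<one>"])
  fix u v assume u: "u \<in> Kp" and v: "v \<in> Kp"
  then have "(up u - one') + (up v - one') \<in> Jp 2" using u by (intro Jp_add) (auto simp: Kp_def)
  then have "up (u \<otimes> v) - one' \<in> Jp 2"
    using Jp_add[OF aug_mult[of u v]] u v unfolding Kp_def by fastforce
  then show "u \<otimes> v \<in> Kp"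
    using u v by (simp add: Kp_def)
qed (auto simp: Kp_def)

lemma aug_phi: "e \<in> carrier E \<Longrightarrow> v \<in> carrier P \<Longrightarrow>
    up (\<phi> e v) - one' = ue e \<star> ((up v - one') \<star> ue (inv\<^bsub>E\<^esub> e))"
  by (simp add: up_phi conv_bilinear ue_mult ue_one)

lemma Kp_stable: "e \<in> carrier E \<Longrightarrow> v \<in> Kp \<Longrightarrow> \<phi> e v \<in> Kp"
  by (auto simp: Kp_def aug_phi intro!: Jp_sandwich)

lemma aug_pow:
  assumes "v \<in> carrier P"
  shows "up (v [^] n) - one' - scl (of_nat n) (up v - one') \<in> Jp 2"
proof (induction n)
  case 0
  then show ?case by (simp add: up_one)
next
  case (Suc n)
  have eq: "up (v [^] Suc n) - one' - scl (of_nat (Suc n)) (up v - one') =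
      (up (v [^] n \<otimes> v) - one' - ((up (v [^] n) - one') + (up v - one')))
      + (up (v [^] n) - one' - scl (of_nat n) (up v - one'))"
    by (simp add: fv.scale_left_distrib)
  show ?case unfolding eq using assms by (intro Jp_add[OF aug_mult Suc]) auto
qed

lemma pow_p_Kp: "v \<in> carrier P \<Longrightarrow> v [^] p \<in> Kp"
  using aug_pow[of v p] char_k of_nat_eq_0_iff_char_dvd[where 'a = 'k, of p] by (simp add: Kp_def)

lemma Mod_pow:
  assumes "subgroup N P" "x \<in> carrier P"
  shows "(N #> x) [^]\<^bsub>P Mod N\<^esub> (n::nat) = N #> (x [^] n)"
proof -
  interpret N: normal N P using assms(1) by (rule P.subgroup_imp_normal)
  interpret h: group_hom P "P Mod N" "(#>) N"
    by (intro group_hom.intro group_hom_axioms.intro P.is_group N.factorgroup_is_group N.r_coset_hom_Mod)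
  show ?thesis using h.hom_nat_pow[OF assms(2)] by simp
qed

lemma elementary_abelian_Mod_iff:
  assumes N: "subgroup N P"
  shows "elementary_abelian p (P Mod N) \<longleftrightarrow> (\<forall>x\<in>carrier P. x [^] p \<in> N)"
proof -
  have "N #> y = N \<longleftrightarrow> y \<in> N" if "y \<in> carrier P" for y
    using P.coset_join1[OF _ that N] P.coset_join2[OF that N] subgroup.subset[OF N] by blast
  then show ?thesis
    using P.abelian_FactGroup[OF N] Mod_pow[OF N]
    by (auto simp: elementary_abelian_def FactGroup_def RCOSETS_def)
qed

lemma frattini_subset_Kp: "frattini p P \<subseteq> Kp"
  using P.subgroup_imp_normal[OF Kp_subgroup] elementary_abelian_Mod_iff[OF Kp_subgroup] pow_p_Kp
  by (auto simp: frattini_def)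

end

section \<open>Operators on \<open>J/J^2\<close> that commute with the derivations killing
  \<open>E\<close>\<close>

context p'_action_central
begin

text \<open>The map \<open>y \<mapsto> e y e^(-1) z\<close>. For \<open>z\<close> in the kernel it
  sends \<open>v - 1\<close> to \<open>(\<phi> e v - 1) z\<close>, and thereby reaches the
  components at the kernel from \<open>kP\<close>.\<close>

definition conj_shift :: "'b \<Rightarrow> 'b \<Rightarrow> ('a \<times> 'b \<Rightarrow> 'k) \<Rightarrow> ('a \<times> 'b \<Rightarrow> 'k)" where
  "conj_shift e z y = ue e \<star> (y \<star> ue (inv\<^bsub>E\<^esub> e \<otimes>\<^bsub>E\<^esub> z))"

inductive_set equi_ops :: "(('a \<times> 'b \<Rightarrow> 'k) \<Rightarrow> ('a \<times> 'b \<Rightarrow> 'k)) set" where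
  zero: "(\<lambda>y. 0) \<in> equi_ops"
| base: "e \<in> carrier E \<Longrightarrow> z \<in> act_ker \<Longrightarrow> conj_shift e z \<in> equi_ops"
| add: "h \<in> equi_ops \<Longrightarrow> h' \<in> equi_ops \<Longrightarrow> (\<lambda>y. h y + h' y) \<in> equi_ops"
| scl: "h \<in> equi_ops \<Longrightarrow> (\<lambda>y. scl c (h y)) \<in> equi_ops"

lemma act_ker_E [simp]: "z \<in> act_ker \<Longrightarrow> z \<in> carrier E"
  by (simp add: act_ker_iff)

lemma act_ker_mult: "z \<in> act_ker \<Longrightarrow> w \<in> act_ker \<Longrightarrow> z \<otimes>\<^bsub>E\<^esub> w \<in> act_ker"
  by (simp add: act_ker_iff phi_comp)

lemma one_act_ker [simp]: "\<one>\<^bsub>E\<^esub> \<in> act_ker"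
  by (simp add: act_ker_iff)

lemma conj_shift_linear: "conj_shift e z (x + y) = conj_shift e z x + conj_shift e z y" "conj_shift e z (scl c x) = scl c (conj_shift e z x)" "conj_shift e z 0 = 0"
  by (simp_all add: conj_shift_def conv_bilinear)

lemma equi_ops_linear:
  assumes "h \<in> equi_ops"
  shows "h (x + y) = h x + h y" "h (scl c x) = scl c (h x)" "h 0 = 0"
  using assms by (induction h rule: equi_ops.induct)
    (simp_all add: conj_shift_linear fv.scale_right_distrib mult.commute)

lemma equi_ops_diff: "h \<in> equi_ops \<Longrightarrow> h (x - y) = h x - h y"
  using equi_ops_linear(1)[of h "x - y" y] by simp

lemma equi_ops_Jp: "h \<in> equi_ops \<Longrightarrow> y \<in> Jp n \<Longrightarrow> h y \<in> Jp n"
  by (induction h rule: equi_ops.induct) (auto simp: conj_shift_def intro!: Jp_sandwich)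

text \<open>A derivation killing \<open>E\<close> is linear over \<open>kE\<close> on both
  sides.\<close>

lemma equi_ops_der:
  assumes d: "d \<in> ders" "\<And>e. e \<in> carrier E \<Longrightarrow> d (ue e) = 0" and h: "h \<in> equi_ops" and y: "y \<in> KG"
  shows "d (h y) = h (d y)"
  using h
proof (induction h rule: equi_ops.induct)
  case (base e z)
  then show ?case using d y by (simp add: conj_shift_def der_mult[OF d(1)])
next
  case (add h h')
  have "h y \<in> KG" "h' y \<in> KG" using equi_ops_Jp[of _ y 0] add y by auto
  then show ?case using add by (simp add: der_add[OF d(1)])
next
  case (scl h c)
  have "h y \<in> KG" using equi_ops_Jp[of _ y 0] scl y by auto
  then show ?case using scl by (simp add: der_scl[OF d(1)])
qed (simp add: der_zero[OF d(1)])

lemma conj_shift_aug: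
  assumes "e \<in> carrier E" "z \<in> act_ker" "v \<in> carrier P" "w \<in> act_ker"
  shows "conj_shift e z ((up v - one') \<star> ue w) = (up (\<phi> e v) - one') \<star> ue (z \<otimes>\<^bsub>E\<^esub> w)"
proof -
  have "w \<otimes>\<^bsub>E\<^esub> (inv\<^bsub>E\<^esub> e \<otimes>\<^bsub>E\<^esub> z) = inv\<^bsub>E\<^esub> e \<otimes>\<^bsub>E\<^esub> (z \<otimes>\<^bsub>E\<^esub> w)"
    using assms act_ker_central[OF assms(4), of "inv\<^bsub>E\<^esub> e \<otimes>\<^bsub>E\<^esub> z"] by (simp add: E.m_assoc)
  then show ?thesis
    using assms by (simp add: conj_shift_def aug_phi conv_assoc ue_mult)
qed

lemma conj_shift_aug': "e \<in> carrier E \<Longrightarrow> z \<in> act_ker \<Longrightarrow> v \<in> carrier P \<Longrightarrow>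
    conj_shift e z (up v - one') = (up (\<phi> e v) - one') \<star> ue z"
  using conj_shift_aug[of e z v "\<one>\<^bsub>E\<^esub>"] by (simp add: ue_one)

lemma conj_shift_conj_shift_commute:
  assumes "e \<in> carrier E" "z \<in> act_ker" "f \<in> carrier E" "w \<in> act_ker" "v \<in> carrier P"
  shows "conj_shift e z (conj_shift f w (up v - one')) = conj_shift f w (conj_shift e z (up v - one'))"
  using assms act_ker_central[OF assms(2), of w] phi_commute[of e f v]
  by (simp add: conj_shift_aug conj_shift_aug')

lemma conj_shift_equi_ops_commute:
  assumes "e \<in> carrier E" "z \<in> act_ker" "v \<in> carrier P" "h \<in> equi_ops"
  shows "conj_shift e z (h (up v - one')) = h (conj_shift e z (up v - one'))"
  using assms(4) by (induction h rule: equi_ops.induct) (use assms in \<open>simp_all add: conj_shift_linear conj_shift_conj_shift_commute\<close>)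

text \<open>Commutation is claimed on elements \<open>v - 1\<close> only. There the conjugations
  commute because \<open>E\<close> acts on \<open>P\<close> through an abelian group, and the
  factors from the kernel are central in \<open>E\<close>.\<close>

lemma equi_ops_commute:
  assumes "v \<in> carrier P" "h \<in> equi_ops" "h' \<in> equi_ops"
  shows "h' (h (up v - one')) = h (h' (up v - one'))"
  using assms(3)
  by (induction h' rule: equi_ops.induct) (simp_all add: equi_ops_linear[OF assms(2)] conj_shift_equi_ops_commute assms)

lemma equi_ops_conj:
  assumes "h \<in> equi_ops" "e \<in> carrier E" "v \<in> carrier P"
  shows "\<exists>h'\<in>equi_ops. conj_shift e \<one>\<^bsub>E\<^esub> (h (up v - one')) = h' (up v - one')"
  using assms(1)
proof (induction h rule: equi_ops.induct)
  case zero
  then show ?case by (intro bexI[OF _ equi_ops.zero]) (simp add: conj_shift_linear)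
next
  case (base f w)
  have "conj_shift e \<one>\<^bsub>E\<^esub> (conj_shift f w (up v - one')) = conj_shift (e \<otimes>\<^bsub>E\<^esub> f) w (up v - one')"
    using assms base by (simp add: conj_shift_aug conj_shift_aug' phi_comp)
  then show ?case using equi_ops.base[of "e \<otimes>\<^bsub>E\<^esub> f" w] assms base by auto
next
  case (add h h')
  then obtain g g' where "g \<in> equi_ops" "conj_shift e \<one>\<^bsub>E\<^esub> (h (up v - one')) = g (up v - one')"
    "g' \<in> equi_ops" "conj_shift e \<one>\<^bsub>E\<^esub> (h' (up v - one')) = g' (up v - one')" by blast
  then show ?case by (intro bexI[of _ "\<lambda>y. g y + g' y"] equi_ops.add) (simp_all add: conj_shift_linear)
next
  case (scl h c)
  then obtain g where "g \<in> equi_ops" "conj_shift e \<one>\<^bsub>E\<^esub> (h (up v - one')) = g (up v - one')" by blast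
  then show ?case by (intro bexI[of _ "\<lambda>y. scl c (g y)"] equi_ops.scl) (simp_all add: conj_shift_linear)
qed

definition op_orbit :: "'a \<Rightarrow> ('a \<times> 'b \<Rightarrow> 'k) set" where
  "op_orbit u0 = {y \<in> KG. \<exists>h\<in>equi_ops. y - h (up u0 - one') \<in> Jp 2}"

lemma op_orbit_Jp2: "y \<in> Jp 2 \<Longrightarrow> y \<in> op_orbit u0"
  by (auto simp: op_orbit_def Jp_KG intro!: bexI[OF _ equi_ops.zero])

lemma op_orbit_add: "x \<in> op_orbit u0 \<Longrightarrow> y \<in> op_orbit u0 \<Longrightarrow> x + y \<in> op_orbit u0"
proof -
  assume x: "x \<in> op_orbit u0" and y: "y \<in> op_orbit u0"
  obtain h h' where h: "h \<in> equi_ops" "x - h (up u0 - one') \<in> Jp 2" "h' \<in> equi_ops" "y - h' (up u0 - one') \<in> Jp 2"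
    using x y by (auto simp: op_orbit_def)
  have "x + y - (h (up u0 - one') + h' (up u0 - one')) \<in> Jp 2"
    using Jp_add[OF h(2,4)] by (simp add: algebra_simps)
  then show ?thesis using x y equi_ops.add[OF h(1,3)] by (auto simp: op_orbit_def)
qed

lemma op_orbit_scl: "x \<in> op_orbit u0 \<Longrightarrow> scl c x \<in> op_orbit u0"
proof -
  assume x: "x \<in> op_orbit u0"
  obtain h where h: "h \<in> equi_ops" "x - h (up u0 - one') \<in> Jp 2" using x by (auto simp: op_orbit_def)
  have "scl c x - scl c (h (up u0 - one')) \<in> Jp 2"
    using Jp_scl[OF h(2), of c] by (simp add: fv.scale_right_diff_distrib)
  then show ?thesis using x equi_ops.scl[OF h(1)] by (auto simp: op_orbit_def)
qed

lemma op_orbit_sum: "(\<And>i. i \<in> I \<Longrightarrow> f i \<in> op_orbit u0) \<Longrightarrow> (\<Sum>i\<in>I. f i) \<in> op_orbit u0"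
  by (induction I rule: infinite_finite_induct) (auto intro: op_orbit_add op_orbit_Jp2)

lemma op_orbit_shift: "x \<in> op_orbit u0 \<Longrightarrow> y - x \<in> Jp 2 \<Longrightarrow> y \<in> op_orbit u0"
  using op_orbit_add[OF _ op_orbit_Jp2, of x u0 "y - x"] by simp

text \<open>Expresses inside \<open>P\<close> that the coset of \<open>u0\<close> generates the
  \<open>E\<close>-module \<open>P/\<Phi>(P)\<close>.\<close>

definition generates :: "'a \<Rightarrow> bool" where
  "generates u0 \<longleftrightarrow> u0 \<in> carrier P \<and> (\<forall>H. subgroup H P \<and> frattini p P \<subseteq> H \<and>
     (\<forall>e\<in>carrier E. \<forall>v\<in>H. \<phi> e v \<in> H) \<and> u0 \<in> H \<longrightarrow> H = carrier P)"

text \<open>The \<open>v\<close> for which all \<open>(v - 1) z\<close> lie in the orbit form an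
  \<open>E\<close>-stable subgroup containing \<Phi>(P) and \<open>u0\<close>.\<close>

lemma aug_op_orbit:
  assumes gen: "generates u0" and v: "v \<in> carrier P" and z: "z \<in> act_ker"
  shows "(up v - one') \<star> ue z \<in> op_orbit u0"
proof -
  have u0: "u0 \<in> carrier P" using gen by (simp add: generates_def)
  define H where "H = {v \<in> carrier P. \<forall>z\<in>act_ker. (up v - one') \<star> ue z \<in> op_orbit u0}"
  have "subgroup H P"
  proof (rule P.finite_subgroupI[OF fin_P])
    show "H \<noteq> {}" using op_orbit_Jp2[OF Jp_zero] by (auto simp: H_def up_one intro!: exI[of _ "\<one>"])
  next
    fix u v assume u: "u \<in> H" and v: "v \<in> H"
    have "(up (u \<otimes> v) - one') \<star> ue z \<in> op_orbit u0" if z: "z \<in> act_ker" for z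
    proof (rule op_orbit_shift)
      show "(up u - one') \<star> ue z + (up v - one') \<star> ue z \<in> op_orbit u0"
        using u v z by (intro op_orbit_add) (simp_all add: H_def)
      have "(up (u \<otimes> v) - one' - ((up u - one') + (up v - one'))) \<star> ue z \<in> Jp 2"
        using u v z by (intro Jp_right aug_mult) (auto simp: H_def)
      then show "(up (u \<otimes> v) - one') \<star> ue z - ((up u - one') \<star> ue z + (up v - one') \<star> ue z) \<in> Jp 2"
        by (simp only: conv_diff_left conv_add_left)
    qed
    then show "u \<otimes> v \<in> H" using u v by (simp add: H_def)
  qed (auto simp: H_def)
  moreover have "frattini p P \<subseteq> H"
    using frattini_subset_Kp by (auto simp: H_def Kp_def intro!: op_orbit_Jp2 Jp_right)
  moreover have "u0 \<in> H"
  proof -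
    have "(up u0 - one') \<star> ue z \<in> op_orbit u0" if z: "z \<in> act_ker" for z
    proof -
      have "(up u0 - one') \<star> ue z = conj_shift \<one>\<^bsub>E\<^esub> z (up u0 - one')" using u0 z by (simp add: conj_shift_aug')
      then have "(up u0 - one') \<star> ue z - conj_shift \<one>\<^bsub>E\<^esub> z (up u0 - one') \<in> Jp 2" by simp
      then show ?thesis unfolding op_orbit_def using equi_ops.base[OF E.one_closed z] by blast
    qed
    then show ?thesis using u0 by (simp add: H_def)
  qed
  moreover have "\<phi> e u \<in> H" if e: "e \<in> carrier E" and u: "u \<in> H" for e u
  proof -
    have "(up (\<phi> e u) - one') \<star> ue z \<in> op_orbit u0" if z: "z \<in> act_ker" for z
    proof -
      have uP: "u \<in> carrier P" using u by (simp add: H_def)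
      let ?y = "(up u - one') \<star> ue z"
      have "?y \<in> op_orbit u0" using u z by (simp add: H_def)
      then obtain h where h: "h \<in> equi_ops" "?y - h (up u0 - one') \<in> Jp 2" by (auto simp: op_orbit_def)
      obtain h' where h': "h' \<in> equi_ops" "conj_shift e \<one>\<^bsub>E\<^esub> (h (up u0 - one')) = h' (up u0 - one')"
        using equi_ops_conj[OF h(1) e u0] by blast
      have "conj_shift e \<one>\<^bsub>E\<^esub> (?y - h (up u0 - one')) \<in> Jp 2"
        using equi_ops_Jp[OF equi_ops.base[OF e one_act_ker] h(2)] .
      then have "conj_shift e \<one>\<^bsub>E\<^esub> ?y - h' (up u0 - one') \<in> Jp 2"
        using equi_ops_diff[OF equi_ops.base[OF e one_act_ker]] h'(2) by simp
      moreover have "conj_shift e \<one>\<^bsub>E\<^esub> ?y = (up (\<phi> e u) - one') \<star> ue z"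
        using conj_shift_aug[OF e one_act_ker uP z] z by simp
      ultimately show ?thesis using h'(1) by (auto simp: op_orbit_def)
    qed
    then show ?thesis using e u by (simp add: H_def)
  qed
  ultimately have "H = carrier P" using gen unfolding generates_def by blast
  then show ?thesis using v z by (auto simp: H_def)
qed

lemma KG_act_ker_op_orbit:
  assumes gen: "generates u0" and y: "y \<in> KG"
    and supp: "\<And>v f. v \<in> carrier P \<Longrightarrow> f \<in> carrier E \<Longrightarrow> f \<notin> act_ker \<Longrightarrow> y (v, f) = 0"
    and z: "\<And>f. f \<in> act_ker \<Longrightarrow> (\<Sum>v\<in>carrier P. y (v, f)) = 0"
  shows "y \<in> op_orbit u0"
proof -
  have inner: "(\<Sum>v\<in>carrier P. scl (y (v, f)) (sgl (v, f))) \<in> op_orbit u0" if f: "f \<in> carrier E" for f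
  proof (cases "f \<in> act_ker")
    case True
    have "(\<Sum>v\<in>carrier P. scl (y (v, f)) (sgl (v, f))) =
        (\<Sum>v\<in>carrier P. scl (y (v, f)) ((up v - one') \<star> ue f)) + (\<Sum>v\<in>carrier P. scl (y (v, f)) (ue f))"
      using f by (simp add: conv_bilinear up_ue fv.scale_right_diff_distrib sum_subtractf)
    also have "(\<Sum>v\<in>carrier P. scl (y (v, f)) (ue f)) = 0"
      using z[OF True] by (simp flip: fv.scale_sum_left)
    finally show ?thesis
      using aug_op_orbit[OF gen _ True] by (simp add: op_orbit_sum op_orbit_scl)
  next
    case False
    then show ?thesis using supp f by (auto intro!: op_orbit_sum op_orbit_Jp2)
  qed
  show ?thesis by (subst sgl_sum_KG[OF y]) (rule op_orbit_sum, rule inner)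
qed

text \<open>After the coboundary is subtracted, the part of the cocycle outside the kernel lies in
  \<open>J^2\<close> by \<open>Jp2I\<close>. The part \<open>pz\<close> at the kernel has
  augmentation 0 on each coset and is reached from \<open>u0 - 1\<close>.\<close>

lemma cobound_op_orbit:
  assumes gen: "generates u0" and d: "Fil 0 d"
  shows "\<exists>a\<in>KG. Fil 0 (dadd (ad a) d) \<and> dadd (ad a) d (up u0 - one') \<in> op_orbit u0"
proof -
  have u0: "u0 \<in> carrier P" using gen by (simp add: generates_def)
  let ?d1 = "dadd (ad (- cobound d)) d"
  have dE: "d (ue e) = 0" if "e \<in> carrier E" for e using FilD(2)[OF d that] .
  note d1 = cobound_correct[OF FilD(1)[OF d] dE]
  let ?y = "log_der ?d1 u0"
  define pz where "pz = (\<lambda>x. if snd x \<in> act_ker then ?y x else 0)"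
  have pzK: "pz \<in> KG" using KG_D[OF log_der_KG] by (auto simp: pz_def intro!: KG_I)
  have "?y - pz \<in> Jp 2"
  proof (rule Jp2I)
    fix f v r assume fvr: "f \<in> carrier E" "v \<in> carrier P" "r \<in> Rf f"
    show "(?y - pz) (r \<otimes> v, f) = (?y - pz) (v, f)"
    proof (cases "f \<in> act_ker")
      case False
      then have "\<exists>u\<in>carrier P. \<phi> f u \<noteq> u" using fvr act_ker_iff by blast
      then show ?thesis using d1(3)[OF _ u0 fvr(2,1) _ fvr(3)] False by (simp add: pz_def minus_apply)
    qed (simp add: pz_def minus_apply)
  qed (use pzK in \<open>auto simp: pz_def minus_apply act_ker_iff\<close>)
  moreover have "pz \<in> op_orbit u0"
  proof (rule KG_act_ker_op_orbit[OF gen pzK])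
    fix f assume f: "f \<in> act_ker"
    then have "(\<Sum>v\<in>carrier P. pz (v, f)) = aug_comp ?d1 f u0" by (simp add: pz_def aug_comp_def)
    then show "(\<Sum>v\<in>carrier P. pz (v, f)) = 0" using aug_comp_zero[OF d1(1,2) _ u0] f by simp
  qed (simp add: pz_def)
  ultimately have y: "?y \<in> op_orbit u0" by (rule op_orbit_shift[rotated])
  have yJ: "?y \<in> Jp 1" by (rule log_der_Jp1[OF d1(1,2) u0])
  have "?d1 (up u0 - one') = ?y \<star> up u0"
    using u0 by (simp add: der_diff[OF d1(1)] der_one'[OF d1(1)] der_up[OF d1(1)])
  \<comment> \<open>Passing from the cocycle value \<open>y\<close> back to the derivative
    \<open>y u0\<close> costs \<open>y (u0 - 1)\<close>, which lies in \<open>J^2\<close>.\<close>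
  then have "?d1 (up u0 - one') - ?y = ?y \<star> (up u0 - one')"
    using Jp_KG[OF yJ] by (simp add: conv_diff_right)
  moreover have "?y \<star> (up u0 - one') \<in> Jp 2"
    using Jp_mult[OF yJ aug_in_Jp1[OF u0]] by (simp add: numeral_2_eq_2)
  ultimately have "?d1 (up u0 - one') \<in> op_orbit u0" using op_orbit_shift[OF y] by simp
  then show ?thesis using Fil_0[OF d1(1,2)] cobound_KG[of d] by blast
qed

lemma Fil_1_bracket:
  assumes gen: "generates u0" and d: "Fil 0 d" "d (up u0 - one') \<in> op_orbit u0"
    and d': "Fil 0 d'" "d' (up u0 - one') \<in> op_orbit u0"
  shows "Fil 1 (dbr d d')"
proof -
  have u0: "u0 \<in> carrier P" using gen by (simp add: generates_def)
  let ?x = "up u0 - one'"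
  have x: "?x \<in> KG" using u0 by simp
  let ?D = "dbr d d'"
  have D: "Fil 0 ?D" using Fil_dbr[OF d(1) d'(1)] by simp
  note dd = FilD(1)[OF d(1)] FilD(1)[OF d'(1)] FilD(1)[OF D]
  \<comment> \<open>\<open>g x\<close> may be replaced by \<open>h' x\<close> because
    \<open>f\<close> preserves \<open>J^2\<close>; then \<open>f\<close> passes through
    \<open>h'\<close>. The operators thus compose in reversed order.\<close>
  have key: "f (g ?x) - h' (h ?x) \<in> Jp 2"
    if f: "Fil 0 f" "h \<in> equi_ops" "f ?x - h ?x \<in> Jp 2" and g: "Fil 0 g" "h' \<in> equi_ops" "g ?x - h' ?x \<in> Jp 2"
    for f g h h'
  proof -
    note ff = FilD(1)[OF f(1)]
    have K: "g ?x \<in> KG" "h' ?x \<in> KG" using x der_closed[OF FilD(1)[OF g(1)]] equi_ops_Jp[OF g(2), of ?x 0] by auto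
    have "f (g ?x - h' ?x) \<in> Jp 2" using Fil_Jp[OF f(1) g(3)] by simp
    then have "f (g ?x) - h' (f ?x) \<in> Jp 2"
      using equi_ops_der[OF ff FilD(2)[OF f(1)] g(2) x] der_diff[OF ff K] by simp
    moreover have "h' (f ?x) - h' (h ?x) \<in> Jp 2"
      using equi_ops_Jp[OF g(2) f(3)] equi_ops_diff[OF g(2)] by simp
    ultimately show ?thesis using Jp_add by fastforce
  qed
  obtain h h' where h: "h \<in> equi_ops" "d ?x - h ?x \<in> Jp 2" "h' \<in> equi_ops" "d' ?x - h' ?x \<in> Jp 2"
    using d(2) d'(2) by (auto simp: op_orbit_def)
  have "d (d' ?x) - h' (h ?x) \<in> Jp 2" "d' (d ?x) - h (h' ?x) \<in> Jp 2"
    using key[OF d(1) h(1,2) d'(1) h(3,4)] key[OF d'(1) h(3,4) d(1) h(1,2)] .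
  then have "(d (d' ?x) - h' (h ?x)) - (d' (d ?x) - h (h' ?x)) \<in> Jp 2" by (rule Jp_diff)
  then have "?D ?x \<in> Jp 2" using equi_ops_commute[OF u0 h(1,3)] x by (simp add: dbr_apply)
  then have Du0: "?D (up u0) \<in> Jp 2" using u0 by (simp add: der_diff[OF dd(3)] der_one'[OF dd(3)])
  \<comment> \<open>So far only \<open>u0\<close> is controlled. The \<open>v\<close> with
    \<open>D(v)\<close> in \<open>J^2\<close> form an \<open>E\<close>-stable subgroup above
    \<Phi>(P), so generation by \<open>u0\<close> finishes.\<close>
  define H where "H = {v \<in> carrier P. ?D (up v) \<in> Jp 2}"
  have "subgroup H P"
  proof (rule P.finite_subgroupI[OF fin_P])
    show "H \<noteq> {}" by (auto simp: H_def up_one der_one'[OF dd(3)] intro!: exI[of _ "\<one>"])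
  next
    fix u v assume "u \<in> H" "v \<in> H"
    then show "u \<otimes> v \<in> H"
      by (auto simp: H_def der_mult[OF dd(3)] simp flip: up_mult
          intro!: Jp_add Jp_left[OF up_KG, of u] Jp_right[OF _ up_KG, of "?D (up u)"])
  qed (auto simp: H_def)
  moreover have "frattini p P \<subseteq> H"
  proof
    fix v assume "v \<in> frattini p P"
    then have v: "v \<in> carrier P" "up v - one' \<in> Jp 2" using frattini_subset_Kp by (auto simp: Kp_def)
    then show "v \<in> H" using Fil_Jp[OF D v(2)] by (simp add: H_def der_diff[OF dd(3)] der_one'[OF dd(3)])
  qed
  moreover have "\<phi> e v \<in> H" if "e \<in> carrier E" "v \<in> H" for e v
    using that der_up_phi[OF dd(3) FilD(2)[OF D], of v e] by (auto simp: H_def intro!: Jp_sandwich)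
  ultimately have "H = carrier P" using gen Du0 u0 unfolding generates_def by (auto simp: H_def)
  then show ?thesis using D by (auto simp: Fil_def H_def numeral_2_eq_2)
qed

lemma solvable_if_generated:
  assumes gen: "generates u0"
  shows "lie_solvable (HA :: ('k, _) module)"
proof (rule lie_solvable_of_Fil[OF ex_Fil_0])
  fix d d' assume d: "Fil 0 d" and d': "Fil 0 d'"
  obtain a where a: "a \<in> KG" "Fil 0 (dadd (ad a) d)" "dadd (ad a) d (up u0 - one') \<in> op_orbit u0"
    using cobound_op_orbit[OF gen d] by blast
  obtain a' where a': "a' \<in> KG" "Fil 0 (dadd (ad a') d')" "dadd (ad a') d' (up u0 - one') \<in> op_orbit u0"
    using cobound_op_orbit[OF gen d'] by blast
  note dd = FilD(1)[OF d] FilD(1)[OF d'] FilD(1)[OF a(2)] FilD(1)[OF a'(2)]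
  let ?D = "dbr (dadd (ad a) d) (dadd (ad a') d')"
  \<comment> \<open>The corrections by \<open>a\<close> and \<open>a'\<close> are inner and leave
    the class of the bracket unchanged.\<close>
  have "cls ?D = cls (dbr d d')"
    using HA_mult[OF dd(1,2)] HA_mult[OF dd(3,4)] cls_eq[OF dd(1) a(1)] cls_eq[OF dd(2) a'(1)] by simp
  then have "?D \<in> cls (dbr d d')" using cls_self[OF dbr_ders[OF dd(3,4)]] by simp
  then show "\<exists>a\<in>KG. Fil 1 (dadd (ad a) (dbr d d'))"
    using Fil_1_bracket[OF gen a(2,3) a'(2,3)] by (auto simp: cls_def)
qed

end

section \<open>Finite modules of prime exponent\<close>

lemma (in group) eq_if_mult_inv_one:
  assumes "x \<in> carrier G" "y \<in> carrier G" "x \<otimes> inv y = \<one>"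
  shows "x = y"
  using inv_equality[OF assms(3)] assms(1,2) by simp

lemma (in group) eq_if_inv_mult_one:
  assumes "x \<in> carrier G" "y \<in> carrier G" "inv y \<otimes> x = \<one>"
  shows "x = y"
  using inv_equality[OF assms(3)] assms(1,2) by (metis inv_closed inv_inv)

lemma (in group) pow_cong:
  assumes "x \<in> carrier G" "x [^] (p::nat) = \<one>" "[a = b] (mod p)"
  shows "x [^] a = x [^] b"
proof -
  have "x [^] n = x [^] (n mod p)" for n :: nat
  proof -
    have "x [^] n = x [^] (p * (n div p) + n mod p)" by simp
    also have "\<dots> = (x [^] p) [^] (n div p) \<otimes> x [^] (n mod p)"
      using assms(1) by (simp add: nat_pow_mult nat_pow_pow)
    finally show ?thesis using assms by simp
  qed
  then show ?thesis using assms(3) by (metis cong_def)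
qed

lemma (in group) subgroup_pow_closed: "subgroup H G \<Longrightarrow> x \<in> H \<Longrightarrow> x [^] (n::nat) \<in> H"
  by (induction n) (auto simp: subgroup.one_closed subgroup.m_closed)

text \<open>Take \<open>M\<close> maximal with trivial intersection with \<open>U\<close>. For
  \<open>x\<close> outside \<open>M\<close>, the group generated by \<open>M\<close> and
  \<open>x\<close> meets \<open>U\<close> in some \<open>u = m x^i\<close> other than 1; here
  \<open>i\<close> is invertible modulo \<open>p\<close>, so \<open>x\<close> lies in
  \<open>U M\<close>.\<close>

lemma (in comm_group) elementary_complement:
  assumes fin: "finite (carrier G)" and p: "Factorial_Ring.prime p"
    and pow: "\<And>x. x \<in> carrier G \<Longrightarrow> x [^] (p::nat) = \<one>" and U: "subgroup U G"
  shows "\<exists>M. subgroup M G \<and> U \<inter> M = {\<one>} \<and> (\<forall>x\<in>carrier G. \<exists>u\<in>U. \<exists>m\<in>M. x = u \<otimes> m)"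
proof -
  define \<M> where "\<M> = {M. subgroup M G \<and> U \<inter> M = {\<one>}}"
  have "\<M> \<subseteq> Pow (carrier G)" using subgroup.subset by (auto simp: \<M>_def)
  then have "finite \<M>" using fin finite_subset by blast
  moreover have "{\<one>} \<in> \<M>" using triv_subgroup subgroup.one_closed[OF U] by (auto simp: \<M>_def)
  ultimately obtain M where M: "M \<in> \<M>" and max: "\<And>N. N \<in> \<M> \<Longrightarrow> M \<subseteq> N \<Longrightarrow> N = M"
    using finite_has_maximal[of \<M>] by (metis empty_iff)
  have sM: "subgroup M G" and UM: "U \<inter> M = {\<one>}" using M by (auto simp: \<M>_def)
  interpret U: subgroup U G by fact
  interpret M: subgroup M G by fact
  have "\<exists>u\<in>U. \<exists>m\<in>M. x = u \<otimes> m" if x: "x \<in> carrier G" for x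
  proof (cases "x \<in> M")
    case True
    then show ?thesis using x by (intro bexI[of _ \<one>] bexI[of _ x]) auto
  next
    case False
    define N where "N = {m \<otimes> x [^] (i::nat) | m i. m \<in> M}"
    have "subgroup N G"
    proof (rule finite_subgroupI[OF fin])
      show "N \<subseteq> carrier G" using x by (auto simp: N_def)
      show "N \<noteq> {}" using M.one_closed unfolding N_def by blast
    next
      fix y z assume "y \<in> N" "z \<in> N"
      then obtain m i m' i' where y: "m \<in> M" "y = m \<otimes> x [^] (i::nat)" "m' \<in> M" "z = m' \<otimes> x [^] (i'::nat)"
        by (auto simp: N_def)
      then have "y \<otimes> z = (m \<otimes> m') \<otimes> x [^] (i + i')"
        using x by (simp add: m_ac flip: nat_pow_mult)
      then show "y \<otimes> z \<in> N" using y unfolding N_def by blast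
    qed
    moreover have MN: "M \<subseteq> N"
    proof
      fix m assume "m \<in> M"
      moreover from this have "m = m \<otimes> x [^] (0::nat)" by simp
      ultimately show "m \<in> N" unfolding N_def by blast
    qed
    moreover have "x \<in> N"
    proof -
      have "x = \<one> \<otimes> x [^] (1::nat)" using x by simp
      then show ?thesis unfolding N_def using M.one_closed by blast
    qed
    ultimately have "U \<inter> N \<noteq> {\<one>}" using max[of N] False by (auto simp: \<M>_def)
    moreover have "\<one> \<in> U \<inter> N" using MN by auto
    ultimately obtain u where u: "u \<in> U" "u \<in> N" "u \<noteq> \<one>" by blast
    then obtain m i where mi: "m \<in> M" "u = m \<otimes> x [^] (i::nat)" by (auto simp: N_def)
    have "\<not> p dvd i"
    proof
      assume "p dvd i"
      then obtain t where "i = p * t" by blast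
      then have "x [^] i = \<one>" using x pow by (simp flip: nat_pow_pow)
      then show False using mi u UM by auto
    qed
    then have "coprime i p" using p by (metis coprime_commute prime_imp_coprime)
    then obtain j where j: "[i * j = 1] (mod p)" using cong_solve_coprime_nat by (metis One_nat_def)
    have xP: "x [^] (i * j) = x" using pow_cong[OF x pow[OF x] j] x by simp
    have "u [^] j = m [^] j \<otimes> x" using mi x xP by (simp add: nat_pow_distrib nat_pow_pow)
    moreover have C: "m [^] j \<in> carrier G" using mi by simp
    ultimately have "inv (m [^] j) \<otimes> u [^] j = x" using x by (simp flip: m_assoc)
    then have "x = u [^] j \<otimes> inv (m [^] j)" using C u(1) by (simp add: m_comm)
    moreover have "u [^] j \<in> U" "inv (m [^] j) \<in> M"
      using subgroup_pow_closed[OF U u(1)] subgroup_pow_closed[OF sM mi(1)] by auto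
    ultimately show ?thesis by blast
  qed
  then show ?thesis using sM UM by blast
qed

lemma (in comm_group) elementary_projection:
  assumes fin: "finite (carrier G)" and p: "Factorial_Ring.prime p"
    and pow: "\<And>x. x \<in> carrier G \<Longrightarrow> x [^] (p::nat) = \<one>" and U: "subgroup U G"
  shows "\<exists>f. (\<forall>x\<in>carrier G. f x \<in> U) \<and> (\<forall>u\<in>U. f u = u) \<and>
    (\<forall>x\<in>carrier G. \<forall>y\<in>carrier G. f (x \<otimes> y) = f x \<otimes> f y)"
proof -
  obtain M where M: "subgroup M G" "U \<inter> M = {\<one>}"
    and dec: "\<And>x. x \<in> carrier G \<Longrightarrow> \<exists>u\<in>U. \<exists>m\<in>M. x = u \<otimes> m"
    using elementary_complement[OF assms] by blast
  interpret U: subgroup U G by fact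
  interpret M: subgroup M G by fact
  have uniq: "u = u'" if h: "u \<in> U" "u' \<in> U" "m \<in> M" "m' \<in> M" "u \<otimes> m = u' \<otimes> m'" for u u' m m'
  proof -
    have "inv u' \<otimes> u = (inv u' \<otimes> (u \<otimes> m)) \<otimes> inv m" using h(1-4) by (simp add: m_assoc)
    also have "\<dots> = m' \<otimes> inv m" unfolding h(5) using h(1-4) by (simp flip: m_assoc)
    finally have eq: "inv u' \<otimes> u = m' \<otimes> inv m" .
    have "inv u' \<otimes> u \<in> U" using h(1,2) by simp
    moreover have "inv u' \<otimes> u \<in> M" unfolding eq using h(3,4) by simp
    ultimately have "inv u' \<otimes> u \<in> U \<inter> M" by blast
    then have "inv u' \<otimes> u = \<one>" using M by blast
    then show ?thesis by (rule eq_if_inv_mult_one[OF U.mem_carrier[OF h(1)] U.mem_carrier[OF h(2)]])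
  qed
  define f where "f x = (THE u. u \<in> U \<and> (\<exists>m\<in>M. x = u \<otimes> m))" for x
  have f: "f (u \<otimes> m) = u" if "u \<in> U" "m \<in> M" for u m
    unfolding f_def by (rule the_equality) (use that uniq in blast)+
  show ?thesis
  proof (intro exI[of _ f] conjI ballI)
    fix x assume "x \<in> carrier G"
    then obtain u m where um: "u \<in> U" "m \<in> M" "x = u \<otimes> m" using dec by blast
    then show "f x \<in> U" using f by simp
    fix y assume "y \<in> carrier G"
    then obtain u' m' where um': "u' \<in> U" "m' \<in> M" "y = u' \<otimes> m'" using dec by blast
    have "x \<otimes> y = (u \<otimes> u') \<otimes> (m \<otimes> m')" using um um' by (simp add: m_ac)
    then show "f (x \<otimes> y) = f x \<otimes> f y" using um um' f by simp
  next
    fix u assume "u \<in> U"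
    then show "f u = u" using f[of u \<one>] by simp
  qed
qed

text \<open>An \<open>F_p E\<close>-module in multiplicative notation. Exponent \<open>p\<close>
  makes every subgroup a subspace and every homomorphism linear, so scalars do not appear.\<close>

locale fin_rep = Q: comm_group Q + E: group E
  for Q :: "('v, 'm) monoid_scheme" (structure) and E :: "('b, 'n) monoid_scheme" +
  fixes \<rho> :: "'b \<Rightarrow> 'v \<Rightarrow> 'v" and p :: nat
  assumes fin_Q [simp, intro]: "finite (carrier Q)" and fin_E [simp, intro]: "finite (carrier E)"
    and prime_p: "Factorial_Ring.prime p" and pow_p: "\<And>x. x \<in> carrier Q \<Longrightarrow> x [^] p = \<one>"
    and coprime_E: "coprime (Coset.order E) p"
    and rho_closed [simp, intro]: "\<And>g x. g \<in> carrier E \<Longrightarrow> x \<in> carrier Q \<Longrightarrow> \<rho> g x \<in> carrier Q"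
    and rho_mult: "\<And>g x y. g \<in> carrier E \<Longrightarrow> x \<in> carrier Q \<Longrightarrow> y \<in> carrier Q \<Longrightarrow>
      \<rho> g (x \<otimes> y) = \<rho> g x \<otimes> \<rho> g y"
    and rho_comp: "\<And>g h x. g \<in> carrier E \<Longrightarrow> h \<in> carrier E \<Longrightarrow> x \<in> carrier Q \<Longrightarrow>
      \<rho> (g \<otimes>\<^bsub>E\<^esub> h) x = \<rho> g (\<rho> h x)"
    and rho_one_E: "\<And>x. x \<in> carrier Q \<Longrightarrow> \<rho> \<one>\<^bsub>E\<^esub> x = x"
begin

lemma rho_hom: "g \<in> carrier E \<Longrightarrow> group_hom Q Q (\<rho> g)"
  by unfold_locales (auto simp: hom_def rho_mult)

lemma rho_one [simp]: "g \<in> carrier E \<Longrightarrow> \<rho> g \<one> = \<one>"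
  using group_hom.hom_one[OF rho_hom] .

lemma rho_cancel [simp]:
  assumes "g \<in> carrier E" "x \<in> carrier Q"
  shows "\<rho> g (\<rho> (inv\<^bsub>E\<^esub> g) x) = x" "\<rho> (inv\<^bsub>E\<^esub> g) (\<rho> g x) = x"
  using assms by (simp_all add: rho_one_E flip: rho_comp)

definition srep :: "'v set \<Rightarrow> bool" where
  "srep W \<longleftrightarrow> subgroup W Q \<and> (\<forall>g\<in>carrier E. \<forall>w\<in>W. \<rho> g w \<in> W)"

definition simple :: "'v set \<Rightarrow> bool" where
  "simple W \<longleftrightarrow> srep W \<and> W \<noteq> {\<one>} \<and> (\<forall>U. srep U \<and> U \<subseteq> W \<longrightarrow> U = {\<one>} \<or> U = W)"

definition isom :: "'v set \<Rightarrow> 'v set \<Rightarrow> bool" where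
  "isom W W' \<longleftrightarrow> (\<exists>f. bij_betw f W W' \<and> (\<forall>x\<in>W. \<forall>y\<in>W. f (x \<otimes> y) = f x \<otimes> f y) \<and>
    (\<forall>g\<in>carrier E. \<forall>x\<in>W. f (\<rho> g x) = \<rho> g (f x)))"

definition mfree :: bool where
  "mfree \<longleftrightarrow> (\<exists>\<S>. finite \<S> \<and> (\<forall>W\<in>\<S>. simple W) \<and>
    (\<forall>W\<in>\<S>. \<forall>W'\<in>\<S>. W \<noteq> W' \<longrightarrow> \<not> isom W W') \<and>
    (\<forall>v\<in>carrier Q. \<exists>!c. c \<in> (\<Pi>\<^sub>E W\<in>\<S>. W) \<and> v = finprod Q c \<S>))"

lemma srepD:
  assumes "srep W"
  shows "W \<subseteq> carrier Q" "w \<in> W \<Longrightarrow> w \<in> carrier Q" "\<one> \<in> W" "x \<in> W \<Longrightarrow> y \<in> W \<Longrightarrow> x \<otimes> y \<in> W"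
    "x \<in> W \<Longrightarrow> inv x \<in> W" "g \<in> carrier E \<Longrightarrow> x \<in> W \<Longrightarrow> \<rho> g x \<in> W"
  using assms subgroup.subset[of W Q] subgroup.mem_carrier[of W Q] subgroup.one_closed[of W Q]
    subgroup.m_closed[of W Q] subgroup.m_inv_closed[of W Q]
  unfolding srep_def by auto

lemma srepI:
  assumes "W \<subseteq> carrier Q" "W \<noteq> {}" "\<And>x y. x \<in> W \<Longrightarrow> y \<in> W \<Longrightarrow> x \<otimes> y \<in> W"
    "\<And>g x. g \<in> carrier E \<Longrightarrow> x \<in> W \<Longrightarrow> \<rho> g x \<in> W"
  shows "srep W"
  using assms by (auto simp: srep_def intro!: Q.finite_subgroupI)

lemma srep_trivial: "srep {\<one>}"
  by (rule srepI) auto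

lemma srep_Int: "srep U \<Longrightarrow> srep W \<Longrightarrow> srep (U \<inter> W)"
  by (rule srepI) (auto dest: srepD)

lemma simpleD:
  assumes "simple W"
  shows "srep W" "W \<noteq> {\<one>}" "srep U \<Longrightarrow> U \<subseteq> W \<Longrightarrow> U \<noteq> {\<one>} \<Longrightarrow> U = W"
  using assms by (auto simp: simple_def)

text \<open>Goursat: \<open>R\<close> is an \<open>E\<close>-stable subgroup, so its two projections
  and its kernel \<open>Kr\<close> are subrepresentations. Simplicity makes the projections onto and
  \<open>Kr\<close> trivial; with \<open>sv\<close> it follows that \<open>R\<close> is the graph of
  an isomorphism.\<close>

lemma simple_goursat:
  assumes W: "simple W" and W': "simple W'" and R: "R \<subseteq> W \<times> W'"
    and mult: "\<And>x y x' y'. (x, y) \<in> R \<Longrightarrow> (x', y') \<in> R \<Longrightarrow> (x \<otimes> x', y \<otimes> y') \<in> R"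
    and act: "\<And>g x y. g \<in> carrier E \<Longrightarrow> (x, y) \<in> R \<Longrightarrow> (\<rho> g x, \<rho> g y) \<in> R"
    and nz: "(x0, y0) \<in> R" "y0 \<noteq> \<one>"
    and sv: "\<And>y. (\<one>, y) \<in> R \<Longrightarrow> y = \<one>"
  shows "isom W W'"
proof -
  note sW = simpleD(1)[OF W] and sW' = simpleD(1)[OF W']
  have C: "x \<in> carrier Q" "y \<in> carrier Q" "x \<in> W" "y \<in> W'" if "(x, y) \<in> R" for x y
    using that R srepD(2)[OF sW] srepD(2)[OF sW'] by auto
  interpret QQ: group "Q \<times>\<times> Q" by (rule DirProd_group) unfold_locales
  have R': "subgroup R (Q \<times>\<times> Q)"
    by (rule QQ.finite_subgroupI) (use C mult nz in auto)
  have one: "(\<one>, \<one>) \<in> R"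
    using subgroup.one_closed[OF R'] by simp
  have inv: "(inv x, inv y) \<in> R" if "(x, y) \<in> R" for x y
    using subgroup.m_inv_closed[OF R' that] C[OF that] inv_DirProd[OF Q.is_group Q.is_group] by simp
  have x0: "x0 \<noteq> \<one>" using nz sv by blast
  have "srep (Domain R)"
  proof (rule srepI)
    show "Domain R \<subseteq> carrier Q" using C by (auto elim: DomainE)
    show "Domain R \<noteq> {}" using nz(1) by auto
    show "x \<otimes> y \<in> Domain R" if "x \<in> Domain R" "y \<in> Domain R" for x y
      using that by (elim DomainE) (rule DomainI, rule mult)
    show "\<rho> g x \<in> Domain R" if "g \<in> carrier E" "x \<in> Domain R" for g x
      using that by (elim DomainE) (rule DomainI, rule act)
  qed
  then have dom: "Domain R = W"
    by (rule simpleD(3)[OF W]) (use R nz x0 in auto)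
  have "srep (Range R)"
  proof (rule srepI)
    show "Range R \<subseteq> carrier Q" using C by (auto elim: RangeE)
    show "Range R \<noteq> {}" using nz(1) by auto
    show "x \<otimes> y \<in> Range R" if "x \<in> Range R" "y \<in> Range R" for x y
      using that by (elim RangeE) (rule RangeI, rule mult)
    show "\<rho> g x \<in> Range R" if "g \<in> carrier E" "x \<in> Range R" for g x
      using that by (elim RangeE) (rule RangeI, rule act)
  qed
  then have ran: "Range R = W'"
    by (rule simpleD(3)[OF W']) (use R nz in auto)
  define Kr where "Kr = {x. (x, \<one>) \<in> R}"
  have "srep Kr"
  proof (rule srepI)
    show "Kr \<subseteq> carrier Q" "Kr \<noteq> {}" using C one by (auto simp: Kr_def)
    show "x \<otimes> y \<in> Kr" if "x \<in> Kr" "y \<in> Kr" for x y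
      using mult[of x "\<one>" y "\<one>"] that by (simp add: Kr_def)
    show "\<rho> g x \<in> Kr" if "g \<in> carrier E" "x \<in> Kr" for g x
      using act[of g x "\<one>"] that by (simp add: Kr_def)
  qed
  moreover have "Kr \<subseteq> W" using C by (auto simp: Kr_def)
  moreover have diff: "y = y'" if h: "(x, y) \<in> R" "(x, y') \<in> R" for x y y'
  proof -
    have "(x \<otimes> inv x, y \<otimes> inv y') \<in> R" using mult[OF h(1) inv[OF h(2)]] .
    then have "y \<otimes> inv y' = \<one>" using sv C[OF h(1)] by simp
    then show ?thesis by (rule Q.eq_if_mult_inv_one[OF C(2)[OF h(1)] C(2)[OF h(2)]])
  qed
  moreover have "x0 \<notin> Kr" using diff[OF nz(1)] nz(2) by (auto simp: Kr_def)
  ultimately have Kr: "Kr = {\<one>}"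
    using simpleD(3)[OF W] C(3)[OF nz(1)] by blast
  define f where "f x = (THE y. (x, y) \<in> R)" for x
  have f: "f x = y" if "(x, y) \<in> R" for x y
    unfolding f_def using that diff by blast
  have fR: "(x, f x) \<in> R" if "x \<in> W" for x
    using that f dom by blast
  show ?thesis
    unfolding isom_def
  proof (intro exI[of _ f] conjI ballI)
    show "bij_betw f W W'"
    proof (rule bij_betwI')
      fix x y assume xy: "x \<in> W" "y \<in> W"
      have "x = y" if e: "f x = f y"
      proof -
        have "(x \<otimes> inv y, f x \<otimes> inv (f y)) \<in> R"
          using mult[OF fR[OF xy(1)] inv[OF fR[OF xy(2)]]] .
        then have "x \<otimes> inv y \<in> Kr" using e C[OF fR[OF xy(2)]] by (simp add: Kr_def)
        then have "x \<otimes> inv y = \<one>" using Kr by simp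
        then show "x = y" by (rule Q.eq_if_mult_inv_one[OF srepD(2)[OF sW xy(1)] srepD(2)[OF sW xy(2)]])
      qed
      then show "f x = f y \<longleftrightarrow> x = y" by blast
    next
      show "f x \<in> W'" if "x \<in> W" for x using C(4)[OF fR[OF that]] .
      fix y assume "y \<in> W'"
      then obtain x where "(x, y) \<in> R" using ran by blast
      then show "\<exists>x\<in>W. y = f x" using f C(3) by blast
    qed
    fix x y assume "x \<in> W" "y \<in> W"
    then show "f (x \<otimes> y) = f x \<otimes> f y" using mult[OF fR fR] f by blast
  next
    fix g x assume "g \<in> carrier E" "x \<in> W"
    then show "f (\<rho> g x) = \<rho> g (f x)" using act[OF _ fR] f by blast
  qed
qed

lemma rho_finprod:
  assumes "g \<in> carrier E" "c \<in> S \<rightarrow> carrier Q"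
  shows "\<rho> g (finprod Q c S) = finprod Q (\<lambda>W. \<rho> g (c W)) S"
  using assms(2)
proof (induction S rule: infinite_finite_induct)
  case (insert x F)
  then have "c \<in> F \<rightarrow> carrier Q" "c x \<in> carrier Q" "(\<lambda>W. \<rho> g (c W)) \<in> F \<rightarrow> carrier Q"
    using assms(1) by auto
  then show ?case using insert assms(1) by (simp add: rho_mult)
qed (use assms(1) in simp_all)

lemma finprod_inv:
  assumes "c \<in> S \<rightarrow> carrier Q"
  shows "inv (finprod Q c S) = finprod Q (\<lambda>W. inv (c W)) S"
  using assms
proof (induction S rule: infinite_finite_induct)
  case (insert x F)
  then have "c \<in> F \<rightarrow> carrier Q" "c x \<in> carrier Q" "(\<lambda>W. inv (c W)) \<in> F \<rightarrow> carrier Q"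
    by auto
  then show ?case using insert by (simp add: Q.inv_mult)
qed simp_all

lemma finprod_single:
  assumes "finite S" "W \<in> S" "c W \<in> carrier Q" "\<And>W'. W' \<in> S - {W} \<Longrightarrow> c W' = \<one>"
  shows "finprod Q c S = c W"
proof -
  have "c \<in> S \<rightarrow> carrier Q" using assms(3,4) by (metis DiffI Pi_I Q.one_closed singletonD)
  then have "finprod Q c S = finprod Q c {W}"
    by (intro Q.finprod_mono_neutral_cong_right) (use assms in auto)
  then show ?thesis using assms(3) by (simp add: Q.finprod_insert)
qed

text \<open>Among the families with product in \<open>U\<close> and non-trivial entry at
  \<open>W\<close>, take one of least support. If it had another entry, at \<open>W'\<close>, the
  pairs of entries at \<open>W'\<close> and \<open>W\<close> of families supported there would
  satisfy \<open>simple_goursat\<close>; minimality is exactly its premise \<open>sv\<close>.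
  Applied to \<open>U = {\<one>}\<close> the lemma yields directness of sums.\<close>

lemma minimal_support:
  assumes fin: "finite \<S>" and simp: "\<And>W. W \<in> \<S> \<Longrightarrow> simple W"
    and noniso: "\<And>W W'. W \<in> \<S> \<Longrightarrow> W' \<in> \<S> \<Longrightarrow> W \<noteq> W' \<Longrightarrow> \<not> isom W W'"
    and U: "srep U" and c0: "\<And>W. W \<in> \<S> \<Longrightarrow> c0 W \<in> W" "finprod Q c0 \<S> \<in> U"
    and W: "W \<in> \<S>" "c0 W \<noteq> \<one>"
  shows "W \<subseteq> U"
proof -
  define C where "C = {c. (\<forall>W\<in>\<S>. c W \<in> W) \<and> finprod Q c \<S> \<in> U}"
  define supp where "supp c = {W\<in>\<S>. c W \<noteq> \<one>}" for c :: "'v set \<Rightarrow> 'v"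
  have Sc: "x \<in> carrier Q" if "W \<in> \<S>" "x \<in> W" for W x using that srepD(2) simpleD(1)[OF simp] by blast
  have CP: "c \<in> \<S> \<rightarrow> carrier Q" if "c \<in> C" for c using that Sc by (auto simp: C_def)
  have Cmult: "(\<lambda>W. c W \<otimes> c' W) \<in> C" if "c \<in> C" "c' \<in> C" for c c'
    using that CP[OF that(1)] CP[OF that(2)] srepD(4)[OF U] srepD(4)[OF simpleD(1)[OF simp]]
    by (auto simp: C_def)
  have Cact: "(\<lambda>W. \<rho> g (c W)) \<in> C" if "c \<in> C" "g \<in> carrier E" for c g
    using that rho_finprod[OF that(2) CP[OF that(1)]] srepD(6)[OF U that(2), of "finprod Q c \<S>"]
      srepD(6)[OF simpleD(1)[OF simp]] by (auto simp: C_def)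
  have "c0 \<in> C \<and> c0 W \<noteq> \<one>" using c0 W by (auto simp: C_def)
  then obtain c where c: "c \<in> C" "c W \<noteq> \<one>"
    and min: "\<And>c'. c' \<in> C \<Longrightarrow> c' W \<noteq> \<one> \<Longrightarrow> card (supp c) \<le> card (supp c')"
    using ex_has_least_nat[of "\<lambda>c. c \<in> C \<and> c W \<noteq> \<one>" c0 "\<lambda>c. card (supp c)"] by blast
  have "c W' = \<one>" if W': "W' \<in> \<S> - {W}" for W'
  proof (rule ccontr)
    assume nz: "c W' \<noteq> \<one>"
    define R where "R = {(x W', x W) | x. x \<in> C \<and> supp x \<subseteq> supp c}"
    have RI: "(x W', x W) \<in> R" if "x \<in> C" "supp x \<subseteq> supp c" for x using that by (auto simp: R_def)
    have "isom W' W"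
    proof (rule simple_goursat)
      show "simple W'" "simple W" using simp W W' by auto
      show "R \<subseteq> W' \<times> W" using W W' by (auto simp: R_def C_def)
      show "(c W', c W) \<in> R" using c by (auto simp: R_def)
      show "c W \<noteq> \<one>" using c by simp
    next
      fix x y x' y' assume "(x, y) \<in> R" "(x', y') \<in> R"
      then obtain a b where ab: "a \<in> C" "supp a \<subseteq> supp c" "x = a W'" "y = a W" "b \<in> C" "supp b \<subseteq> supp c"
        "x' = b W'" "y' = b W" by (auto simp: R_def)
      have "supp (\<lambda>W. a W \<otimes> b W) \<subseteq> supp c" using ab(2,6) unfolding supp_def by force
      then show "(x \<otimes> x', y \<otimes> y') \<in> R" using RI[OF Cmult[OF ab(1,5)]] ab(3,4,7,8) by simp
    next
      fix g x y assume g: "g \<in> carrier E" and "(x, y) \<in> R"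
      then obtain a where a: "a \<in> C" "supp a \<subseteq> supp c" "x = a W'" "y = a W" by (auto simp: R_def)
      have "supp (\<lambda>W. \<rho> g (a W)) \<subseteq> supp c" using g a(2) unfolding supp_def by force
      then show "(\<rho> g x, \<rho> g y) \<in> R" using RI[OF Cact[OF a(1) g]] a(3,4) by simp
    next
      fix y assume "(\<one>, y) \<in> R"
      then obtain a where a: "a \<in> C" "supp a \<subseteq> supp c" "a W' = \<one>" "y = a W" by (auto simp: R_def)
      show "y = \<one>"
      proof (rule ccontr)
        assume "y \<noteq> \<one>"
        then have "card (supp c) \<le> card (supp a)" using min a by blast
        moreover have "W' \<in> supp c" "W' \<notin> supp a" using a(3) nz W' by (simp_all add: supp_def)
        then have "supp a \<subset> supp c" using a(2) by blast
        then have "card (supp a) < card (supp c)"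
          using fin by (intro psubset_card_mono) (simp_all add: supp_def)
        ultimately show False by simp
      qed
    qed
    then show False using noniso W W' by blast
  qed
  then have "finprod Q c \<S> = c W"
    using fin W CP[OF c(1)] by (intro finprod_single) auto
  then have "c W \<in> U \<inter> W" using c W by (auto simp: C_def)
  then have "U \<inter> W \<noteq> {\<one>}" using c by auto
  then have "U \<inter> W = W"
    using srep_Int[OF U simpleD(1)[OF simp[OF W(1)]]] simpleD(3)[OF simp[OF W(1)], of "U \<inter> W"] by auto
  then show ?thesis by blast
qed

lemma finprod_in_srep:
  assumes "srep U" "c \<in> S \<rightarrow> U"
  shows "finprod Q c S \<in> U"
  using assms(2)
proof (induction S rule: infinite_finite_induct)
  case (insert x F)
  then have "c \<in> F \<rightarrow> carrier Q" "c x \<in> carrier Q" using srepD(2)[OF assms(1)] by auto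
  then show ?case using insert srepD(4)[OF assms(1)] by auto
qed (use srepD(3)[OF assms(1)] in auto)

text \<open>A product of one non-trivial element from each summand generates, since by
  \<open>minimal_support\<close> a submodule containing it contains every summand.\<close>

lemma mfree_cyclic:
  assumes mfree
  shows "\<exists>w\<in>carrier Q. \<forall>U. srep U \<and> w \<in> U \<longrightarrow> U = carrier Q"
proof -
  obtain \<S> where h: "finite \<S>" "\<forall>W\<in>\<S>. simple W"
      "\<forall>W\<in>\<S>. \<forall>W'\<in>\<S>. W \<noteq> W' \<longrightarrow> \<not> isom W W'"
      "\<forall>v\<in>carrier Q. \<exists>!c. c \<in> (\<Pi>\<^sub>E W\<in>\<S>. W) \<and> v = finprod Q c \<S>"
    using assms unfolding mfree_def by (elim exE conjE) (rule that; assumption)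
  note S = h(1) h(2)[rule_format] h(3)[rule_format] and sum = h(4)[rule_format]
  have "\<exists>x\<in>W. x \<noteq> \<one>" if "W \<in> \<S>" for W
    using simpleD(1,2)[OF S(2)[OF that]] srepD(3) by blast
  then obtain c0 where c0: "\<And>W. W \<in> \<S> \<Longrightarrow> c0 W \<in> W" "\<And>W. W \<in> \<S> \<Longrightarrow> c0 W \<noteq> \<one>" by metis
  have "c0 \<in> \<S> \<rightarrow> carrier Q" using c0(1) srepD(2)[OF simpleD(1)[OF S(2)]] by blast
  moreover have "U = carrier Q" if U: "srep U" "finprod Q c0 \<S> \<in> U" for U
  proof
    show "U \<subseteq> carrier Q" using srepD(1)[OF U(1)] .
    have WU: "W \<subseteq> U" if W: "W \<in> \<S>" for W
      using minimal_support[OF S U(1) c0(1) U(2) W c0(2)[OF W]] by blast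
    show "carrier Q \<subseteq> U"
    proof
      fix v assume "v \<in> carrier Q"
      then obtain c where c: "c \<in> (\<Pi>\<^sub>E W\<in>\<S>. W)" "v = finprod Q c \<S>" using ex1_implies_ex[OF sum] by blast
      then show "v \<in> U" using WU by (auto intro!: finprod_in_srep[OF U(1)])
    qed
  qed
  ultimately show ?thesis by (intro bexI[of _ "finprod Q c0 \<S>"]) auto
qed

text \<open>Maschke: a projection of groups is averaged over \<open>E\<close>. Division by
  \<open>|E|\<close> is the power \<open>k\<close>, an inverse of \<open>|E|\<close> modulo
  \<open>p\<close>.\<close>

lemma maschke_projection:
  assumes U: "srep U"
  obtains f where "\<And>x. x \<in> carrier Q \<Longrightarrow> f x \<in> U" "\<And>u. u \<in> U \<Longrightarrow> f u = u"
    "\<And>x y. x \<in> carrier Q \<Longrightarrow> y \<in> carrier Q \<Longrightarrow> f (x \<otimes> y) = f x \<otimes> f y"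
    "\<And>g x. g \<in> carrier E \<Longrightarrow> x \<in> carrier Q \<Longrightarrow> f (\<rho> g x) = \<rho> g (f x)"
proof -
  have "subgroup U Q" using U by (simp add: srep_def)
  then obtain f0 where f0: "\<And>x. x \<in> carrier Q \<Longrightarrow> f0 x \<in> U" "\<And>u. u \<in> U \<Longrightarrow> f0 u = u"
    "\<And>x y. x \<in> carrier Q \<Longrightarrow> y \<in> carrier Q \<Longrightarrow> f0 (x \<otimes> y) = f0 x \<otimes> f0 y"
    using Q.elementary_projection[OF fin_Q prime_p pow_p] by blast
  obtain k where k: "[Coset.order E * k = 1] (mod p)" using cong_solve_coprime_nat[OF coprime_E] by (metis One_nat_def)
  define h where "h x = finprod Q (\<lambda>g. \<rho> g (f0 (\<rho> (inv\<^bsub>E\<^esub> g) x))) (carrier E)" for x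
  define f where "f x = h x [^] k" for x
  have tU: "\<rho> g (f0 (\<rho> (inv\<^bsub>E\<^esub> g) x)) \<in> U" if "g \<in> carrier E" "x \<in> carrier Q" for g x
    using that f0 srepD(6)[OF U] by auto
  have tQ: "\<rho> g (f0 (\<rho> (inv\<^bsub>E\<^esub> g) x)) \<in> carrier Q" if "g \<in> carrier E" "x \<in> carrier Q" for g x
    using tU[OF that] srepD(2)[OF U] by blast
  have f0Q: "f0 x \<in> carrier Q" if "x \<in> carrier Q" for x using f0(1)[OF that] srepD(2)[OF U] by blast
  have hU: "h x \<in> U" if "x \<in> carrier Q" for x
    unfolding h_def using tU that by (intro finprod_in_srep[OF U]) auto
  have hQ: "h x \<in> carrier Q" if "x \<in> carrier Q" for x using hU[OF that] srepD(2)[OF U] by blast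
  have hm: "h (x \<otimes> y) = h x \<otimes> h y" if xy: "x \<in> carrier Q" "y \<in> carrier Q" for x y
  proof -
    have "h (x \<otimes> y) = finprod Q (\<lambda>g. \<rho> g (f0 (\<rho> (inv\<^bsub>E\<^esub> g) x)) \<otimes> \<rho> g (f0 (\<rho> (inv\<^bsub>E\<^esub> g) y))) (carrier E)"
      unfolding h_def
    proof (rule Q.finprod_cong')
      fix g assume g: "g \<in> carrier E"
      have "f0 (\<rho> (inv\<^bsub>E\<^esub> g) (x \<otimes> y)) = f0 (\<rho> (inv\<^bsub>E\<^esub> g) x) \<otimes> f0 (\<rho> (inv\<^bsub>E\<^esub> g) y)"
        using g xy by (simp add: rho_mult f0(3))
      then show "\<rho> g (f0 (\<rho> (inv\<^bsub>E\<^esub> g) (x \<otimes> y))) =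
          \<rho> g (f0 (\<rho> (inv\<^bsub>E\<^esub> g) x)) \<otimes> \<rho> g (f0 (\<rho> (inv\<^bsub>E\<^esub> g) y))"
        using g xy f0Q by (simp add: rho_mult)
    qed (use tQ xy in auto)
    also have "\<dots> = h x \<otimes> h y"
      unfolding h_def using tQ xy by (intro Q.finprod_multf) auto
    finally show ?thesis .
  qed
  have ha: "h (\<rho> e x) = \<rho> e (h x)" if e: "e \<in> carrier E" and x: "x \<in> carrier Q" for e x
  proof -
    have "\<rho> e (h x) = finprod Q (\<lambda>g. \<rho> e (\<rho> g (f0 (\<rho> (inv\<^bsub>E\<^esub> g) x)))) (carrier E)"
      unfolding h_def using tQ x by (intro rho_finprod[OF e]) auto
    also have "\<dots> = finprod Q (\<lambda>g. \<rho> (e \<otimes>\<^bsub>E\<^esub> g) (f0 (\<rho> (inv\<^bsub>E\<^esub> (e \<otimes>\<^bsub>E\<^esub> g)) (\<rho> e x)))) (carrier E)"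
    proof (rule Q.finprod_cong')
      show "(\<lambda>g. \<rho> (e \<otimes>\<^bsub>E\<^esub> g) (f0 (\<rho> (inv\<^bsub>E\<^esub> (e \<otimes>\<^bsub>E\<^esub> g)) (\<rho> e x)))) \<in> carrier E \<rightarrow> carrier Q"
        using tQ e x by auto
      fix g assume g: "g \<in> carrier E"
      have "\<rho> (inv\<^bsub>E\<^esub> (e \<otimes>\<^bsub>E\<^esub> g)) (\<rho> e x) = \<rho> (inv\<^bsub>E\<^esub> g) x"
        using e g x by (simp add: E.inv_mult_group E.m_assoc flip: rho_comp)
      then show "\<rho> e (\<rho> g (f0 (\<rho> (inv\<^bsub>E\<^esub> g) x))) = \<rho> (e \<otimes>\<^bsub>E\<^esub> g) (f0 (\<rho> (inv\<^bsub>E\<^esub> (e \<otimes>\<^bsub>E\<^esub> g)) (\<rho> e x)))"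
        using e g x f0Q by (simp add: rho_comp)
    qed simp
    also have "\<dots> = finprod Q (\<lambda>g. \<rho> g (f0 (\<rho> (inv\<^bsub>E\<^esub> g) (\<rho> e x)))) ((\<lambda>g. e \<otimes>\<^bsub>E\<^esub> g) ` carrier E)"
      using e x tQ by (intro Q.finprod_reindex[symmetric]) (auto intro: inj_onI)
    also have "(\<lambda>g. e \<otimes>\<^bsub>E\<^esub> g) ` carrier E = carrier E"
      using e by (intro endo_inj_surj) (auto intro: inj_onI)
    finally show ?thesis by (simp add: h_def)
  qed
  show thesis
  proof (rule that[of f])
    fix x assume x: "x \<in> carrier Q"
    show "f x \<in> U" unfolding f_def using hU[OF x] Q.subgroup_pow_closed[OF \<open>subgroup U Q\<close>] by blast
    fix y assume "y \<in> carrier Q"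
    then show "f (x \<otimes> y) = f x \<otimes> f y" using x hQ hm by (simp add: f_def Q.nat_pow_distrib)
  next
    fix g x assume g: "g \<in> carrier E" and x: "x \<in> carrier Q"
    show "f (\<rho> g x) = \<rho> g (f x)"
      using group_hom.hom_nat_pow[OF rho_hom[OF g] hQ[OF x], of k] ha[OF g x] by (simp add: f_def)
  next
    fix u assume u: "u \<in> U"
    then have uQ: "u \<in> carrier Q" using srepD(2)[OF U] by blast
    have "h u = finprod Q (\<lambda>g. u) (carrier E)"
      unfolding h_def using u uQ f0(2) srepD(6)[OF U] by (intro Q.finprod_cong') auto
    also have "\<dots> = u [^] Coset.order E" using uQ by (simp add: Q.finprod_const Coset.order_def)
    finally have "f u = u [^] (Coset.order E * k)" using uQ by (simp add: f_def Q.nat_pow_pow)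
    then show "f u = u" using Q.pow_cong[OF uQ pow_p[OF uQ] k] uQ by simp
  qed
qed

lemma ex_simple:
  assumes U: "srep U" "U \<noteq> {\<one>}"
  shows "\<exists>W. simple W \<and> W \<subseteq> U"
proof -
  let ?M = "{W. srep W \<and> W \<noteq> {\<one>} \<and> W \<subseteq> U}"
  have "finite ?M" by (rule finite_subset[of _ "Pow (carrier Q)"]) (use srepD(1) in auto)
  moreover have "U \<in> ?M" using U by simp
  ultimately obtain W where W: "W \<in> ?M" "\<And>W'. W' \<in> ?M \<Longrightarrow> W' \<subseteq> W \<Longrightarrow> W' = W"
    using finite_has_minimal[of ?M] by (metis (no_types, lifting) empty_iff)
  then show ?thesis by (intro exI[of _ W]) (auto simp: simple_def)
qed

text \<open>If distinct simple submodules were never isomorphic, the set of all of them would be a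
  decomposition: uniqueness is \<open>minimal_support\<close> at the trivial submodule, and a
  Maschke complement of their product \<open>T\<close> would contain yet another simple
  submodule.\<close>

lemma not_mfree_ex_isom:
  assumes "\<not> mfree"
  shows "\<exists>W W'. simple W \<and> simple W' \<and> W \<noteq> W' \<and> isom W W'"
proof (rule ccontr)
  assume noniso: "\<not> ?thesis"
  define \<S> where "\<S> = Collect simple"
  have fin: "finite \<S>"
    by (rule finite_subset[of _ "Pow (carrier Q)"]) (use srepD(1) simpleD(1) in \<open>auto simp: \<S>_def\<close>)
  have sS: "simple W" if "W \<in> \<S>" for W using that by (simp add: \<S>_def)
  have ni: "\<not> isom W W'" if "W \<in> \<S>" "W' \<in> \<S>" "W \<noteq> W'" for W W'
    using that noniso by (auto simp: \<S>_def)
  note sr = simpleD(1)[OF sS]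
  define T where "T = {finprod Q c \<S> | c. \<forall>W\<in>\<S>. c W \<in> W}"
  have cP: "c \<in> \<S> \<rightarrow> carrier Q" if "\<forall>W\<in>\<S>. c W \<in> W" for c using that srepD(2)[OF sr] by blast
  have TI: "finprod Q c \<S> \<in> T" if "\<forall>W\<in>\<S>. c W \<in> W" for c using that by (auto simp: T_def)
  have T: "srep T"
  proof (rule srepI)
    show "T \<subseteq> carrier Q" using cP by (auto simp: T_def)
    have "finprod Q (\<lambda>W. \<one>) \<S> \<in> T" using srepD(3)[OF sr] by (intro TI) blast
    then show "T \<noteq> {}" by blast
  next
    fix x y assume "x \<in> T" "y \<in> T"
    then obtain c d where c: "\<forall>W\<in>\<S>. c W \<in> W" "x = finprod Q c \<S>" and d: "\<forall>W\<in>\<S>. d W \<in> W" "y = finprod Q d \<S>"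
      by (auto simp: T_def)
    have "x \<otimes> y = finprod Q (\<lambda>W. c W \<otimes> d W) \<S>" using c d cP by simp
    moreover have "\<forall>W\<in>\<S>. c W \<otimes> d W \<in> W" using c d srepD(4)[OF sr] by blast
    ultimately show "x \<otimes> y \<in> T" by (simp only: TI)
  next
    fix g x assume g: "g \<in> carrier E" and "x \<in> T"
    then obtain c where c: "\<forall>W\<in>\<S>. c W \<in> W" "x = finprod Q c \<S>" by (auto simp: T_def)
    have "\<rho> g x = finprod Q (\<lambda>W. \<rho> g (c W)) \<S>" using c rho_finprod[OF g cP] by simp
    moreover have "\<forall>W\<in>\<S>. \<rho> g (c W) \<in> W" using c g srepD(6)[OF sr] by blast
    ultimately show "\<rho> g x \<in> T" by (simp only: TI)
  qed
  have WT: "W \<subseteq> T" if W: "W \<in> \<S>" for W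
  proof
    fix w assume w: "w \<in> W"
    let ?c = "\<lambda>W'. if W' = W then w else \<one>"
    have "finprod Q ?c \<S> = w" using finprod_single[OF fin W, of ?c] w srepD(2)[OF sr[OF W]] by simp
    moreover have "\<forall>W'\<in>\<S>. ?c W' \<in> W'" using w srepD(3)[OF sr] by auto
    ultimately show "w \<in> T" using TI[of ?c] by simp
  qed
  obtain f where f: "\<And>x. x \<in> carrier Q \<Longrightarrow> f x \<in> T" "\<And>u. u \<in> T \<Longrightarrow> f u = u"
    "\<And>x y. x \<in> carrier Q \<Longrightarrow> y \<in> carrier Q \<Longrightarrow> f (x \<otimes> y) = f x \<otimes> f y"
    "\<And>g x. g \<in> carrier E \<Longrightarrow> x \<in> carrier Q \<Longrightarrow> f (\<rho> g x) = \<rho> g (f x)"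
    using maschke_projection[OF T] by blast
  have fQ: "f x \<in> carrier Q" if "x \<in> carrier Q" for x using f(1)[OF that] srepD(2)[OF T] by blast
  interpret f: group_hom Q Q f by unfold_locales (use fQ f(3) in \<open>auto simp: hom_def\<close>)
  define Kr where "Kr = {x \<in> carrier Q. f x = \<one>}"
  have Kr: "srep Kr" by (rule srepI) (auto simp: Kr_def f(4))
  have "Kr = {\<one>}"
  proof (rule ccontr)
    assume "Kr \<noteq> {\<one>}"
    then obtain W where W: "simple W" "W \<subseteq> Kr" using ex_simple[OF Kr] by blast
    then have "W \<subseteq> T" using WT by (simp add: \<S>_def)
    then have "x = \<one>" if "x \<in> W" for x
    proof -
      have "x \<in> Kr" "x \<in> T" using that W(2) \<open>W \<subseteq> T\<close> by blast+
      then show ?thesis using f(2)[of x] by (simp add: Kr_def)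
    qed
    then have "W \<subseteq> {\<one>}" by blast
    then show False using simpleD(2)[OF W(1)] srepD(3)[OF simpleD(1)[OF W(1)]] by blast
  qed
  have TQ: "x \<in> T" if x: "x \<in> carrier Q" for x
  proof -
    have "f (x \<otimes> inv (f x)) = \<one>" using x f(2)[OF f(1)[OF x]] fQ[OF x] by simp
    then have "x \<otimes> inv (f x) \<in> Kr" using x fQ[OF x] unfolding Kr_def by simp
    then have "x \<otimes> inv (f x) = \<one>" unfolding \<open>Kr = {\<one>}\<close> by simp
    then have "x = f x" by (rule Q.eq_if_mult_inv_one[OF x fQ[OF x]])
    then show ?thesis using f(1)[OF x] by simp
  qed
  have "mfree"
    unfolding mfree_def
  proof (intro exI[of _ \<S>] conjI ballI impI fin sS ni)
    fix v assume v: "v \<in> carrier Q"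
    have "v \<in> T" using TQ[OF v] .
    then obtain c where c: "\<forall>W\<in>\<S>. c W \<in> W" "v = finprod Q c \<S>" unfolding T_def by blast
    show "\<exists>!c. c \<in> (\<Pi>\<^sub>E W\<in>\<S>. W) \<and> v = finprod Q c \<S>"
    proof (rule ex1I[of _ "restrict c \<S>"])
      have "finprod Q (restrict c \<S>) \<S> = finprod Q c \<S>"
        using cP[OF c(1)] by (intro Q.finprod_cong') auto
      then show "restrict c \<S> \<in> (\<Pi>\<^sub>E W\<in>\<S>. W) \<and> v = finprod Q (restrict c \<S>) \<S>" using c by auto
    next
      fix d assume d: "d \<in> (\<Pi>\<^sub>E W\<in>\<S>. W) \<and> v = finprod Q d \<S>"
      then have dW: "\<forall>W\<in>\<S>. d W \<in> W" by auto
      show "d = restrict c \<S>"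
      proof (rule extensionalityI[of _ \<S>])
        fix W assume W: "W \<in> \<S>"
        show "d W = restrict c \<S> W"
        proof (rule ccontr)
          assume ne: "d W \<noteq> restrict c \<S> W"
          let ?e = "\<lambda>W. d W \<otimes> inv (c W)"
          have "finprod Q ?e \<S> = finprod Q d \<S> \<otimes> finprod Q (\<lambda>W. inv (c W)) \<S>"
            using cP[OF c(1)] cP[OF dW] by (intro Q.finprod_multf) auto
          also have "\<dots> = v \<otimes> inv v" using finprod_inv[OF cP[OF c(1)]] c d by simp
          finally have "finprod Q ?e \<S> \<in> {\<one>}" using v by simp
          moreover have "?e W' \<in> W'" if "W' \<in> \<S>" for W'
            using that c dW srepD(4,5)[OF sr[OF that]] by blast
          moreover have "?e W \<noteq> \<one>"
          proof
            have CQ: "d W \<in> carrier Q" "c W \<in> carrier Q" using cP[OF c(1)] cP[OF dW] W by auto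
            assume "?e W = \<one>"
            then have "d W = c W" by (rule Q.eq_if_mult_inv_one[OF CQ])
            then show False using ne W by simp
          qed
          ultimately have "W \<subseteq> {\<one>}"
            using minimal_support[OF fin sS ni srep_trivial _ _ W, of ?e] by blast
          then show False using simpleD(2)[OF sS[OF W]] srepD(3)[OF sr[OF W]] by blast
        qed
      qed (use d in \<open>auto simp: PiE_def\<close>)
    qed
  qed
  then show False using assms by blast
qed

definition endo :: "('v \<Rightarrow> 'v) \<Rightarrow> bool" where
  "endo h \<longleftrightarrow> (\<forall>x\<in>carrier Q. h x \<in> carrier Q) \<and>
    (\<forall>x\<in>carrier Q. \<forall>y\<in>carrier Q. h (x \<otimes> y) = h x \<otimes> h y) \<and>
    (\<forall>g\<in>carrier E. \<forall>x\<in>carrier Q. h (\<rho> g x) = \<rho> g (h x))"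

text \<open>The elements \<open>e\<close>, \<open>f\<close> of \<open>sl\<^sub>2\<close> acting on two isomorphic summands.\<close>

lemma not_mfree_matrix_units:
  assumes "\<not> mfree"
  shows "\<exists>e f. endo e \<and> endo f \<and> (\<forall>x\<in>carrier Q. e (e x) = \<one>) \<and> (\<forall>x\<in>carrier Q. f (f x) = \<one>) \<and>
    (\<forall>x\<in>carrier Q. e (f (e x)) = e x) \<and> (\<forall>x\<in>carrier Q. f (e (f x)) = f x) \<and> (\<exists>x\<in>carrier Q. e x \<noteq> \<one>)"
proof -
  obtain W W' where W: "simple W" and W': "simple W'" and ne: "W \<noteq> W'" and iso: "isom W W'"
    using not_mfree_ex_isom[OF assms] by blast
  note sW = simpleD(1)[OF W] and sW' = simpleD(1)[OF W']
  note WQ = srepD(2)[OF sW] and WQ' = srepD(2)[OF sW']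
  obtain i where bij: "bij_betw i W W'"
    and im: "\<And>x y. x \<in> W \<Longrightarrow> y \<in> W \<Longrightarrow> i (x \<otimes> y) = i x \<otimes> i y"
    and ia: "\<And>g x. g \<in> carrier E \<Longrightarrow> x \<in> W \<Longrightarrow> i (\<rho> g x) = \<rho> g (i x)"
    using iso unfolding isom_def by blast
  define j where "j = inv_into W i"
  have iW: "i x \<in> W'" if "x \<in> W" for x using bij that by (auto simp: bij_betw_def)
  have jW: "j y \<in> W" "i (j y) = y" if "y \<in> W'" for y
    using bij that unfolding j_def by (auto simp: bij_betw_def inv_into_into f_inv_into_f)
  have ji: "j (i x) = x" if "x \<in> W" for x using bij that by (simp add: j_def bij_betw_def inv_into_f_f)
  have jm: "j (x \<otimes> y) = j x \<otimes> j y" if "x \<in> W'" "y \<in> W'" for x y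
    using ji[of "j x \<otimes> j y"] im[of "j x" "j y"] jW that srepD(4)[OF sW] by simp
  have ja: "j (\<rho> g x) = \<rho> g (j x)" if "g \<in> carrier E" "x \<in> W'" for g x
    using ji[of "\<rho> g (j x)"] ia[of g "j x"] jW that srepD(6)[OF sW] by simp
  have triv: "W \<inter> W' = {\<one>}"
  proof (rule ccontr)
    assume h: "W \<inter> W' \<noteq> {\<one>}"
    have "W \<inter> W' = W" "W \<inter> W' = W'"
      using simpleD(3)[OF W srep_Int[OF sW sW']] simpleD(3)[OF W' srep_Int[OF sW sW']] h by auto
    then show False using ne by simp
  qed
  \<comment> \<open>The maps are constructed on the direct sum \<open>U\<close> of the two summands
    and extended to \<open>Q\<close> by a Maschke projection.\<close>
  define U where "U = {a \<otimes> b | a b. a \<in> W \<and> b \<in> W'}"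
  have UI: "a \<otimes> b \<in> U" if "a \<in> W" "b \<in> W'" for a b using that by (auto simp: U_def)
  have U: "srep U"
  proof (rule srepI)
    show "U \<subseteq> carrier Q" using WQ WQ' by (auto simp: U_def)
    show "U \<noteq> {}" using UI[OF srepD(3)[OF sW] srepD(3)[OF sW']] by blast
  next
    fix x y assume "x \<in> U" "y \<in> U"
    then obtain a b c d where h: "a \<in> W" "b \<in> W'" "x = a \<otimes> b" "c \<in> W" "d \<in> W'" "y = c \<otimes> d"
      by (auto simp: U_def)
    have "x \<otimes> y = (a \<otimes> c) \<otimes> (b \<otimes> d)" using h WQ WQ' by (simp add: Q.m_ac)
    then show "x \<otimes> y \<in> U" using UI[OF srepD(4)[OF sW h(1,4)] srepD(4)[OF sW' h(2,5)]] by simp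
  next
    fix g x assume g: "g \<in> carrier E" and "x \<in> U"
    then obtain a b where h: "a \<in> W" "b \<in> W'" "x = a \<otimes> b" by (auto simp: U_def)
    have "\<rho> g x = \<rho> g a \<otimes> \<rho> g b" using h g WQ WQ' by (simp add: rho_mult)
    then show "\<rho> g x \<in> U" using UI[OF srepD(6)[OF sW g h(1)] srepD(6)[OF sW' g h(2)]] by simp
  qed
  obtain f where f: "\<And>x. x \<in> carrier Q \<Longrightarrow> f x \<in> U" "\<And>u. u \<in> U \<Longrightarrow> f u = u"
    "\<And>x y. x \<in> carrier Q \<Longrightarrow> y \<in> carrier Q \<Longrightarrow> f (x \<otimes> y) = f x \<otimes> f y"
    "\<And>g x. g \<in> carrier E \<Longrightarrow> x \<in> carrier Q \<Longrightarrow> f (\<rho> g x) = \<rho> g (f x)"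
    using maschke_projection[OF U] by blast
  have "\<exists>ab. fst ab \<in> W \<and> snd ab \<in> W' \<and> f x = fst ab \<otimes> snd ab" if "x \<in> carrier Q" for x
    using f(1)[OF that] by (force simp: U_def)
  then obtain ab where ab: "\<And>x. x \<in> carrier Q \<Longrightarrow> fst (ab x) \<in> W \<and> snd (ab x) \<in> W' \<and> f x = fst (ab x) \<otimes> snd (ab x)"
    by metis
  define a where "a x = fst (ab x)" for x
  define b where "b x = snd (ab x)" for x
  have abW: "a x \<in> W" "b x \<in> W'" "f x = a x \<otimes> b x" if "x \<in> carrier Q" for x
    using ab[OF that] by (auto simp: a_def b_def)
  have uniq: "u = u' \<and> w = w'" if h: "u \<in> W" "u' \<in> W" "w \<in> W'" "w' \<in> W'" "u \<otimes> w = u' \<otimes> w'" for u u' w w'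
  proof -
    note hQ = WQ[OF h(1)] WQ[OF h(2)] WQ'[OF h(3)] WQ'[OF h(4)]
    have "inv u' \<otimes> u = (inv u' \<otimes> (u \<otimes> w)) \<otimes> inv w" using hQ by (simp add: Q.m_assoc)
    also have "\<dots> = w' \<otimes> inv w" unfolding h(5) using hQ by (simp flip: Q.m_assoc)
    finally have eq: "inv u' \<otimes> u = w' \<otimes> inv w" .
    have "inv u' \<otimes> u \<in> W" using h srepD(4,5)[OF sW] by blast
    moreover have "inv u' \<otimes> u \<in> W'" unfolding eq using h srepD(4,5)[OF sW'] by blast
    ultimately have "inv u' \<otimes> u = \<one>" using triv by blast
    then have "u = u'" by (rule Q.eq_if_inv_mult_one[OF hQ(1,2)])
    then show ?thesis using h(5) hQ by simp
  qed
  have abI: "a x = u \<and> b x = w" if "x \<in> carrier Q" "u \<in> W" "w \<in> W'" "f x = u \<otimes> w" for x u w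
    using uniq[OF abW(1)[OF that(1)] that(2) abW(2)[OF that(1)] that(3)] abW(3)[OF that(1)] that(4) by simp
  have abm: "a (x \<otimes> y) = a x \<otimes> a y \<and> b (x \<otimes> y) = b x \<otimes> b y"
    if xy: "x \<in> carrier Q" "y \<in> carrier Q" for x y
    using xy f(3)[OF xy] abW[OF xy(1)] abW[OF xy(2)] WQ WQ' srepD(4)[OF sW] srepD(4)[OF sW']
    by (intro abI) (auto simp: Q.m_ac)
  have aba: "a (\<rho> g x) = \<rho> g (a x) \<and> b (\<rho> g x) = \<rho> g (b x)" if gx: "g \<in> carrier E" "x \<in> carrier Q" for g x
    using gx f(4)[OF gx] abW[OF gx(2)] WQ WQ' srepD(6)[OF sW gx(1)] srepD(6)[OF sW' gx(1)]
    by (intro abI) (auto simp: rho_mult)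
  have abS: "a u = u \<and> b u = \<one>" if "u \<in> W" for u
    using that f(2)[of u] UI[OF that srepD(3)[OF sW']] WQ srepD(3)[OF sW'] by (intro abI) auto
  have abS': "a w = \<one> \<and> b w = w" if "w \<in> W'" for w
    using that f(2)[of w] UI[OF srepD(3)[OF sW] that] WQ' srepD(3)[OF sW] by (intro abI) auto
  have i1: "i \<one> = \<one>"
  proof -
    have "i \<one> = i \<one> \<otimes> i \<one>" using im[OF srepD(3)[OF sW] srepD(3)[OF sW]] by simp
    then show ?thesis using WQ'[OF iW[OF srepD(3)[OF sW]]] by (metis Q.r_cancel_one')
  qed
  have j1: "j \<one> = \<one>" using ji[OF srepD(3)[OF sW]] i1 by simp
  obtain w where w: "w \<in> W" "w \<noteq> \<one>" using simpleD(2)[OF W] srepD(3)[OF sW] by blast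
  \<comment> \<open>\<open>e\<close> is the projection to \<open>W\<close> followed by the
    isomorphism \<open>i\<close>, and \<open>f\<close> the projection to \<open>W'\<close> followed
    by its inverse \<open>j\<close>.\<close>
  have "endo (\<lambda>x. i (a x))" "endo (\<lambda>x. j (b x))"
    unfolding endo_def using abm aba abW im jm ia ja iW jW WQ WQ' by auto
  moreover have "i w \<noteq> \<one>" using ji[OF w(1)] j1 w(2) by auto
  then have "\<exists>x\<in>carrier Q. i (a x) \<noteq> \<one>" using w abS WQ by (intro bexI[of _ w]) auto
  moreover have "\<forall>x\<in>carrier Q. i (a (i (a x))) = \<one>" "\<forall>x\<in>carrier Q. j (b (j (b x))) = \<one>"
    "\<forall>x\<in>carrier Q. i (a (j (b (i (a x))))) = i (a x)" "\<forall>x\<in>carrier Q. j (b (i (a (j (b x))))) = j (b x)"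
    using abW iW jW ji abS abS' i1 j1 by auto
  ultimately show ?thesis
    by - (rule exI[of _ "\<lambda>x. i (a x)"], rule exI[of _ "\<lambda>x. j (b x)"], intro conjI; assumption)
qed

end

section \<open>The Frattini quotient\<close>

context p'_action
begin

lemma sum_Gr_translate:
  fixes h :: "'a \<times> 'b \<Rightarrow> 'k"
  assumes "u \<in> carrier P"
  shows "(\<Sum>x\<in>carrier Gr. (up u \<star> y) x * h x) = (\<Sum>x\<in>carrier Gr. y x * h ((u, \<one>\<^bsub>E\<^esub>) \<otimes>\<^bsub>Gr\<^esub> x))"
proof -
  let ?g = "(u, \<one>\<^bsub>E\<^esub>)"
  have g: "?g \<in> carrier Gr" using assms by simp
  have "(\<Sum>x\<in>carrier Gr. (up u \<star> y) x * h x) =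
      (\<Sum>x\<in>carrier Gr. y (inv\<^bsub>Gr\<^esub> ?g \<otimes>\<^bsub>Gr\<^esub> x) * h (?g \<otimes>\<^bsub>Gr\<^esub> (inv\<^bsub>Gr\<^esub> ?g \<otimes>\<^bsub>Gr\<^esub> x)))"
    unfolding up_def
    by (rule sum.cong[OF refl]) (simp only: conv_sgl_left[OF g] mult_inv_cancel[OF g] if_True)
  also have "\<dots> = (\<Sum>x\<in>carrier Gr. y x * h (?g \<otimes>\<^bsub>Gr\<^esub> x))"
    using sum_left_translate[OF g, of "\<lambda>x. y x * h (?g \<otimes>\<^bsub>Gr\<^esub> x)"] .
  finally show ?thesis .
qed

lemma Jp1_sum: "y \<in> Jp (Suc 0) \<Longrightarrow> (\<Sum>x\<in>carrier Gr. y x) = 0"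
proof (induction y rule: Jp_Suc_induct)
  case (gen u y)
  have "(\<Sum>x\<in>carrier Gr. ((up u - one') \<star> y) x) = (\<Sum>x\<in>carrier Gr. (up u \<star> y) x) - (\<Sum>x\<in>carrier Gr. y x)"
    using gen by (simp add: conv_diff_left minus_apply sum_subtractf)
  then show ?case using sum_Gr_translate[OF gen(1), of y "\<lambda>_. 1"] by simp
qed (simp_all add: pointwise sum.distrib flip: sum_distrib_left)

text \<open>A homomorphism \<open>P \<rightarrow> k\<close> extends linearly to \<open>kG\<close> and then vanishes on the square of the
  radical, because \<open>\<chi>(u v) - \<chi>(u) - \<chi>(v) = 0\<close>.\<close>

lemma Jp2_sum:
  assumes hom: "\<And>u v. u \<in> carrier P \<Longrightarrow> v \<in> carrier P \<Longrightarrow> \<chi> (u \<otimes> v) = \<chi> u + (\<chi> v :: 'k)"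
    and y: "y \<in> Jp (Suc (Suc 0))"
  shows "(\<Sum>x\<in>carrier Gr. y x * \<chi> (fst x)) = 0"
  using y
proof (induction y rule: Jp_Suc_induct)
  case (gen u y)
  have "(\<Sum>x\<in>carrier Gr. ((up u - one') \<star> y) x * \<chi> (fst x)) =
      (\<Sum>x\<in>carrier Gr. (up u \<star> y) x * \<chi> (fst x)) - (\<Sum>x\<in>carrier Gr. y x * \<chi> (fst x))"
    using gen Jp_KG[OF gen(2)] by (simp add: conv_diff_left minus_apply sum_subtractf algebra_simps)
  also have "(\<Sum>x\<in>carrier Gr. (up u \<star> y) x * \<chi> (fst x)) = (\<Sum>x\<in>carrier Gr. y x * (\<chi> u + \<chi> (fst x)))"
    unfolding sum_Gr_translate[OF gen(1), of y "\<lambda>x. \<chi> (fst x)"]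
    using gen(1) by (intro sum.cong refl) (auto simp: hom)
  also have "\<dots> = \<chi> u * (\<Sum>x\<in>carrier Gr. y x) + (\<Sum>x\<in>carrier Gr. y x * \<chi> (fst x))"
    by (simp add: algebra_simps sum.distrib sum_distrib_left)
  finally show ?case using Jp1_sum[OF gen(2)] by simp
qed (simp_all add: pointwise sum.distrib algebra_simps flip: sum_distrib_left)

text \<open>For \<open>u\<close> outside \<open>N\<close>, a projection of \<open>P/N\<close> onto
  the subgroup of order \<open>p\<close> generated by the coset of \<open>u\<close> yields a
  homomorphism \<chi> from \<open>P\<close> to \<open>k\<close> with \<open>\<chi> u = 1\<close>.
  But \<open>Jp2_sum\<close> at \<open>u - 1\<close> forces
  \<open>\<chi> u = \<chi> \<one> = 0\<close>.\<close>

lemma Kp_subset: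
  assumes N: "subgroup N P" and el: "elementary_abelian p (P Mod N)"
  shows "Kp \<subseteq> N"
proof
  fix u assume u: "u \<in> Kp"
  then have uP: "u \<in> carrier P" by (simp add: Kp_def)
  show "u \<in> N"
  proof (rule ccontr)
    assume nu: "u \<notin> N"
    let ?Q = "P Mod N"
    interpret N: normal N P using N by (rule P.subgroup_imp_normal)
    interpret Q: comm_group ?Q using el by (simp add: elementary_abelian_def)
    have finQ: "finite (carrier ?Q)" by (simp add: FactGroup_def RCOSETS_def)
    let ?q = "N #> u"
    have co: "N #> x \<in> carrier ?Q" if "x \<in> carrier P" for x
      using that by (auto simp: FactGroup_def RCOSETS_def)
    have q: "?q \<in> carrier ?Q" using co uP by blast
    have q1: "?q \<noteq> \<one>\<^bsub>?Q\<^esub>" using nu P.coset_join1[OF _ uP N] N.subset by (auto simp: FactGroup_def)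
    have qp: "x [^]\<^bsub>?Q\<^esub> p = \<one>\<^bsub>?Q\<^esub>" if "x \<in> carrier ?Q" for x
      using el that by (simp add: elementary_abelian_def)
    have "Q.ord ?q dvd p" using qp[OF q] Q.pow_eq_id[OF q] by simp
    moreover have "Q.ord ?q \<noteq> 1" using Q.ord_eq_1[OF q] q1 by simp
    ultimately have ord: "Q.ord ?q = p" using prime_p by (metis prime_nat_iff)
    define U where "U = {?q [^]\<^bsub>?Q\<^esub> (k::int) | k. True}"
    have sU: "subgroup U ?Q"
    proof (rule Q.finite_subgroupI[OF finQ])
      show "U \<subseteq> carrier ?Q" "U \<noteq> {}" using q by (auto simp: U_def)
    next
      fix x y assume "x \<in> U" "y \<in> U"
      then obtain k l :: int where "x = ?q [^]\<^bsub>?Q\<^esub> k" "y = ?q [^]\<^bsub>?Q\<^esub> l" by (auto simp: U_def)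
      then have "x \<otimes>\<^bsub>?Q\<^esub> y = ?q [^]\<^bsub>?Q\<^esub> (k + l)" using Q.int_pow_mult[OF q] by simp
      then show "x \<otimes>\<^bsub>?Q\<^esub> y \<in> U" by (auto simp: U_def)
    qed
    have "\<exists>f. (\<forall>x\<in>carrier ?Q. f x \<in> U) \<and> (\<forall>u\<in>U. f u = u) \<and>
        (\<forall>x\<in>carrier ?Q. \<forall>y\<in>carrier ?Q. f (x \<otimes>\<^bsub>?Q\<^esub> y) = f x \<otimes>\<^bsub>?Q\<^esub> f y)"
      by (rule Q.elementary_projection[OF finQ prime_p qp sU])
    then obtain f where ff: "(\<forall>x\<in>carrier ?Q. f x \<in> U) \<and> (\<forall>u\<in>U. f u = u) \<and>
        (\<forall>x\<in>carrier ?Q. \<forall>y\<in>carrier ?Q. f (x \<otimes>\<^bsub>?Q\<^esub> y) = f x \<otimes>\<^bsub>?Q\<^esub> f y)"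
      by (elim exE)
    note f = conjunct1[OF ff, rule_format] conjunct1[OF conjunct2[OF ff], rule_format]
      conjunct2[OF conjunct2[OF ff], rule_format]
    have "\<exists>k::int. f (N #> x) = ?q [^]\<^bsub>?Q\<^esub> k" if "x \<in> carrier P" for x
      using f(1)[OF co[OF that]] by (auto simp: U_def)
    then obtain k :: "'a \<Rightarrow> int" where k: "\<And>x. x \<in> carrier P \<Longrightarrow> f (N #> x) = ?q [^]\<^bsub>?Q\<^esub> k x" by metis
    \<comment> \<open>The exponents are determined modulo \<open>p\<close> only; their images in
      \<open>k\<close> are well defined.\<close>
    have eq: "of_int i = (of_int j :: 'k)" if ij: "?q [^]\<^bsub>?Q\<^esub> i = ?q [^]\<^bsub>?Q\<^esub> j" for i j :: int
    proof -
      have "int p dvd j - i" using ij Q.int_pow_eq[OF q] ord by simp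
      then obtain t where "j - i = int p * t" by blast
      then have "of_int j - of_int i = (of_nat p * of_int t :: 'k)"
        by (metis of_int_diff of_int_mult of_int_of_nat_eq)
      then show ?thesis using char_k of_nat_eq_0_iff_char_dvd[where 'a = 'k, of p] by simp
    qed
    define \<chi> where "\<chi> x = (of_int (k x) :: 'k)" for x
    have hom: "\<chi> (x \<otimes> y) = \<chi> x + \<chi> y" if xy: "x \<in> carrier P" "y \<in> carrier P" for x y
    proof -
      have "?q [^]\<^bsub>?Q\<^esub> k (x \<otimes> y) = f ((N #> x) \<otimes>\<^bsub>?Q\<^esub> (N #> y))"
        using k[of "x \<otimes> y"] xy N.rcos_sum[OF xy] by (simp add: FactGroup_def)
      also have "\<dots> = ?q [^]\<^bsub>?Q\<^esub> (k x + k y)"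
        using f(3)[OF co[OF xy(1)] co[OF xy(2)]] k xy Q.int_pow_mult[OF q] by simp
      finally have "of_int (k (x \<otimes> y)) = (of_int (k x + k y) :: 'k)" by (rule eq)
      then show ?thesis by (simp add: \<chi>_def)
    qed
    have "?q \<in> U" using q unfolding U_def by (auto intro!: exI[of _ 1])
    then have "?q [^]\<^bsub>?Q\<^esub> k u = ?q [^]\<^bsub>?Q\<^esub> (1::int)" using f(2)[of ?q] k[OF uP] q by simp
    then have "of_int (k u) = (of_int 1 :: 'k)" by (rule eq)
    then have aug_prod_u: "\<chi> u = 1" by (simp add: \<chi>_def)
    have aug_prod_1: "\<chi> \<one> = 0" using hom[of "\<one>" "\<one>"] by (simp only: P.one_closed P.l_one add_cancel_right_right)
    have sum: "(\<Sum>x\<in>carrier Gr. up v x * \<chi> (fst x)) = \<chi> v" if v: "v \<in> carrier P" for v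
    proof -
      have "(\<Sum>x\<in>carrier Gr. up v x * \<chi> (fst x)) = (\<Sum>x\<in>carrier Gr. if x = (v, \<one>\<^bsub>E\<^esub>) then \<chi> v else 0)"
        by (rule sum.cong) (auto simp: up_def sgl_apply)
      also have "\<dots> = \<chi> v" using v by (subst sum.delta) auto
      finally show ?thesis .
    qed
    have "up u - one' \<in> Jp (Suc (Suc 0))" using u by (simp add: Kp_def numeral_2_eq_2)
    from Jp2_sum[OF hom this] have "\<chi> u - \<chi> \<one> = 0"
      using sum[OF uP] sum[OF P.one_closed] by (simp add: minus_apply left_diff_distrib sum_subtractf up_one)
    then show False using aug_prod_u aug_prod_1 by simp
  qed
qed

lemma frattini_eq_Kp: "frattini p P = Kp"
proof
  show "frattini p P \<subseteq> Kp" by (rule frattini_subset_Kp)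
  have "Kp \<subseteq> N" if "N \<lhd> P" "elementary_abelian p (P Mod N)" for N
    using Kp_subset[of N] that by (simp add: normal_imp_subgroup)
  then show "Kp \<subseteq> frattini p P" unfolding frattini_def by blast
qed

section \<open>\<open>P/\<Phi>(P)\<close> as a representation, and the translation of the module
  notions\<close>

definition QP :: "'a set monoid" where "QP = P Mod Kp"

lemma Kp_normal: "Kp \<lhd> P"
  using P.subgroup_imp_normal[OF Kp_subgroup] .

lemma QP_carrier: "carrier QP = (\<lambda>u. Kp #> u) ` carrier P"
  by (auto simp: QP_def FactGroup_def RCOSETS_def)

lemma QP_one: "\<one>\<^bsub>QP\<^esub> = Kp"
  by (simp add: QP_def FactGroup_def)

lemma QP_mult: "u \<in> carrier P \<Longrightarrow> v \<in> carrier P \<Longrightarrow>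
    (Kp #> u) \<otimes>\<^bsub>QP\<^esub> (Kp #> v) = Kp #> (u \<otimes> v)"
  using normal.rcos_sum[OF Kp_normal] by (simp add: QP_def FactGroup_def)

lemma coset_Kp_eq: "u \<in> carrier P \<Longrightarrow> v \<in> carrier P \<Longrightarrow>
    Kp #> u = Kp #> v \<longleftrightarrow> u \<otimes> inv v \<in> Kp"
  using P.coset_mult_inv1 P.coset_mult_inv2 P.coset_join1 P.coset_join2 subgroup.subset[OF Kp_subgroup] Kp_subgroup
  by (smt (verit, ccfv_threshold) P.inv_closed P.m_closed)

lemma coset_Kp_one: "u \<in> carrier P \<Longrightarrow> Kp #> u = \<one>\<^bsub>QP\<^esub> \<longleftrightarrow> u \<in> Kp"
  using P.coset_join1[of Kp u] P.coset_join2[of u Kp] subgroup.subset[OF Kp_subgroup] Kp_subgroup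
  by (auto simp: QP_one)

lemma induced_coset:
  assumes e: "e \<in> carrier E" and u: "u \<in> carrier P"
  shows "induced_action \<phi> e (Kp #> u) = Kp #> \<phi> e u"
proof
  have KP: "Kp \<subseteq> carrier P" using subgroup.subset[OF Kp_subgroup] .
  show "induced_action \<phi> e (Kp #> u) \<subseteq> Kp #> \<phi> e u"
    using e u Kp_stable[OF e] KP by (auto simp: induced_action_def r_coset_def phi_mult subset_iff)
  show "Kp #> \<phi> e u \<subseteq> induced_action \<phi> e (Kp #> u)"
  proof
    fix x assume "x \<in> Kp #> \<phi> e u"
    then obtain h where h: "h \<in> Kp" "x = h \<otimes> \<phi> e u" by (auto simp: r_coset_def)
    then have "x = \<phi> e (\<phi> (inv\<^bsub>E\<^esub> e) h \<otimes> u)" using KP e u by (auto simp: phi_mult subset_iff)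
    moreover have "\<phi> (inv\<^bsub>E\<^esub> e) h \<in> Kp" using h e Kp_stable by simp
    ultimately show "x \<in> induced_action \<phi> e (Kp #> u)"
      unfolding induced_action_def r_coset_def by blast
  qed
qed

lemma fin_rep_QP: "fin_rep QP E (induced_action \<phi>) p"
proof -
  interpret Q: comm_group QP
    unfolding QP_def by (rule P.abelian_FactGroup[OF Kp_subgroup])
  show ?thesis
  proof (intro fin_rep.intro fin_rep_axioms.intro)
    show "comm_group QP" "group E" by unfold_locales
    show "finite (carrier QP)" by (simp add: QP_carrier)
    fix x assume "x \<in> carrier QP"
    then obtain u where u: "u \<in> carrier P" "x = Kp #> u" by (auto simp: QP_carrier)
    then show "x [^]\<^bsub>QP\<^esub> p = \<one>\<^bsub>QP\<^esub>"
      using Mod_pow[OF Kp_subgroup u(1), of p, folded QP_def] pow_p_Kp[OF u(1)]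
        coset_Kp_one[of "u [^] p"] by simp
  qed (use prime_p coprime_E in \<open>auto simp: QP_carrier induced_coset QP_mult phi_mult phi_comp\<close>)
qed

end

sublocale p'_action \<subseteq> FR: fin_rep QP E "induced_action \<phi>" p
  by (rule fin_rep_QP)

context p'_action
begin

abbreviation FQ :: "(int, 'a set) module" where "FQ \<equiv> frattini_quotient p P"

lemma FQ_simps:
  "carrier FQ = carrier QP" "\<zero>\<^bsub>FQ\<^esub> = \<one>\<^bsub>QP\<^esub>" "x \<oplus>\<^bsub>FQ\<^esub> y = x \<otimes>\<^bsub>QP\<^esub> y" "c \<odot>\<^bsub>FQ\<^esub> x = x [^]\<^bsub>QP\<^esub> c"
  by (simp_all add: frattini_quotient_def frattini_eq_Kp QP_def Let_def)

lemma FQ_subgroup: "subgroup W (add_monoid FQ) \<longleftrightarrow> subgroup W QP"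
  by (simp add: subgroup_def m_inv_def FQ_simps)

lemma FQ_finsum: "finsum FQ c S = finprod QP c S"
proof -
  have "(\<oplus>\<^bsub>FQ\<^esub>) = (\<otimes>\<^bsub>QP\<^esub>)" by (intro ext) (simp add: FQ_simps)
  then show ?thesis by (simp add: finsum_def finprod_def FQ_simps)
qed

lemma residue_carrier: "c \<in> carrier (residue_ring (int p)) \<Longrightarrow> \<exists>n::nat. c = int n"
  by (auto simp: residue_ring_def intro: nonneg_int_cases)

lemma subrep_iff_srep: "subrep (residue_ring (int p)) E FQ (induced_action \<phi>) W \<longleftrightarrow> FR.srep W"
proof -
  have "x [^]\<^bsub>QP\<^esub> c \<in> W" if "subgroup W QP" "c \<in> carrier (residue_ring (int p))" "x \<in> W" for c x
    using residue_carrier[OF that(2)] FR.Q.subgroup_pow_closed[OF that(1,3)] by (auto simp: int_pow_int)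
  then show ?thesis
    unfolding subrep_def FR.srep_def submodule_def submodule_axioms_def FQ_subgroup
    by (auto simp: FQ_simps(4))
qed

lemma simple_subrep_iff: "simple_subrep (residue_ring (int p)) E FQ (induced_action \<phi>) W \<longleftrightarrow> FR.simple W"
  by (simp add: simple_subrep_def FR.simple_def subrep_iff_srep FQ_simps)

text \<open>Residues are natural numbers and a homomorphism commutes with natural powers, so
  linearity over \<open>F_p\<close> comes for free.\<close>

lemma isomorphic_iff:
  assumes W: "FR.srep W" and W': "FR.srep W'"
  shows "isomorphic_subreps (residue_ring (int p)) E FQ (induced_action \<phi>) W W' \<longleftrightarrow> FR.isom W W'"
proof -
  have pow: "f (x [^]\<^bsub>QP\<^esub> c) = f x [^]\<^bsub>QP\<^esub> c"
    if f: "bij_betw f W W'" "\<forall>x\<in>W. \<forall>y\<in>W. f (x \<otimes>\<^bsub>QP\<^esub> y) = f x \<otimes>\<^bsub>QP\<^esub> f y"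
      and c: "c \<in> carrier (residue_ring (int p))" and x: "x \<in> W" for f c x
  proof -
    have sW: "subgroup W QP" using W by (simp add: FR.srep_def)
    have fW: "f x \<in> carrier QP" if "x \<in> W" for x
      using f(1) that FR.srepD(2)[OF W'] by (auto simp: bij_betw_def)
    have one: "f \<one>\<^bsub>QP\<^esub> = \<one>\<^bsub>QP\<^esub>"
      using f(2) FR.srepD(3)[OF W] fW by (metis FR.Q.one_closed FR.Q.r_cancel_one' FR.Q.r_one)
    have "f (x [^]\<^bsub>QP\<^esub> n) = f x [^]\<^bsub>QP\<^esub> n" for n :: nat
      by (induction n) (use one f(2) x FR.Q.subgroup_pow_closed[OF sW x] in auto)
    then show ?thesis using residue_carrier[OF c] by (auto simp: int_pow_int)
  qed
  show ?thesis
    unfolding isomorphic_subreps_def FR.isom_def FQ_simps using pow by blast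
qed

lemma multiplicity_free_iff: "frattini_quotient_multiplicity_free p P E \<phi> \<longleftrightarrow> FR.mfree"
proof -
  have "(\<forall>W\<in>S. \<forall>W'\<in>S. W \<noteq> W' \<longrightarrow> \<not> isomorphic_subreps (residue_ring (int p)) E FQ (induced_action \<phi>) W W')
      \<longleftrightarrow> (\<forall>W\<in>S. \<forall>W'\<in>S. W \<noteq> W' \<longrightarrow> \<not> FR.isom W W')" if "\<forall>W\<in>S. FR.simple W" for S
    using that isomorphic_iff FR.simpleD(1) by (meson)
  then show ?thesis
    unfolding frattini_quotient_multiplicity_free_def multiplicity_free_def FR.mfree_def
    by (simp add: simple_subrep_iff FQ_simps FQ_finsum cong: conj_cong)
qed

end

context p'_action_central
begin

text \<open>Lifts a cyclic generator: a subgroup above \<Phi>(P) is the full preimage of its image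
  in \<open>QP\<close>.\<close>

lemma ex_generates:
  assumes "frattini_quotient_multiplicity_free p P E \<phi>"
  shows "\<exists>u0. generates u0"
proof -
  obtain w where w: "w \<in> carrier QP" "\<And>U. FR.srep U \<Longrightarrow> w \<in> U \<Longrightarrow> U = carrier QP"
    using FR.mfree_cyclic assms multiplicity_free_iff by blast
  obtain u0 where u0: "u0 \<in> carrier P" "w = Kp #> u0" using w(1) by (auto simp: QP_carrier)
  have "H = carrier P" if H: "subgroup H P" and K: "frattini p P \<subseteq> H"
    and st: "\<forall>e\<in>carrier E. \<forall>v\<in>H. \<phi> e v \<in> H" and uH: "u0 \<in> H" for H
  proof
    interpret H: subgroup H P by fact
    let ?c = "\<lambda>v. Kp #> v"
    have "FR.srep (?c ` H)"
    proof (rule FR.srepI)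
      show "?c ` H \<subseteq> carrier QP" by (auto simp: QP_carrier)
      show "?c ` H \<noteq> {}" using uH by blast
    next
      fix x y assume "x \<in> ?c ` H" "y \<in> ?c ` H"
      then show "x \<otimes>\<^bsub>QP\<^esub> y \<in> ?c ` H" by (auto simp: QP_mult)
    next
      fix g x assume "g \<in> carrier E" "x \<in> ?c ` H"
      then show "induced_action \<phi> g x \<in> ?c ` H" using st by (auto simp: induced_coset)
    qed
    moreover have "w \<in> ?c ` H" using u0 uH by auto
    ultimately have eq: "?c ` H = carrier QP" using w(2) by blast
    show "carrier P \<subseteq> H"
    proof
      fix v assume v: "v \<in> carrier P"
      then have "?c v \<in> ?c ` H" unfolding eq by (auto simp: QP_carrier)
      then obtain h where h: "h \<in> H" "?c v = ?c h" by auto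
      then have "v \<otimes> inv h \<in> H" using coset_Kp_eq[OF v, of h] K frattini_eq_Kp by auto
      then have "v \<otimes> inv h \<otimes> h \<in> H" using h by blast
      then show "v \<in> H" using v h by (simp add: P.m_assoc)
    qed
    show "H \<subseteq> carrier P" by (rule H.subset)
  qed
  then show ?thesis using u0 unfolding generates_def by blast
qed

end

section \<open>Non-solvability\<close>

context p'_action
begin

text \<open>The identity minus a linear projection onto \<open>J^2\<close>: a linear choice of
  representatives modulo \<open>J^2\<close>, with no regard to \<open>E\<close>.\<close>

lemma ex_section:
  obtains s :: "('a \<times> 'b \<Rightarrow> 'k) \<Rightarrow> ('a \<times> 'b \<Rightarrow> 'k)"
  where "\<And>x y. s (x + y) = s x + s y" "\<And>x. x \<in> Jp 2 \<Longrightarrow> s x = 0" "\<And>x. s x - x \<in> Jp 2"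
proof -
  interpret vp: vector_space_pair "scl :: 'k \<Rightarrow> ('a \<times> 'b \<Rightarrow> 'k) \<Rightarrow> ('a \<times> 'b \<Rightarrow> 'k)"
      "scl :: 'k \<Rightarrow> ('a \<times> 'b \<Rightarrow> 'k) \<Rightarrow> ('a \<times> 'b \<Rightarrow> 'k)"
    by unfold_locales
  have "Vector_Spaces.linear (scl :: 'k \<Rightarrow> ('a \<times> 'b \<Rightarrow> 'k) \<Rightarrow> ('a \<times> 'b \<Rightarrow> 'k)) scl (\<lambda>x. x)"
    by unfold_locales auto
  from vp.linear_exists_left_inverse_on[OF this subspace_Jp[of 2]]
  obtain g where g: "range g \<subseteq> Jp 2" "Vector_Spaces.linear scl scl g" "\<forall>v\<in>Jp 2. g v = v"
    by auto
  interpret g: Vector_Spaces.linear scl scl g by (rule g(2))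
  show thesis
  proof (rule that[of "\<lambda>x. x - g x"])
    show "x - g x - x \<in> Jp 2" for x
      using Jp_neg[of "g x" 2] g(1) by auto
  qed (use g(3) g.add in auto)
qed

section \<open>The component in \<open>kP\<close>, and an equivariant lift of \<open>u - 1\<close>
  into it\<close>

definition proj_P :: "('a \<times> 'b \<Rightarrow> 'k) \<Rightarrow> ('a \<times> 'b \<Rightarrow> 'k)" where
  "proj_P x = (\<lambda>y. if snd y = \<one>\<^bsub>E\<^esub> then x y else 0)"

lemma proj_P_linear: "proj_P (x + y) = proj_P x + proj_P y" "proj_P (x - y) = proj_P x - proj_P y" "proj_P (scl c x) = scl c (proj_P x)" "proj_P 0 = 0"
  "proj_P (proj_P x) = proj_P x"
  by (auto simp: proj_P_def pointwise fun_eq_iff)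

lemma proj_P_sum: "proj_P (\<Sum>i\<in>I. h i) = (\<Sum>i\<in>I. proj_P (h i))"
  using sum_comp_morphism[of proj_P h I] by (simp add: proj_P_linear o_def)

lemma proj_P_KG: "x \<in> KG \<Longrightarrow> proj_P x \<in> KG"
  by (auto simp: proj_P_def KG_def)

lemma proj_P_up: "proj_P (up u) = up u"
  and proj_P_one: "proj_P one' = one'"
  by (auto simp: proj_P_def up_def one'_def sgl_apply fun_eq_iff)

lemma proj_P_up_conv:
  assumes u: "u \<in> carrier P"
  shows "proj_P (up u \<star> y) = up u \<star> proj_P y"
proof
  fix x :: "'a \<times> 'b"
  have g: "(u, \<one>\<^bsub>E\<^esub>) \<in> carrier Gr" using u by simp
  show "proj_P (up u \<star> y) x = (up u \<star> proj_P y) x"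
    by (cases x) (use u in \<open>simp add: proj_P_def up_def conv_sgl_left[OF g] Gr_inv\<close>)
qed

lemma proj_P_Jp: "y \<in> Jp n \<Longrightarrow> proj_P y \<in> Jp n"
proof (induction n arbitrary: y)
  case 0
  then show ?case by (simp add: proj_P_KG)
next
  case (Suc n)
  from Suc.prems show ?case
  proof (induction y rule: Jp_Suc_induct)
    case (gen u y)
    have "proj_P ((up u - one') \<star> y) = (up u - one') \<star> proj_P y"
      using gen Jp_KG[OF gen(2)] by (simp add: conv_diff_left proj_P_linear proj_P_up_conv proj_P_KG)
    then show ?case using gen Suc.IH by (simp only: Jp_gen)
  qed (simp_all only: proj_P_linear Jp_zero Jp_add Jp_scl)
qed

lemma proj_P_commute:
  assumes x: "proj_P x = x" and w: "w \<in> carrier P"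
  shows "up w \<star> x = x \<star> up w"
proof
  fix y :: "'a \<times> 'b"
  have g: "(w, \<one>\<^bsub>E\<^esub>) \<in> carrier Gr" using w by simp
  have z: "x (v, f) = 0" if "f \<noteq> \<one>\<^bsub>E\<^esub>" for v f
    using fun_cong[OF x, of "(v, f)"] that by (simp add: proj_P_def)
  obtain v f where y: "y = (v, f)" by fastforce
  show "(up w \<star> x) y = (x \<star> up w) y"
    unfolding y up_def conv_sgl_left[OF g] conv_sgl_right[OF g]
    using w z by (cases "f = \<one>\<^bsub>E\<^esub>") (auto simp: Gr_inv P.m_comm)
qed

definition conj_by :: "'b \<Rightarrow> ('a \<times> 'b \<Rightarrow> 'k) \<Rightarrow> ('a \<times> 'b \<Rightarrow> 'k)" where
  "conj_by e y = ue e \<star> (y \<star> ue (inv\<^bsub>E\<^esub> e))"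

lemma conj_by_linear: "conj_by e (x + y) = conj_by e x + conj_by e y" "conj_by e (x - y) = conj_by e x - conj_by e y" "conj_by e (scl c x) = scl c (conj_by e x)"
    "conj_by e 0 = 0"
  by (simp_all add: conj_by_def conv_bilinear)

lemma conj_by_sum: "conj_by e (\<Sum>i\<in>I. h i) = (\<Sum>i\<in>I. conj_by e (h i))"
  using sum_comp_morphism[of "conj_by e" h I] by (simp add: conj_by_linear o_def)

lemma conj_by_Jp: "e \<in> carrier E \<Longrightarrow> y \<in> Jp n \<Longrightarrow> conj_by e y \<in> Jp n"
  by (simp add: conj_by_def Jp_sandwich)

lemma conj_by_comp:
  assumes "e \<in> carrier E" "f \<in> carrier E"
  shows "conj_by e (conj_by f y) = conj_by (e \<otimes>\<^bsub>E\<^esub> f) y"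
  using assms by (simp add: conj_by_def conv_assoc ue_mult_assoc ue_mult E.inv_mult_group)

lemma conj_by_aug: "e \<in> carrier E \<Longrightarrow> u \<in> carrier P \<Longrightarrow> conj_by e (up u - one') = up (\<phi> e u) - one'"
  by (simp add: conj_by_def aug_phi)

lemma proj_P_conj_by:
  assumes e: "e \<in> carrier E"
  shows "proj_P (conj_by e y) = conj_by e (proj_P y)"
proof
  fix x :: "'a \<times> 'b"
  show "proj_P (conj_by e y) x = conj_by e (proj_P y) x"
  proof (cases "x \<in> carrier Gr")
    case False
    then have "conj_by e z x = 0" for z by (simp add: conj_by_def KG_D[OF KG_conv])
    then show ?thesis by (simp add: proj_P_def)
  next
    case True
    then obtain v f where x: "x = (v, f)" "v \<in> carrier P" "f \<in> carrier E" by auto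
    have "inv\<^bsub>E\<^esub> e \<otimes>\<^bsub>E\<^esub> (f \<otimes>\<^bsub>E\<^esub> e) = \<one>\<^bsub>E\<^esub> \<longleftrightarrow> f = \<one>\<^bsub>E\<^esub>"
    proof
      assume h: "inv\<^bsub>E\<^esub> e \<otimes>\<^bsub>E\<^esub> (f \<otimes>\<^bsub>E\<^esub> e) = \<one>\<^bsub>E\<^esub>"
      have "f = e \<otimes>\<^bsub>E\<^esub> (inv\<^bsub>E\<^esub> e \<otimes>\<^bsub>E\<^esub> (f \<otimes>\<^bsub>E\<^esub> e)) \<otimes>\<^bsub>E\<^esub> inv\<^bsub>E\<^esub> e"
        using e x by (simp add: E.m_assoc) (simp flip: E.m_assoc)
      then show "f = \<one>\<^bsub>E\<^esub>" unfolding h using e by simp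
    qed (use e in simp)
    then show ?thesis
      using ue_conj_apply[OF e x(2,3), of y] ue_conj_apply[OF e x(2,3), of "proj_P y"]
      by (auto simp: x conj_by_def proj_P_def)
  qed
qed

text \<open>An \<open>E\<close>-equivariant additive lift of \<open>u \<mapsto> u - 1 \<in> J/J\<^sup>2\<close> to \<open>kP\<close>.\<close>

lemma ex_lift:
  "\<exists>lam :: 'a \<Rightarrow> ('a \<times> 'b \<Rightarrow> 'k).
    (\<forall>u\<in>carrier P. \<forall>v\<in>carrier P. lam (u \<otimes> v) = lam u + lam v) \<and>
    (\<forall>u\<in>carrier P. proj_P (lam u) = lam u) \<and>
    (\<forall>e\<in>carrier E. \<forall>u\<in>carrier P. lam (\<phi> e u) = conj_by e (lam u)) \<and>
    (\<forall>u\<in>carrier P. lam u - (up u - one') \<in> Jp 2) \<and> (\<forall>u\<in>Kp. lam u = 0)"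
proof -
  obtain s :: "('a \<times> 'b \<Rightarrow> 'k) \<Rightarrow> ('a \<times> 'b \<Rightarrow> 'k)"
    where s: "\<And>x y. s (x + y) = s x + s y" "\<And>x. x \<in> Jp 2 \<Longrightarrow> s x = 0" "\<And>x. s x - x \<in> Jp 2"
    by (rule ex_section) (rule that; blast)
  \<comment> \<open>\<open>s\<close> kills the error term of \<open>aug_mult\<close>, so that
    \<open>l0\<close> is exactly additive and not merely additive modulo \<open>J^2\<close>.\<close>
  define l0 where "l0 u = proj_P (s (up u - one'))" for u
  let ?n = "of_nat (Coset.order E) :: 'k"
  \<comment> \<open>Averaging over \<open>E\<close> makes the lift equivariant and keeps it in
    \<open>kP\<close>.\<close>
  define lam where "lam u = scl (inverse ?n) (\<Sum>e\<in>carrier E. conj_by e (l0 (\<phi> (inv\<^bsub>E\<^esub> e) u)))" for u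
  have l0_mult: "l0 (u \<otimes> v) = l0 u + l0 v" if uv: "u \<in> carrier P" "v \<in> carrier P" for u v
  proof -
    let ?d = "up (u \<otimes> v) - one' - ((up u - one') + (up v - one'))"
    have "s (?d + ((up u - one') + (up v - one'))) = s ?d + (s (up u - one') + s (up v - one'))"
      by (simp only: s(1))
    then have "s (up (u \<otimes> v) - one') = s (up u - one') + s (up v - one')"
      by (simp only: s(2)[OF aug_mult[OF uv]] diff_add_cancel add_0_left)
    then show ?thesis by (simp only: l0_def proj_P_linear)
  qed
  have l0_aug: "l0 u - (up u - one') \<in> Jp 2" if "u \<in> carrier P" for u
    using proj_P_Jp[OF s(3)[of "up u - one'"]] by (simp only: l0_def proj_P_linear proj_P_up proj_P_one)
  have l0_Kp: "l0 u = 0" if "u \<in> Kp" for u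
    using that s(2)[of "up u - one'"] by (simp add: l0_def Kp_def proj_P_linear)
  show ?thesis
  proof (intro exI[of _ lam] conjI ballI)
    show "lam (u \<otimes> v) = lam u + lam v" if "u \<in> carrier P" "v \<in> carrier P" for u v
      using that by (simp add: lam_def phi_mult l0_mult conj_by_linear sum.distrib fv.scale_right_distrib)
    show "proj_P (lam u) = lam u" if "u \<in> carrier P" for u
      by (simp add: lam_def proj_P_linear proj_P_sum proj_P_conj_by l0_def)
    show "lam u = 0" if "u \<in> Kp" for u
      using that by (simp add: lam_def l0_Kp Kp_stable conj_by_linear)
    show "lam u - (up u - one') \<in> Jp 2" if u: "u \<in> carrier P" for u
    proof -
      have "up u - one' = scl (inverse ?n) (\<Sum>e\<in>carrier E. up u - one')"
        using order_E_nonzero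
        by (simp add: fv.sum_constant_scale Coset.order_def del: sum_constant sum_subtractf)
      also have "\<dots> = scl (inverse ?n) (\<Sum>e\<in>carrier E. conj_by e (up (\<phi> (inv\<^bsub>E\<^esub> e) u) - one'))"
        using u by (simp add: conj_by_aug del: sum_constant sum_subtractf)
      finally have "lam u - (up u - one') = scl (inverse ?n)
          (\<Sum>e\<in>carrier E. conj_by e (l0 (\<phi> (inv\<^bsub>E\<^esub> e) u) - (up (\<phi> (inv\<^bsub>E\<^esub> e) u) - one')))"
        by (simp only: lam_def conj_by_linear sum_subtractf fv.scale_right_diff_distrib)
      also have "\<dots> \<in> Jp 2"
        using u by (intro Jp_scl Jp_sum conj_by_Jp l0_aug) auto
      finally show ?thesis .
    qed
    show "lam (\<phi> e u) = conj_by e (lam u)" if e: "e \<in> carrier E" and u: "u \<in> carrier P" for e u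
    proof -
      have "conj_by e (lam u) = scl (inverse ?n) (\<Sum>f\<in>carrier E. conj_by (e \<otimes>\<^bsub>E\<^esub> f) (l0 (\<phi> (inv\<^bsub>E\<^esub> f) u)))"
        using e by (simp add: lam_def conj_by_linear conj_by_sum conj_by_comp)
      also have "(\<Sum>f\<in>carrier E. conj_by (e \<otimes>\<^bsub>E\<^esub> f) (l0 (\<phi> (inv\<^bsub>E\<^esub> f) u))) =
          (\<Sum>f\<in>carrier E. conj_by f (l0 (\<phi> (inv\<^bsub>E\<^esub> f) (\<phi> e u))))"
      proof (rule sum.reindex_bij_witness[where i = "\<lambda>f. inv\<^bsub>E\<^esub> e \<otimes>\<^bsub>E\<^esub> f" and j = "\<lambda>f. e \<otimes>\<^bsub>E\<^esub> f"])
        fix f assume f: "f \<in> carrier E"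
        have "\<phi> (inv\<^bsub>E\<^esub> (e \<otimes>\<^bsub>E\<^esub> f)) (\<phi> e u) = \<phi> (inv\<^bsub>E\<^esub> f) u"
          using e f u by (simp add: E.inv_mult_group phi_comp)
        then show "conj_by (e \<otimes>\<^bsub>E\<^esub> f) (l0 (\<phi> (inv\<^bsub>E\<^esub> (e \<otimes>\<^bsub>E\<^esub> f)) (\<phi> e u))) = conj_by (e \<otimes>\<^bsub>E\<^esub> f) (l0 (\<phi> (inv\<^bsub>E\<^esub> f) u))"
          by simp
      qed (use e in \<open>auto simp flip: E.m_assoc\<close>)
      finally show ?thesis by (simp add: lam_def)
    qed
  qed
qed

text \<open>With \<open>d(g) = \<mu>(u) g\<close> on basis elements \<open>g = (u, e)\<close>,
  Leibniz at \<open>(u, e)\<close> and \<open>(v, f)\<close> becomes additivity of \<mu> at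
  \<open>u\<close> and \<open>\<phi> e v\<close>: moving \<open>\<mu> v\<close> past
  \<open>e\<close> is equivariance, and moving it past \<open>u\<close> is possible because
  \<open>kP\<close> is commutative.\<close>

lemma der_of_hom:
  assumes mult: "\<And>u v. u \<in> carrier P \<Longrightarrow> v \<in> carrier P \<Longrightarrow> \<mu> (u \<otimes> v) = \<mu> u + \<mu> v"
    and proj_P: "\<And>u. u \<in> carrier P \<Longrightarrow> proj_P (\<mu> u) = (\<mu> u :: 'a \<times> 'b \<Rightarrow> 'k)"
    and act: "\<And>e u. e \<in> carrier E \<Longrightarrow> u \<in> carrier P \<Longrightarrow> \<mu> (\<phi> e u) = conj_by e (\<mu> u)"
  shows "\<exists>d\<in>ders. (\<forall>e\<in>carrier E. d (ue e) = 0) \<and> (\<forall>u\<in>carrier P. d (up u) = \<mu> u \<star> up u)"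
proof -
  define d where "d = (\<lambda>x\<in>KG. \<Sum>g\<in>carrier Gr. scl (x g) (\<mu> (fst g) \<star> sgl g))"
  have dK: "d x \<in> KG" if "x \<in> KG" for x using that by (auto simp: d_def intro!: KG_sum)
  have add: "d (x + y) = d x + d y" if "x \<in> KG" "y \<in> KG" for x y
    using that by (simp add: d_def plus_fun_apply fv.scale_left_distrib sum.distrib)
  have scl: "d (scl c x) = scl c (d x)" if "x \<in> KG" for c x
    using that by (simp add: d_def scl_apply fv.scale_sum_right)
  have sg: "d (sgl g) = \<mu> (fst g) \<star> sgl g" if g: "g \<in> carrier Gr" for g
  proof -
    have eq: "scl (sgl g h) z = (if h = g then z else 0)" for h and z :: "'a \<times> 'b \<Rightarrow> 'k"
      by (simp add: sgl_apply)
    have "d (sgl g) = (\<Sum>h\<in>carrier Gr. if h = g then \<mu> (fst h) \<star> sgl h else 0)"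
    proof -
      have "(sgl g :: 'a \<times> 'b \<Rightarrow> 'k) \<in> KG" by (rule KG_sgl[OF g])
      then show ?thesis unfolding d_def by (simp add: eq del: Gr_simps)
    qed
    then show ?thesis using g by (simp add: sum.delta' del: Gr_simps)
  qed
  have d0: "d 0 = 0" using scl[of 0 0] by simp
  have mu_one: "\<mu> \<one> = 0"
    using mult[of "\<one>" "\<one>"] by (simp only: P.one_closed P.l_one add_cancel_right_right)
  have sgsg: "d (sgl g \<star> sgl h) = d (sgl g) \<star> sgl h + sgl g \<star> d (sgl h)"
    if gh: "g \<in> carrier Gr" "h \<in> carrier Gr" for g h
  proof -
    obtain u e v f where g: "g = (u, e)" "u \<in> carrier P" "e \<in> carrier E"
      and h: "h = (v, f)" "v \<in> carrier P" "f \<in> carrier E" using gh by auto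
    have "sgl g \<star> d (sgl h) = up u \<star> (ue e \<star> (\<mu> v \<star> sgl h))"
    proof -
      have gg: "sgl g = up u \<star> ue e" using g by (simp add: up_ue)
      show ?thesis unfolding sg[OF gh(2)] gg conv_assoc by (simp add: h)
    qed
    also have "ue e \<star> (\<mu> v \<star> sgl h) = conj_by e (\<mu> v) \<star> (ue e \<star> sgl h)"
      using g h gh by (simp add: conj_by_def conv_assoc ue_mult_assoc ue_one del: Gr_simps conv_sgl_sgl)
    also have "up u \<star> (conj_by e (\<mu> v) \<star> (ue e \<star> sgl h)) = \<mu> (\<phi> e v) \<star> (up u \<star> (ue e \<star> sgl h))"
    proof -
      have "up u \<star> \<mu> (\<phi> e v) = \<mu> (\<phi> e v) \<star> up u" using g h by (intro proj_P_commute proj_P) auto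
      then show ?thesis using act[OF g(3) h(2)] by (metis conv_assoc)
    qed
    also have "up u \<star> (ue e \<star> sgl h) = sgl (g \<otimes>\<^bsub>Gr\<^esub> h)"
      using g h by (simp add: up_def ue_def)
    finally have 1: "sgl g \<star> d (sgl h) = \<mu> (\<phi> e v) \<star> sgl (g \<otimes>\<^bsub>Gr\<^esub> h)" .
    have 2: "d (sgl g) \<star> sgl h = \<mu> u \<star> sgl (g \<otimes>\<^bsub>Gr\<^esub> h)"
      using sg[OF gh(1)] g gh by (simp add: conv_assoc)
    have "d (sgl g \<star> sgl h) = \<mu> (u \<otimes> \<phi> e v) \<star> sgl (g \<otimes>\<^bsub>Gr\<^esub> h)"
      using sg[OF m_closed[OF gh]] gh g h by simp
    also have "\<mu> (u \<otimes> \<phi> e v) = \<mu> u + \<mu> (\<phi> e v)" using g h by (intro mult) auto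
    finally show ?thesis by (simp only: 1 2 conv_add_left)
  qed
  have sgx: "d (sgl g \<star> y) = d (sgl g) \<star> y + sgl g \<star> d y" if g: "g \<in> carrier Gr" and y: "y \<in> KG" for g y
    using y
  proof (induction y rule: KG_induct)
    case (sgl h)
    then show ?case using sgsg[OF g] by blast
  qed (simp_all add: d0 add scl conv_bilinear fv.scale_right_distrib)
  have leib: "d (x \<star> y) = d x \<star> y + x \<star> d y" if x: "x \<in> KG" and y: "y \<in> KG" for x y
    using x
  proof (induction x rule: KG_induct)
    case (sgl g)
    then show ?case using sgx[OF _ y] by blast
  qed (simp_all add: d0 add scl conv_bilinear fv.scale_right_distrib)
  show ?thesis
  proof (intro bexI[of _ d] conjI ballI)
    have "d \<in> extensional KG" by (simp add: d_def)
    then show "d \<in> ders" by (rule dersI[OF _ dK add scl leib])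
    show "d (ue e) = 0" if "e \<in> carrier E" for e using sg[of "(\<one>, e)"] that mu_one by (simp add: ue_def)
    show "d (up u) = \<mu> u \<star> up u" if "u \<in> carrier P" for u using sg[of "(u, \<one>\<^bsub>E\<^esub>)"] that by (simp add: up_def)
  qed
qed

section \<open>Derivations computed modulo \<open>J^2\<close>\<close>

definition eqv :: "('a \<times> 'b \<Rightarrow> 'k) \<Rightarrow> ('a \<times> 'b \<Rightarrow> 'k) \<Rightarrow> bool" (infix \<open>\<doteq>\<close> 50) where
  "x \<doteq> y \<longleftrightarrow> x - y \<in> Jp 2"

lemma eqv_refl [simp]: "x \<doteq> x"
  by (simp add: eqv_def)

lemma eqv_sym: "x \<doteq> y \<Longrightarrow> y \<doteq> x"
  unfolding eqv_def using Jp_neg[of "x - y" 2] by simp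

lemma eqv_trans [trans]: "x \<doteq> y \<Longrightarrow> y \<doteq> z \<Longrightarrow> x \<doteq> z"
  unfolding eqv_def using Jp_add[of "x - y" 2 "y - z"] by simp

lemma eqv_diff: "x \<doteq> y \<Longrightarrow> x' \<doteq> y' \<Longrightarrow> x - x' \<doteq> y - y'"
  unfolding eqv_def using Jp_diff[of "x - y" 2 "x' - y'"] by (simp add: algebra_simps)

lemma eqv_scl: "x \<doteq> y \<Longrightarrow> scl c x \<doteq> scl c y"
  unfolding eqv_def using Jp_scl[of "x - y" 2 c] by (simp add: fv.scale_right_diff_distrib)

lemma eqv_coset:
  assumes "u \<in> carrier P" "v \<in> carrier P" "Kp #> u = Kp #> v"
  shows "up u \<doteq> up v"
proof -
  have K: "u \<otimes> inv v \<in> Kp" using assms coset_Kp_eq by blast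
  have "up u - up v = (up (u \<otimes> inv v) - one') \<star> up v"
    using assms by (simp add: conv_diff_left up_mult P.m_assoc)
  then show ?thesis using K assms by (simp add: eqv_def Kp_def Jp_right)
qed

definition shape :: "('a \<Rightarrow> 'a \<times> 'b \<Rightarrow> 'k) \<Rightarrow> (('a \<times> 'b \<Rightarrow> 'k) \<Rightarrow> ('a \<times> 'b \<Rightarrow> 'k)) \<Rightarrow> bool" where
  "shape r d \<longleftrightarrow> Fil 0 d \<and> (\<forall>u\<in>carrier P. d (up u) \<doteq> r u)"

lemma shape_der:
  assumes "shape r d" "x \<in> KG" "y \<in> KG" "x \<doteq> y"
  shows "d x \<doteq> d y"
  using assms Fil_Jp[of 0 d "x - y" 2] der_diff[OF FilD(1), of 0 d x y]
  by (simp add: shape_def eqv_def)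

lemma shape_diff:
  assumes "shape r d" "u \<in> carrier P" "v \<in> carrier P"
  shows "d (up u - up v) \<doteq> r u - r v"
  using assms der_diff[OF FilD(1), of 0 d "up u" "up v"] by (auto simp: shape_def intro: eqv_diff)

lemma shape_aug:
  assumes "shape r d" "u \<in> carrier P"
  shows "d (up u - one') \<doteq> r u"
  using assms der_diff[OF FilD(1), of 0 d "up u" one'] der_one'[OF FilD(1), of 0 d]
  by (auto simp: shape_def)

text \<open>Composites can be read off from representatives, because a derivation of degree 0
  preserves congruence modulo \<open>J^2\<close>.\<close>

lemma shape_bracket:
  assumes d: "shape r d" and d': "shape r' d'"
    and rK: "\<And>u. u \<in> carrier P \<Longrightarrow> r u \<in> KG" "\<And>u. u \<in> carrier P \<Longrightarrow> r' u \<in> KG"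
    and h: "\<And>u. u \<in> carrier P \<Longrightarrow> d (r' u) - d' (r u) \<doteq> q u"
  shows "shape q (dbr d d')"
  unfolding shape_def
proof (intro conjI ballI)
  have F: "Fil 0 d" "Fil 0 d'" using d d' by (auto simp: shape_def)
  then show "Fil 0 (dbr d d')" using Fil_dbr[of 0 d 0 d'] by simp
  fix u assume u: "u \<in> carrier P"
  have "d (d' (up u)) \<doteq> d (r' u)" "d' (d (up u)) \<doteq> d' (r u)"
    using shape_der[OF d, of "d' (up u)" "r' u"] shape_der[OF d', of "d (up u)" "r u"]
      u d d' rK der_closed[OF FilD(1)[OF F(1)]] der_closed[OF FilD(1)[OF F(2)]] by (auto simp: shape_def)
  then have "dbr d d' (up u) \<doteq> d (r' u) - d' (r u)" using u by (simp add: dbr_apply eqv_diff)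
  also have "\<dots> \<doteq> q u" by (rule h[OF u])
  finally show "dbr d d' (up u) \<doteq> q u" .
qed

lemma shape_dscl:
  assumes "shape r d" "\<And>u. u \<in> carrier P \<Longrightarrow> scl c (r u) = q u"
  shows "shape q (dscl c d)"
  using assms eqv_scl[of _ _ c] by (auto simp: shape_def Fil_dscl dscl_apply) metis

text \<open>\<open>t\<close> is only a choice of coset representatives. Since \<open>lam\<close>
  vanishes on \<open>Kp\<close>, the map \<open>u \<mapsto> lam (t u)\<close> is nevertheless an
  exact equivariant homomorphism, to which \<open>der_of_hom\<close> applies.\<close>

lemma ex_shape:
  assumes tP: "\<And>u. u \<in> carrier P \<Longrightarrow> t u \<in> carrier P"
    and hom: "\<And>u v. u \<in> carrier P \<Longrightarrow> v \<in> carrier P \<Longrightarrow>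
      Kp #> t (u \<otimes> v) = Kp #> (t u \<otimes> t v)"
    and act: "\<And>e u. e \<in> carrier E \<Longrightarrow> u \<in> carrier P \<Longrightarrow> Kp #> t (\<phi> e u) = Kp #> \<phi> e (t u)"
  shows "\<exists>d. shape (\<lambda>u. up (t u) - one') d"
proof -
  obtain lam :: "'a \<Rightarrow> ('a \<times> 'b \<Rightarrow> 'k)"
    where "\<forall>u\<in>carrier P. \<forall>v\<in>carrier P. lam (u \<otimes> v) = lam u + lam v"
      "\<forall>u\<in>carrier P. proj_P (lam u) = lam u"
      "\<forall>e\<in>carrier E. \<forall>u\<in>carrier P. lam (\<phi> e u) = conj_by e (lam u)"
      "\<forall>u\<in>carrier P. lam u - (up u - one') \<in> Jp 2" "\<forall>u\<in>Kp. lam u = 0"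
    using ex_lift by (elim exE conjE) (rule that; assumption)
  note lam = this[rule_format]
  have lam_cong: "lam u = lam v" if uv: "u \<in> carrier P" "v \<in> carrier P" "Kp #> u = Kp #> v" for u v
  proof -
    have "u = (u \<otimes> inv v) \<otimes> v" using uv by (simp add: P.m_assoc)
    then have "lam u = lam (u \<otimes> inv v) + lam v"
      using lam(1)[of "u \<otimes> inv v" v] uv by simp
    then show ?thesis using lam(5)[of "u \<otimes> inv v"] coset_Kp_eq[OF uv(1,2)] uv(3) by simp
  qed
  have "\<exists>d\<in>ders. (\<forall>e\<in>carrier E. d (ue e) = 0) \<and> (\<forall>u\<in>carrier P. d (up u) = lam (t u) \<star> up u)"
  proof (rule der_of_hom)
    show "lam (t (u \<otimes> v)) = lam (t u) + lam (t v)" if "u \<in> carrier P" "v \<in> carrier P" for u v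
      using lam_cong[OF _ _ hom[OF that]] lam(1) tP that by simp
    show "proj_P (lam (t u)) = lam (t u)" if "u \<in> carrier P" for u using lam(2) tP that by simp
    show "lam (t (\<phi> e u)) = conj_by e (lam (t u))" if "e \<in> carrier E" "u \<in> carrier P" for e u
      using lam_cong[OF _ _ act[OF that]] lam(3) tP that by simp
  qed
  then obtain d where d: "d \<in> ders" "\<forall>e\<in>carrier E. d (ue e) = 0"
    "\<forall>u\<in>carrier P. d (up u) = lam (t u) \<star> up u"
    by (elim bexE conjE) (rule that; assumption)
  have lJ: "lam u \<in> Jp 1" if u: "u \<in> carrier P" for u
  proof -
    have "(lam u - (up u - one')) + (up u - one') \<in> Jp 1"
      using lam(4)[OF u] aug_in_Jp1[OF u] Jp_antimono[of 1 2] by (intro Jp_add) auto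
    then show ?thesis by simp
  qed
  have 1: "d (up u) \<doteq> up (t u) - one'" if u: "u \<in> carrier P" for u
  proof -
    have "lam (t u) \<star> up u - lam (t u) = lam (t u) \<star> (up u - one')"
      using Jp_KG[OF lJ[OF tP[OF u]]] by (simp add: conv_diff_right)
    moreover have "lam (t u) \<star> (up u - one') \<in> Jp 2"
      using Jp_mult[OF lJ[OF tP[OF u]] aug_in_Jp1[OF u]] by (simp add: numeral_2_eq_2)
    ultimately have "d (up u) \<doteq> lam (t u)" using d(3)[rule_format, OF u] by (simp add: eqv_def)
    also have "\<dots> \<doteq> up (t u) - one'" using lam(4)[OF tP[OF u]] by (simp add: eqv_def)
    finally show ?thesis .
  qed
  have "Fil 0 d"
    using d lJ tP by (auto simp: Fil_def intro!: Jp_right simp flip: One_nat_def)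
  then show ?thesis using 1 unfolding shape_def by blast
qed

text \<open>\<open>ad a (u) u^(-1) = a - u a u^(-1)\<close> has no component in \<open>kP\<close>,
  so projecting its congruence with \<open>t u - 1\<close> to \<open>kP\<close> leaves
  \<open>t u - 1\<close> in \<open>J^2\<close>.\<close>

lemma shape_inner:
  assumes "shape (\<lambda>u. up (t u) - one') (ad a)" "a \<in> KG" "u \<in> carrier P" "t u \<in> carrier P"
  shows "t u \<in> Kp"
proof -
  have uP: "u \<in> carrier P" by fact
  let ?y = "ad a (up u) \<star> up (inv u)"
  let ?x = "up (t u) - one'"
  have xJ: "?x \<in> Jp 1" using aug_in_Jp1 assms(4) .
  have "ad a (up u) - ?x \<in> Jp 2" using assms(1) uP by (simp add: shape_def eqv_def)
  then have "(ad a (up u) - ?x) \<star> up (inv u) \<in> Jp 2" using uP by (intro Jp_right) auto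
  \<comment> \<open>This product absorbs the factor \<open>u^(-1)\<close> on the right of
    \<open>x\<close>, so that \<open>y\<close> is compared with \<open>x\<close> itself.\<close>
  moreover have "?x \<star> (up (inv u) - one') \<in> Jp 2"
    using Jp_mult[OF xJ aug_in_Jp1[of "inv u"]] uP by (simp add: numeral_2_eq_2)
  ultimately have "(ad a (up u) - ?x) \<star> up (inv u) + ?x \<star> (up (inv u) - one') \<in> Jp 2" by (rule Jp_add)
  moreover have "(ad a (up u) - ?x) \<star> up (inv u) + ?x \<star> (up (inv u) - one') = ?y - ?x"
    unfolding conv_diff_left[of "ad a (up u)" ?x] conv_diff_right one'_right[OF Jp_KG[OF xJ]] by simp
  ultimately have "?y - ?x \<in> Jp 2" by (simp only:)
  then have "proj_P (?y - ?x) \<in> Jp 2" by (rule proj_P_Jp)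
  moreover have "proj_P ?y = 0"
  proof
    fix z :: "'a \<times> 'b"
    have y: "?y = a - up u \<star> (a \<star> up (inv u))"
      using uP assms(2) by (simp add: ad_apply conv_diff_left conv_assoc up_mult up_one)
    show "proj_P ?y z = 0 z"
    proof (cases "z \<in> carrier Gr \<and> snd z = \<one>\<^bsub>E\<^esub>")
      case True
      then obtain v where z: "z = (v, \<one>\<^bsub>E\<^esub>)" "v \<in> carrier P" by auto
      then show ?thesis
        using uP up_conj_apply[OF uP z(2) E.one_closed, of a] by (simp add: y proj_P_def pointwise twist_def)
    next
      case False
      have "?y \<in> KG" by simp
      then show ?thesis using False KG_D[of ?y z] by (auto simp: proj_P_def pointwise simp del: Gr_simps)
    qed
  qed
  ultimately have "- ?x \<in> Jp 2" by (simp add: proj_P_linear proj_P_up proj_P_one)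
  then show ?thesis using Jp_neg[of "- ?x" 2] assms(4) by (simp add: Kp_def)
qed

text \<open>Every term of the derived series keeps classes that act on \<open>J/J^2\<close> as the
  elements \<open>e\<close>, \<open>f\<close> and \<open>h = [e,f]\<close> of
  \<open>sl_2\<close>.\<close>

lemma mfree_if_solvable:
  assumes odd: "odd p" and solv: "lie_solvable (HA :: ('k, _) module)"
  shows "FR.mfree"
proof (rule ccontr)
  assume "\<not> FR.mfree"
  from FR.not_mfree_matrix_units[OF this] obtain e f where "FR.endo e" "FR.endo f"
    and "\<forall>x\<in>carrier QP. e (e x) = \<one>\<^bsub>QP\<^esub>" "\<forall>x\<in>carrier QP. f (f x) = \<one>\<^bsub>QP\<^esub>"
      "\<forall>x\<in>carrier QP. e (f (e x)) = e x" "\<forall>x\<in>carrier QP. f (e (f x)) = f x"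
    and nz: "\<exists>x\<in>carrier QP. e x \<noteq> \<one>\<^bsub>QP\<^esub>"
    by (elim exE conjE) (rule that; assumption)
  note ee = this(3)[rule_format] and ff = this(4)[rule_format]
    and efe = this(5)[rule_format] and fef = this(6)[rule_format]
    and e = this(1)[unfolded FR.endo_def] and f = this(2)[unfolded FR.endo_def]
  note ef = conjunct1[OF e, rule_format] conjunct1[OF f, rule_format]
    conjunct1[OF conjunct2[OF e], rule_format] conjunct1[OF conjunct2[OF f], rule_format]
    conjunct2[OF conjunct2[OF e], rule_format] conjunct2[OF conjunct2[OF f], rule_format]
  let ?c = "\<lambda>u. Kp #> u"
  have cQ: "?c u \<in> carrier QP" if "u \<in> carrier P" for u using that by (auto simp: QP_carrier)
  have "\<exists>v. v \<in> carrier P \<and> ?c v = e (?c u)" if "u \<in> carrier P" for u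
    using ef(1)[OF cQ[OF that]] by (auto simp: QP_carrier)
  \<comment> \<open>A set-theoretic lift of \<open>e\<close> to \<open>P\<close>, multiplicative and
    equivariant only modulo \<open>Kp\<close>; \<open>tf\<close> below is the same for
    \<open>f\<close>.\<close>
  then obtain te where te: "\<And>u. u \<in> carrier P \<Longrightarrow> te u \<in> carrier P \<and> ?c (te u) = e (?c u)" by metis
  have "\<exists>v. v \<in> carrier P \<and> ?c v = f (?c u)" if "u \<in> carrier P" for u
    using ef(2)[OF cQ[OF that]] by (auto simp: QP_carrier)
  then obtain tf where tf: "\<And>u. u \<in> carrier P \<Longrightarrow> tf u \<in> carrier P \<and> ?c (tf u) = f (?c u)" by metis
  have tP: "te u \<in> carrier P" "tf u \<in> carrier P" if "u \<in> carrier P" for u using te tf that by auto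
  have e1: "e \<one>\<^bsub>QP\<^esub> = \<one>\<^bsub>QP\<^esub>"
    using ef(3)[OF FR.Q.one_closed FR.Q.one_closed] ef(1)[OF FR.Q.one_closed]
    by (simp add: FR.Q.r_cancel_one')
  have f1: "f \<one>\<^bsub>QP\<^esub> = \<one>\<^bsub>QP\<^esub>"
    using ef(4)[OF FR.Q.one_closed FR.Q.one_closed] ef(2)[OF FR.Q.one_closed]
    by (simp add: FR.Q.r_cancel_one')
  have up1: "up u \<doteq> one'" if "u \<in> carrier P" "?c u = \<one>\<^bsub>QP\<^esub>" for u
    using coset_Kp_one[OF that(1)] that by (simp add: eqv_def Kp_def)
  define re where "re u = up (te u) - one'" for u
  define rf where "rf u = up (tf u) - one'" for u
  \<comment> \<open>The constant terms of \<open>e f\<close> and \<open>f e\<close> cancel. The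
    relations verified below are \<open>[e,f] = h\<close>, \<open>[h,e] = 2 e\<close> and
    \<open>[h,f] = -2 f\<close>; they rest on \<open>e e = f f = 0\<close>, \<open>e f e = e\<close>
    and \<open>f e f = f\<close> in additive notation.\<close>
  define rh where "rh u = up (te (tf u)) - up (tf (te u))" for u
  have rK: "re u \<in> KG" "rf u \<in> KG" "rh u \<in> KG" if "u \<in> carrier P" for u
    using tP that by (auto simp: re_def rf_def rh_def)
  have eq_e: "up (te (tf (te u))) \<doteq> up (te u)" if "u \<in> carrier P" for u
    using that tP te tf efe cQ by (intro eqv_coset) simp_all
  have eq_f: "up (tf (te (tf u))) \<doteq> up (tf u)" if "u \<in> carrier P" for u
    using that tP te tf fef cQ by (intro eqv_coset) simp_all
  have z_e: "up (te (te v)) \<doteq> one'" if "v \<in> carrier P" for v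
    using that tP te ee cQ by (intro up1) simp_all
  have z_f: "up (tf (tf v)) \<doteq> one'" if "v \<in> carrier P" for v
    using that tP tf ff cQ by (intro up1) simp_all
  have z_fe: "up (tf (te (te u))) \<doteq> one'" if "u \<in> carrier P" for u
    using that tP te tf ee f1 cQ by (intro up1) simp_all
  have z_ef: "up (te (tf (tf u))) \<doteq> one'" if "u \<in> carrier P" for u
    using that tP te tf ff e1 cQ by (intro up1) simp_all
  have bEF: "shape rh (dbr De Df)" if De: "shape re De" and Df: "shape rf Df" for De Df
  proof (rule shape_bracket[OF De Df rK(1,2)])
    fix u assume u: "u \<in> carrier P"
    have "De (rf u) - Df (re u) \<doteq> re (tf u) - rf (te u)"
      unfolding rf_def[of u] re_def[of u] using tP u by (intro eqv_diff shape_aug[OF De] shape_aug[OF Df])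
    then show "De (rf u) - Df (re u) \<doteq> rh u" by (simp add: re_def rf_def rh_def)
  qed
  have bHE: "shape (\<lambda>u. scl 2 (re u)) (dbr Dh De)" if Dh: "shape rh Dh" and De: "shape re De" for Dh De
  proof (rule shape_bracket[OF Dh De rK(3,1)])
    fix u assume u: "u \<in> carrier P"
    have "Dh (re u) \<doteq> rh (te u)"
      unfolding re_def[of u] using tP u by (intro shape_aug[OF Dh])
    also have "rh (te u) \<doteq> up (te u) - one'"
      unfolding rh_def using u by (intro eqv_diff eq_e z_fe)
    finally have 1: "Dh (re u) \<doteq> up (te u) - one'" .
    have "De (rh u) \<doteq> re (te (tf u)) - re (tf (te u))"
      unfolding rh_def using tP u by (intro shape_diff[OF De]) auto
    also have "\<dots> = up (te (te (tf u))) - up (te (tf (te u)))" by (simp add: re_def)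
    also have "\<dots> \<doteq> one' - up (te u)" using u tP by (intro eqv_diff eq_e z_e)
    finally have "Dh (re u) - De (rh u) \<doteq> (up (te u) - one') - (one' - up (te u))"
      by (intro eqv_diff 1)
    also have "\<dots> = scl (1 + 1) (re u)" unfolding fv.scale_left_distrib by (simp add: re_def)
    finally show "Dh (re u) - De (rh u) \<doteq> scl 2 (re u)" by simp
  qed
  have bHF: "shape (\<lambda>u. scl (- 2) (rf u)) (dbr Dh Df)" if Dh: "shape rh Dh" and Df: "shape rf Df" for Dh Df
  proof (rule shape_bracket[OF Dh Df rK(3,2)])
    fix u assume u: "u \<in> carrier P"
    have "Dh (rf u) \<doteq> rh (tf u)"
      unfolding rf_def[of u] using tP u by (intro shape_aug[OF Dh])
    also have "rh (tf u) \<doteq> one' - up (tf u)"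
      unfolding rh_def using u by (intro eqv_diff eq_f z_ef)
    finally have 1: "Dh (rf u) \<doteq> one' - up (tf u)" .
    have "Df (rh u) \<doteq> rf (te (tf u)) - rf (tf (te u))"
      unfolding rh_def using tP u by (intro shape_diff[OF Df]) auto
    also have "\<dots> = up (tf (te (tf u))) - up (tf (tf (te u)))" by (simp add: rf_def)
    also have "\<dots> \<doteq> up (tf u) - one'" using u tP by (intro eqv_diff eq_f z_f)
    finally have "Dh (rf u) - Df (rh u) \<doteq> (one' - up (tf u)) - (up (tf u) - one')"
      by (intro eqv_diff 1)
    also have "\<dots> = - scl (1 + 1) (rf u)" unfolding fv.scale_left_distrib by (simp add: rf_def)
    finally show "Dh (rf u) - Df (rh u) \<doteq> scl (- 2) (rf u)" by (simp add: fv.scale_minus_left)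
  qed
  have two: "(2 :: 'k) \<noteq> 0"
  proof
    assume "(2 :: 'k) = 0"
    then have "of_nat 2 = (0 :: 'k)" by simp
    then have "p dvd 2" using char_k of_nat_eq_0_iff_char_dvd[where 'a = 'k, of 2] by simp
    then show False using odd prime_p by (metis dvd_refl prime_nat_iff two_is_prime_nat One_nat_def not_prime_1)
  qed
  let ?L = "\<lambda>n. (lie_derived HA ^^ n) (carrier (HA :: ('k, _) module))"
  \<comment> \<open>The three shapes are recovered one term further down from
    \<open>[h,e] / 2\<close>, \<open>- [h,f] / 2\<close> and \<open>[e,f]\<close>; oddness of
    \<open>p\<close> allows the division.\<close>
  have main: "\<exists>De Df Dh. shape re De \<and> shape rf Df \<and> shape rh Dh \<and> cls De \<in> ?L n \<and> cls Df \<in> ?L n \<and> cls Dh \<in> ?L n" for n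
  proof (induction n)
    case 0
    obtain De where De: "shape re De"
      using ex_shape[of te] te tP ef(3,5) cQ by (auto simp: re_def[abs_def] QP_mult[symmetric] induced_coset[symmetric])
    obtain Df where Df: "shape rf Df"
      using ex_shape[of tf] tf tP ef(4,6) cQ by (auto simp: rf_def[abs_def] QP_mult[symmetric] induced_coset[symmetric])
    have "cls d \<in> ?L 0" if "shape r d" for r d
      using that FilD(1)[of 0 d] by (auto simp: shape_def HA_carrier)
    then show ?case using De Df bEF[OF De Df] by blast
  next
    case (Suc n)
    then obtain De Df Dh where D: "shape re De" "shape rf Df" "shape rh Dh"
      "cls De \<in> ?L n" "cls Df \<in> ?L n" "cls Dh \<in> ?L n" by blast
    have dd: "De \<in> ders" "Df \<in> ders" "Dh \<in> ders" using D FilD(1) by (auto simp: shape_def)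
    have "shape re (dscl (inverse 2) (dbr Dh De))"
      by (rule shape_dscl[OF bHE[OF D(3,1)]]) (use two in simp)
    moreover have "shape rf (dscl (inverse (- 2)) (dbr Dh Df))"
      by (rule shape_dscl[OF bHF[OF D(3,2)]]) (use two in simp)
    moreover have "shape rh (dscl 1 (dbr De Df))"
      by (rule shape_dscl[OF bEF[OF D(1,2)]]) simp
    moreover have "cls (dscl c (dbr d d')) \<in> ?L (Suc n)"
      if "d \<in> ders" "d' \<in> ders" "cls d \<in> ?L n" "cls d' \<in> ?L n" for c d d'
      using lie_derived_bracket[OF that] by simp
    ultimately show ?case using dd D(4-6) by meson
  qed
  obtain N where "?L N = {\<zero>\<^bsub>(HA :: ('k, _) module)\<^esub>}" using solv unfolding lie_solvable_def by blast
  then have LN: "?L N = {inn}" by (simp add: HA_zero)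
  \<comment> \<open>In the vanishing term the class of shape \<open>re\<close> is still present, so
    it is inner. By \<open>shape_inner\<close> the map \<open>e\<close> would then be trivial on
    \<open>QP\<close>.\<close>
  obtain De where De: "shape re De" "cls De \<in> ?L N" using main[of N] by blast
  then have "De \<in> ders" "cls De = inn" using LN FilD(1) by (auto simp: shape_def)
  then obtain a where a: "a \<in> KG" "De = ad a" using cls_eqD by blast
  obtain x where x: "x \<in> carrier QP" "e x \<noteq> \<one>\<^bsub>QP\<^esub>" using nz by blast
  then obtain u where u: "u \<in> carrier P" "x = ?c u" by (auto simp: QP_carrier)
  have "te u \<in> Kp"
    using shape_inner[of te a u] De(1) a u tP by (simp add: re_def[abs_def])
  then have "?c (te u) = \<one>\<^bsub>QP\<^esub>" using coset_Kp_one[OF tP(1)[OF u(1)]] by simp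
  then show False using te[OF u(1)] u x by simp
qed

end

theorem theorem7p4:
  fixes p :: nat and P :: "'a monoid" and E :: "'b monoid" and \<phi> :: "'b \<Rightarrow> 'a \<Rightarrow> 'a"
  assumes "Factorial_Ring.prime p" and "CHAR('k::field) = p"
    and "comm_group P" and "finite (carrier P)" and "carrier P \<noteq> {\<one>\<^bsub>P\<^esub>}"
    and "\<exists>n. Coset.order P = p ^ n"
    and "group E" and "finite (carrier E)" and "coprime (Coset.order E) p"
    and "\<phi> \<in> hom E (AutoGroup P)"
    and "action_commutator P E \<phi> = carrier P"
    and "kernel E (AutoGroup P) \<phi> \<subseteq> group_center E"
    and "comm_group (E Mod kernel E (AutoGroup P) \<phi>)"
  shows "(\<forall>C \<in> carrier (HH1 (group_algebra TYPE('k) (semidirect_product P E \<phi>))). \<exists>d\<in>C.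
            d ` carrier (group_algebra TYPE('k) (semidirect_product P E \<phi>))
              \<subseteq> jacobson_radical (group_algebra TYPE('k) (semidirect_product P E \<phi>))) \<and>
         (frattini_quotient_multiplicity_free p P E \<phi> \<longrightarrow>
            lie_solvable (HH1 (group_algebra TYPE('k) (semidirect_product P E \<phi>)))) \<and>
         (odd p \<and> lie_solvable (HH1 (group_algebra TYPE('k) (semidirect_product P E \<phi>))) \<longrightarrow>
            frattini_quotient_multiplicity_free p P E \<phi>)"
proof -
  interpret p'_action_central P E \<phi> p "TYPE('k)"
    by (intro p'_action_central.intro p'_action.intro p'_action_axioms.intro
        p'_action_central_axioms.intro assms)
  have "\<forall>C\<in>carrier (HA :: ('k, _) module). \<exists>d\<in>C. d ` carrier (A :: ('k, _) module) \<subseteq> jacobson_radical A"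
    using HH1_rep_jacobson by blast
  moreover have "frattini_quotient_multiplicity_free p P E \<phi> \<longrightarrow> lie_solvable (HA :: ('k, _) module)"
    using ex_generates solvable_if_generated by blast
  moreover have "odd p \<and> lie_solvable (HA :: ('k, _) module) \<longrightarrow> frattini_quotient_multiplicity_free p P E \<phi>"
    using mfree_if_solvable multiplicity_free_iff by blast
  ultimately show ?thesis unfolding Gr_def by blast
qed

end
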